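(* Let $\nu>0$ be an even integer and consider the Multigrid Monte Carlo V-cycle ($\gamma_\ell=1$ on all levels) with $\nu_1=\nu_2=\nu/2$ smoothing steps, an exact sampler on level $\ell=0$, and the same symmetric invertible splitting matrix $M_\ell=M_\ell^\top$ for pre- and post-smoothing on every level $\ell\ge 1$. Assume the smoothing property $$0<A_\ell\le M_\ell\qquad\text{for all }\ell\ge1,$$ and the approximation property $$\|M_\ell^{1/2}(A_\ell^{-1}-I_{\ell-1}^\ell A_{\ell-1}^{-1}I_\ell^{\ell-1})M_\ell^{1/2}\|_2\le C_A\qquad\text{for all }\ell\geq 1$$ with a constant $C_A>0$ independent of $\ell$. Let $L\ge1$, $f_L\in\mathbb R^{n_L}$ and let $(\theta_L^{(m)})_{m\ge0}$ be the Markov chain $\theta_L^{(m+1)}=\mathrm{MGMC}_L(A_L,f_L,\theta_L^{(m)})$. Then for all $m,s\in\{0,1,2,\dots\}$ $$\|\mathbb E[\theta_L^{(m+1)}]-A_L^{-1}f_L\|_{A_L}\le\frac{C_A}{C_A+\nu}\,\|\mathbb E[\theta_L^{(m)}]-A_L^{-1}f_L\|_{A_L},$$ $$\|A_L^{1/2}\mathrm{Cov}(\theta_L^{(m)})A_L^{1/2}-I\|_2\le\Bigl(\frac{C_A}{C_A+\nu}\Bigr)^{2m}\|A_L^{1/2}\mathrm{Cov}(\theta_L^{(0)})A_L^{1/2}-I\|_2,$$ $$\|\mathrm{Cov}(\theta_L^{(m+s)},\theta_L^{(m)})\|_{A_L}\le\Bigl(\frac{C_A}{C_A+\nu}\Bigr)^{s}\|\mathrm{Cov}(\theta_L^{(m)},\theta_L^{(m)})\|_{A_L}.$$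 Moreover, if $\mathrm{Cov}(\theta_L^{(0)})\ne A_L^{-1}$ (so that the quotient is defined), $$\lim_{m\to\infty}\left(\frac{\|\mathrm{Cov}(\theta_L^{(m)})-A_L^{-1}\|_{A_L}}{\|\mathrm{Cov}(\theta_L^{(0)})-A_L^{-1}\|_{A_L}}\right)^{1/m}\le\Bigl(\frac{C_A}{C_A+\nu}\Bigr)^2 .$$ The constant $C_A$ is independent of $L$.
   Context: Hierarchy: for $\ell=0,1,2,\dots$ let $n_0<n_1<\dots$ be dimensions, $I_{\ell-1}^{\ell}\in\mathbb R^{n_\ell\times n_{\ell-1}}$ (prolongation) matrices of full column rank, $I_\ell^{\ell-1}=(I_{\ell-1}^\ell)^\top$ (restriction), and $A_\ell\in\mathbb R^{n_\ell\times n_\ell}$ symmetric positive definite matrices with $A_{\ell-1}=I_\ell^{\ell-1}A_\ell I_{\ell-1}^\ell$ for all $\ell\ge1$. For symmetric matrices, $A<B$ (resp. $A\le B$) means that $B-A$ is positive definite (resp. semidefinite). $I$ without indices is the identity matrix. Random smoother: $\mathrm{RandomSmoother}(A,M,f,\theta):=\theta+M^{-1}(f+\xi-A\theta)$ with a fresh $\xi\sim\mathcal N(0,M+M^\top-A)$, independent of everything else. MGMC update $\mathrm{MGMC}_\ell(A_\ell,f_\ell,\theta_\ell)$ (V-cycle with exact coarse sampler): if $\ell=0$, return a fresh sample from $\mathcal N(A_0^{-1}f_0,A_0^{-1})$. If $\ell\ge1$: (1) starting from $\theta_\ell$, apply $\nu_1$ times $\theta\mapsto\mathrm{RandomSmoother}(A_\ell,M_\ell,f_\ell,\theta)$,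 giving $\theta_{\ell,\nu_1}$; (2) set $f_{\ell-1}:=I_\ell^{\ell-1}(f_\ell-A_\ell\theta_{\ell,\nu_1})$, $\psi_{\ell-1}:=\mathrm{MGMC}_{\ell-1}(A_{\ell-1},f_{\ell-1},0)$ and $\theta_{\ell,\nu_1+1}:=\theta_{\ell,\nu_1}+I_{\ell-1}^\ell\psi_{\ell-1}$; (3) starting from $\theta_{\ell,\nu_1+1}$ apply $\nu_2$ times the same random smoother and return the result. All random variables drawn are mutually independent and independent of the initial state $\theta_L^{(0)}$, which is a multivariate normal random vector (possibly degenerate, e.g. deterministic). Norms: $\|v\|_{A}:=\|A^{1/2}v\|_2$ for vectors $v$ and $\|X\|_{A}:=\|A^{1/2}XA^{-1/2}\|_2$ for matrices $X$. $\mathrm{Cov}(\theta,\theta'):=\mathbb E[(\theta-\mathbb E\theta)(\theta'-\mathbb E\theta')^\top]$ and $\mathrm{Cov}(\theta):=\mathrm{Cov}(\theta,\theta)$. *)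

theory Defs
  imports
    "HOL-Probability.Probability"
    "Jordan_Normal_Form.DL_Rank"
    "Jordan_Normal_Form.Gauss_Jordan_Elimination"
begin

text \<open>
  Since the dimension varies with the level, matrices and vectors are those of
  Jordan_Normal_Form. The notation of HOL-Analysis for vectors indexed by a type and for the
  inner product is switched off, as it clashes with that library.
\<close>

unbundle no vec_syntax
unbundle no inner_syntax
hide_type (open) Finite_Cartesian_Product.vec
hide_const (open) Finite_Cartesian_Product.vec Finite_Cartesian_Product.mat
  Finite_Cartesian_Product.row Determinants.det Cartesian_Space.rank

section \<open>Matrices\<close>

definition psd :: "real mat \<Rightarrow> bool" where
  "psd A \<longleftrightarrow> square_mat A \<and> transpose_mat A = A \<and>
     (\<forall>v \<in> carrier_vec (dim_row A). 0 \<le> v \<bullet> (A *\<^sub>v v))"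

definition spd :: "real mat \<Rightarrow> bool" where
  "spd A \<longleftrightarrow> square_mat A \<and> transpose_mat A = A \<and>
     (\<forall>v \<in> carrier_vec (dim_row A). v \<noteq> 0\<^sub>v (dim_row A) \<longrightarrow> 0 < v \<bullet> (A *\<^sub>v v))"

definition loewner_le :: "real mat \<Rightarrow> real mat \<Rightarrow> bool" (infix \<open>\<le>\<^sub>L\<close> 50) where
  "A \<le>\<^sub>L B \<longleftrightarrow> psd (B - A)"

definition loewner_less :: "real mat \<Rightarrow> real mat \<Rightarrow> bool" (infix \<open><\<^sub>L\<close> 50) where
  "A <\<^sub>L B \<longleftrightarrow> spd (B - A)"

text \<open>Only meaningful for invertible matrices, as \<open>mat_inverse\<close> is \<open>None\<close> otherwise.\<close>

definition mat_inv :: "real mat \<Rightarrow> real mat" where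
  "mat_inv A = the (mat_inverse A)"

text \<open>The unique positive semidefinite square root of a positive semidefinite matrix.\<close>

definition mat_sqrt :: "real mat \<Rightarrow> real mat" where
  "mat_sqrt A = (THE B. psd B \<and> B * B = A)"

definition norm2 :: "real vec \<Rightarrow> real" where
  "norm2 v = sqrt (v \<bullet> v)"

definition spec_norm :: "real mat \<Rightarrow> real" where
  "spec_norm X = (SUP v \<in> {v \<in> carrier_vec (dim_col X). norm2 v \<le> 1}. norm2 (X *\<^sub>v v))"

definition energy_norm :: "real mat \<Rightarrow> real vec \<Rightarrow> real" where
  "energy_norm A v = norm2 (mat_sqrt A *\<^sub>v v)"

definition energy_mat_norm :: "real mat \<Rightarrow> real mat \<Rightarrow> real" where
  "energy_mat_norm A X = spec_norm (mat_sqrt A * X * mat_inv (mat_sqrt A))"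

section \<open>Random vectors\<close>

text \<open>The Borel \<open>\<sigma>\<close>-algebra of \<open>n\<close>-dimensional space, generated by the coordinate projections.\<close>

definition borel_vec :: "nat \<Rightarrow> real vec measure" where
  "borel_vec n = sigma (carrier_vec n)
     {{v \<in> carrier_vec n. v $ i \<in> B} | i B. i < n \<and> B \<in> sets borel}"

definition mean_vec :: "'w measure \<Rightarrow> nat \<Rightarrow> ('w \<Rightarrow> real vec) \<Rightarrow> real vec" where
  "mean_vec \<Omega> n X = vec n (\<lambda>i. \<integral>\<omega>. X \<omega> $ i \<partial>\<Omega>)"

definition cov_mat :: "'w measure \<Rightarrow> nat \<Rightarrow> ('w \<Rightarrow> real vec) \<Rightarrow> ('w \<Rightarrow> real vec) \<Rightarrow> real mat" where
  "cov_mat \<Omega> n X Y = mat n n (\<lambda>(i, j).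
     \<integral>\<omega>. (X \<omega> - mean_vec \<Omega> n X) $ i * (Y \<omega> - mean_vec \<Omega> n Y) $ j \<partial>\<Omega>)"

text \<open>Univariate normal with mean \<open>m\<close> and variance \<open>v \<ge> 0\<close>; a point mass if \<open>v = 0\<close>.\<close>

definition normal_rv :: "'w measure \<Rightarrow> ('w \<Rightarrow> real) \<Rightarrow> real \<Rightarrow> real \<Rightarrow> bool" where
  "normal_rv \<Omega> X m v \<longleftrightarrow> X \<in> borel_measurable \<Omega> \<and>
     (if v = 0 then AE \<omega> in \<Omega>. X \<omega> = m
      else distributed \<Omega> lborel X (normal_density m (sqrt v)))"

text \<open>Multivariate normal, possibly degenerate: every linear functional is univariate normal.\<close>

definition mvn :: "'w measure \<Rightarrow> nat \<Rightarrow> ('w \<Rightarrow> real vec) \<Rightarrow> real vec \<Rightarrow> real mat \<Rightarrow> bool" where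
  "mvn \<Omega> n X \<mu> \<Sigma> \<longleftrightarrow> X \<in> measurable \<Omega> (borel_vec n) \<and>
     \<mu> \<in> carrier_vec n \<and> \<Sigma> \<in> carrier_mat n n \<and> psd \<Sigma> \<and>
     (\<forall>a \<in> carrier_vec n. normal_rv \<Omega> (\<lambda>\<omega>. a \<bullet> X \<omega>) (a \<bullet> \<mu>) (a \<bullet> (\<Sigma> *\<^sub>v a)))"

section \<open>Multigrid Monte Carlo\<close>

text \<open>
  The randomness enters the algorithm as arguments: \<open>\<xi>\<close> is the noise of a smoothing step, and
  \<open>\<eta>\<close>, distributed as N(0, \<open>A 0\<close> inverse), is the noise of the coarse sampler. As \<open>\<eta>\<close> is
  independent of \<open>f\<close>, the coarse sample \<open>mat_inv (A 0) *\<^sub>v f + \<eta>\<close> is, given \<open>f\<close>, a fresh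
  sample from the normal distribution with mean \<open>mat_inv (A 0) *\<^sub>v f\<close> and covariance
  \<open>mat_inv (A 0)\<close>.
\<close>

definition random_smoother ::
  "real mat \<Rightarrow> real mat \<Rightarrow> real vec \<Rightarrow> real vec \<Rightarrow> real vec \<Rightarrow> real vec" where
  "random_smoother A M f \<xi> \<theta> = \<theta> + mat_inv M *\<^sub>v (f + \<xi> - A *\<^sub>v \<theta>)"

fun smooth :: "real mat \<Rightarrow> real mat \<Rightarrow> real vec \<Rightarrow> (nat \<Rightarrow> real vec) \<Rightarrow> nat \<Rightarrow> real vec \<Rightarrow> real vec" where
  "smooth A M f \<xi> 0 \<theta> = \<theta>"
| "smooth A M f \<xi> (Suc k) \<theta> = random_smoother A M f (\<xi> k) (smooth A M f \<xi> k \<theta>)"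

text \<open>
  One V-cycle. \<open>P l\<close> is the prolongation from level \<open>l - 1\<close> to level \<open>l\<close>, and \<open>\<xi> l k\<close> is
  the noise of the smoothing step number \<open>k < \<nu>1 + \<nu>2\<close> on level \<open>l\<close>, pre-smoothing first.
\<close>

fun mgmc :: "(nat \<Rightarrow> real mat) \<Rightarrow> (nat \<Rightarrow> real mat) \<Rightarrow> (nat \<Rightarrow> real mat) \<Rightarrow> nat \<Rightarrow> nat \<Rightarrow>
    (nat \<Rightarrow> nat \<Rightarrow> real vec) \<Rightarrow> real vec \<Rightarrow> nat \<Rightarrow> real vec \<Rightarrow> real vec \<Rightarrow> real vec" where
  "mgmc A M P \<nu>1 \<nu>2 \<xi> \<eta> 0 f \<theta> = mat_inv (A 0) *\<^sub>v f + \<eta>"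
| "mgmc A M P \<nu>1 \<nu>2 \<xi> \<eta> (Suc l) f \<theta> =
    (let \<theta>1 = smooth (A (Suc l)) (M (Suc l)) f (\<xi> (Suc l)) \<nu>1 \<theta>;
         f' = transpose_mat (P (Suc l)) *\<^sub>v (f - A (Suc l) *\<^sub>v \<theta>1);
         \<psi> = mgmc A M P \<nu>1 \<nu>2 \<xi> \<eta> l f' (0\<^sub>v (dim_row (A l)));
         \<theta>2 = \<theta>1 + P (Suc l) *\<^sub>v \<psi>
     in smooth (A (Suc l)) (M (Suc l)) f (\<lambda>k. \<xi> (Suc l) (\<nu>1 + k)) \<nu>2 \<theta>2)"

text \<open>
  The random vectors entering a chain on level \<open>L\<close>: the initial state, and for the transition
  number \<open>m\<close> the noise of smoothing step \<open>k\<close> on level \<open>l\<close> and the noise of the coarse sampler.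
\<close>

datatype draw = Initial | Smoothing nat nat nat | Coarse nat

definition draws :: "nat \<Rightarrow> nat \<Rightarrow> draw set" where
  "draws \<nu> L = {Initial} \<union> {Smoothing m l k | m l k. 1 \<le> l \<and> l \<le> L \<and> k < \<nu>} \<union> range Coarse"

fun draw_dim :: "(nat \<Rightarrow> nat) \<Rightarrow> nat \<Rightarrow> draw \<Rightarrow> nat" where
  "draw_dim n L Initial = n L"
| "draw_dim n L (Smoothing m l k) = n l"
| "draw_dim n L (Coarse m) = n 0"

end

theory Submission
  imports Defs
begin

text \<open>
  One V-cycle acts on the state as \<open>\<theta> - A\<^sup>-\<^sup>1 f \<mapsto> E (\<theta> - A\<^sup>-\<^sup>1 f) + W\<close>, where \<open>E\<close> is the iteration
  matrix of the deterministic multigrid method and \<open>W\<close> is centred noise, uncorrelated with the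
  state, of covariance \<open>A\<^sup>-\<^sup>1 - E A\<^sup>-\<^sup>1 E\<^sup>T\<close>: smoothing steps and coarse corrections all have
  this form, and the form is closed under composition. Hence the error of the mean is multiplied by
  \<open>E\<close>, the error \<open>Cov \<theta> - A\<^sup>-\<^sup>1\<close> of the covariance is conjugated by \<open>E\<close>, and the lagged
  covariance is multiplied by \<open>E\<close>.

  It remains to bound \<open>E\<close>, which is self-adjoint in the energy inner product. By induction on the
  level, \<open>0 \<le> E \<le> C / (C + \<nu>)\<close> in that inner product, because the coarse correction is controlled by
  the approximation property and \<open>(1 - t)\<^sup>\<nu> (1 + \<nu> t) \<le> 1\<close> on \<open>[0, 1]\<close>.

  The limit in the last claim exists because the Frobenius norms of the symmetrically scaled
  covariance errors form a log-convex sequence.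
\<close>

section \<open>Norms of vectors and matrices\<close>

text \<open>No eigenvalues occur. Positivity and contraction are statements about forms
  \<open>u \<bullet> (A *\<^sub>v v)\<close>, and Cauchy-Schwarz for a semidefinite form takes the
  place of the spectral theorem: it turns form bounds into norm bounds, shows that inversion
  reverses the order, and controls the energy projection. The square roots in the statement come
  from a convergent matrix iteration.

  The obstacle in the induction over levels is that the coarse sampler runs with a right-hand side
  that depends on the current random state. The noise of an update is therefore required to be one
  random vector that serves all \<open>f\<close> and all states; a nested cycle then only adds the
  image of its own noise, and nothing has to be conditioned.

  E need not be symmetric, but X = A^{1/2} E A^{-1/2} is, and all norm estimates are read off from 0
  <= X <= C / (C + \<nu>). The limit is taken for Frobenius norms because they stem from an inner
  product in which F -> X F X is self-adjoint; passing to another norm costs constant factors, whose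
  m-th roots tend to 1.\<close>

lemma norm2_L2_set: "norm2 v = L2_set (\<lambda>i. v $ i) {0..<dim_vec v}"
  by (simp add: norm2_def L2_set_def scalar_prod_def power2_eq_square)

lemma norm2_nonneg [simp]: "0 \<le> norm2 v"
  by (simp add: norm2_L2_set)

lemma scalar_prod_self_nonneg [simp]: "0 \<le> (v :: real vec) \<bullet> v"
  by (simp add: scalar_prod_def sum_nonneg)

lemma norm2_squared: "(norm2 v)\<^sup>2 = v \<bullet> v"
  by (simp add: norm2_def)

lemma norm2_zero [simp]: "norm2 (0\<^sub>v n) = 0"
  by (simp add: norm2_def)

lemma norm2_eq_0_iff: "v \<in> carrier_vec n \<Longrightarrow> norm2 v = 0 \<longleftrightarrow> v = 0\<^sub>v n"
  by (auto simp: norm2_L2_set L2_set_eq_0_iff)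

lemma norm2_smult: "norm2 (c \<cdot>\<^sub>v v) = \<bar>c\<bar> * norm2 v"
proof -
  have "(c \<cdot>\<^sub>v v) \<bullet> (c \<cdot>\<^sub>v v) = c\<^sup>2 * (v \<bullet> v)"
    by (simp add: power2_eq_square)
  then show ?thesis by (simp add: norm2_def real_sqrt_mult)
qed

lemma norm2_triangle:
  assumes "u \<in> carrier_vec n" "v \<in> carrier_vec n"
  shows "norm2 (u + v) \<le> norm2 u + norm2 v"
proof -
  have "norm2 (u + v) = L2_set (\<lambda>i. u $ i + v $ i) {0..<n}"
    unfolding norm2_L2_set using assms by (auto intro!: L2_set_cong)
  then show ?thesis
    using L2_set_triangle_ineq[of "\<lambda>i. u $ i" "\<lambda>i. v $ i" "{0..<n}"] assms
    by (simp add: norm2_L2_set)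
qed

lemma norm2_Cauchy_Schwarz:
  assumes "u \<in> carrier_vec n" "v \<in> carrier_vec n"
  shows "\<bar>u \<bullet> v\<bar> \<le> norm2 u * norm2 v"
proof -
  have "\<bar>u \<bullet> v\<bar> \<le> (\<Sum>i\<in>{0..<n}. \<bar>u $ i\<bar> * \<bar>v $ i\<bar>)"
    unfolding scalar_prod_def using assms by (auto simp: abs_mult intro!: sum_abs[THEN order_trans])
  also have "\<dots> \<le> norm2 u * norm2 v"
    using L2_set_mult_ineq[of "\<lambda>i. u $ i" "\<lambda>i. v $ i" "{0..<n}"] assms by (simp add: norm2_L2_set)
  finally show ?thesis .
qed

lemma norm2_unit_vec: "i < n \<Longrightarrow> norm2 (unit_vec n i) = 1"
  by (simp add: norm2_def)

lemma abs_index_le_norm2: "i < dim_vec v \<Longrightarrow> \<bar>v $ i\<bar> \<le> norm2 v"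
proof -
  assume i: "i < dim_vec v"
  have "\<bar>unit_vec (dim_vec v) i \<bullet> v\<bar> \<le> norm2 (unit_vec (dim_vec v) i) * norm2 v"
    by (rule norm2_Cauchy_Schwarz[of _ "dim_vec v"]) auto
  with i show ?thesis by (simp add: norm2_unit_vec)
qed

text \<open>The Frobenius norm, written as the l2 norm of the row norms so that Cauchy-Schwarz can
  be applied row by row. Here it only serves as some finite bound on a matrix; its inner product
  becomes essential when the limit of the m-th roots is taken.\<close>

definition frob :: "real mat \<Rightarrow> real" where
  "frob X = L2_set (\<lambda>i. norm2 (row X i)) {0..<dim_row X}"

lemma norm2_mult_le_frob:
  assumes "v \<in> carrier_vec (dim_col X)"
  shows "norm2 (X *\<^sub>v v) \<le> frob X * norm2 v"
proof -
  have "norm2 (X *\<^sub>v v) = L2_set (\<lambda>i. \<bar>row X i \<bullet> v\<bar>) {0..<dim_row X}"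
    unfolding norm2_L2_set L2_set_def by (auto intro!: sum.cong)
  also have "\<dots> \<le> L2_set (\<lambda>i. norm2 (row X i) * norm2 v) {0..<dim_row X}"
    by (intro L2_set_mono norm2_Cauchy_Schwarz[of _ "dim_col X"]) (use assms in auto)
  also have "\<dots> = frob X * norm2 v"
    by (simp add: frob_def L2_set_left_distrib)
  finally show ?thesis .
qed

lemma frob_nonneg [simp]: "0 \<le> frob X"
  by (simp add: frob_def)

text \<open>A supremum of reals dominates its members only over a bounded set, so every estimate of
  \<open>norm2 (X *\<^sub>v v)\<close> by \<open>spec_norm X\<close> rests on this fact.\<close>

lemma spec_norm_bdd:
  "bdd_above ((\<lambda>v. norm2 (X *\<^sub>v v)) ` {v \<in> carrier_vec (dim_col X). norm2 v \<le> 1})"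
proof (rule bdd_aboveI2)
  fix v assume v: "v \<in> {v \<in> carrier_vec (dim_col X). norm2 v \<le> 1}"
  then have "norm2 (X *\<^sub>v v) \<le> frob X * norm2 v" by (intro norm2_mult_le_frob) auto
  also have "\<dots> \<le> frob X * 1" using v by (intro mult_left_mono) auto
  finally show "norm2 (X *\<^sub>v v) \<le> frob X" by simp
qed

lemma norm2_mult_le_spec_norm:
  assumes v: "v \<in> carrier_vec (dim_col X)"
  shows "norm2 (X *\<^sub>v v) \<le> spec_norm X * norm2 v"
proof (cases "norm2 v = 0")
  case True
  with v have "v = 0\<^sub>v (dim_col X)" using norm2_eq_0_iff by blast
  then have "X *\<^sub>v v = 0\<^sub>v (dim_row X)" by auto
  then show ?thesis using True by simp
next
  case False
  define w where "w = (1 / norm2 v) \<cdot>\<^sub>v v"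
  have pos: "norm2 v > 0" using False by (simp add: less_le)
  have w: "w \<in> carrier_vec (dim_col X)" "norm2 w = 1"
    using v pos by (auto simp: w_def norm2_smult)
  have "norm2 (X *\<^sub>v w) \<le> spec_norm X"
    unfolding spec_norm_def by (rule cSUP_upper[OF _ spec_norm_bdd]) (use w in auto)
  moreover have "X *\<^sub>v w = (1 / norm2 v) \<cdot>\<^sub>v (X *\<^sub>v v)"
    unfolding w_def by (rule mult_mat_vec) (use v in auto)
  ultimately have "norm2 (X *\<^sub>v v) / norm2 v \<le> spec_norm X"
    by (simp add: norm2_smult)
  then show ?thesis using pos by (simp add: field_simps)
qed

lemma spec_norm_leI:
  assumes "\<And>v. v \<in> carrier_vec (dim_col X) \<Longrightarrow> norm2 (X *\<^sub>v v) \<le> c * norm2 v" and "0 \<le> c"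
  shows "spec_norm X \<le> c"
  unfolding spec_norm_def
proof (rule cSUP_least)
  \<comment> \<open>The zero vector keeps the index set nonempty in every dimension, zero
    included.\<close>
  have "0\<^sub>v (dim_col X) \<in> {v \<in> carrier_vec (dim_col X). norm2 v \<le> 1}" by simp
  then show "{v \<in> carrier_vec (dim_col X). norm2 v \<le> 1} \<noteq> {}" by blast
next
  fix v assume v: "v \<in> {v \<in> carrier_vec (dim_col X). norm2 v \<le> 1}"
  then have "norm2 (X *\<^sub>v v) \<le> c * norm2 v" by (intro assms) auto
  also have "\<dots> \<le> c * 1" using v assms(2) by (intro mult_left_mono) auto
  finally show "norm2 (X *\<^sub>v v) \<le> c" by simp
qed

lemma spec_norm_nonneg [simp]: "0 \<le> spec_norm X"
proof -
  have "norm2 (X *\<^sub>v 0\<^sub>v (dim_col X)) \<le> spec_norm X"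
    unfolding spec_norm_def by (rule cSUP_upper[OF _ spec_norm_bdd]) auto
  then show ?thesis using norm2_nonneg order_trans by blast
qed

lemma spec_norm_mult_le:
  assumes X: "X \<in> carrier_mat k m" and Y: "Y \<in> carrier_mat m n"
  shows "spec_norm (X * Y) \<le> spec_norm X * spec_norm Y"
proof (rule spec_norm_leI)
  fix v :: "real vec" assume "v \<in> carrier_vec (dim_col (X * Y))"
  then have v: "v \<in> carrier_vec n" using Y by simp
  have Yv: "Y *\<^sub>v v \<in> carrier_vec m" using Y v by simp
  have "norm2 (X * Y *\<^sub>v v) = norm2 (X *\<^sub>v (Y *\<^sub>v v))" using X Y v by simp
  also have "\<dots> \<le> spec_norm X * norm2 (Y *\<^sub>v v)"
    using X Yv by (intro norm2_mult_le_spec_norm) auto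
  also have "\<dots> \<le> spec_norm X * (spec_norm Y * norm2 v)"
    using Y v by (intro mult_left_mono norm2_mult_le_spec_norm) auto
  finally show "norm2 (X * Y *\<^sub>v v) \<le> spec_norm X * spec_norm Y * norm2 v" by simp
qed simp

lemma spec_norm_le_frob: "spec_norm X \<le> frob X"
  by (rule spec_norm_leI) (auto intro: norm2_mult_le_frob)

lemma abs_index_le_spec_norm:
  assumes "i < dim_row X" "j < dim_col X"
  shows "\<bar>X $$ (i, j)\<bar> \<le> spec_norm X"
proof -
  have "\<bar>(X *\<^sub>v unit_vec (dim_col X) j) $ i\<bar> \<le> norm2 (X *\<^sub>v unit_vec (dim_col X) j)"
    using assms by (intro abs_index_le_norm2) auto
  also have "\<dots> \<le> spec_norm X * norm2 (unit_vec (dim_col X) j)"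
    by (intro norm2_mult_le_spec_norm) auto
  finally show ?thesis using assms by (simp add: norm2_unit_vec)
qed

text \<open>Each of the two l2 norms is bounded by a sum of absolute values, which costs one factor
  per dimension. The crude constant suffices, as it disappears under the m-th root.\<close>

lemma frob_le_spec_norm: "frob X \<le> real (dim_row X * dim_col X) * spec_norm X"
proof -
  have "norm2 (row X i) \<le> real (dim_col X) * spec_norm X" if "i < dim_row X" for i
  proof -
    have "norm2 (row X i) \<le> (\<Sum>j<dim_col X. \<bar>X $$ (i, j)\<bar>)"
      using L2_set_le_sum_abs[of "\<lambda>j. row X i $ j" "{0..<dim_col X}"] that
      by (simp add: norm2_L2_set atLeast0LessThan)
    also have "\<dots> \<le> (\<Sum>j<dim_col X. spec_norm X)"
      using that by (intro sum_mono abs_index_le_spec_norm) auto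
    finally show ?thesis by simp
  qed
  moreover have "frob X \<le> (\<Sum>i<dim_row X. norm2 (row X i))"
    unfolding frob_def using L2_set_le_sum[of "{0..<dim_row X}" "\<lambda>i. norm2 (row X i)"]
    by (simp add: atLeast0LessThan)
  ultimately have "frob X \<le> (\<Sum>i<dim_row X. real (dim_col X) * spec_norm X)"
    by (meson order_trans sum_mono lessThan_iff)
  then show ?thesis by (simp add: algebra_simps)
qed

section \<open>Symmetric and positive definite matrices\<close>

lemma scalar_prod_mult_mat_vec:
  fixes B :: "real mat"
  assumes "B \<in> carrier_mat k n" "a \<in> carrier_vec k" "v \<in> carrier_vec n"
  shows "a \<bullet> (B *\<^sub>v v) = (B\<^sup>T *\<^sub>v a) \<bullet> v"
  using transpose_vec_mult_scalar[OF assms(1,3,2)] by simp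

lemma vec_eq_by_scalar_prod:
  fixes v w :: "real vec"
  assumes "v \<in> carrier_vec n" "w \<in> carrier_vec n"
    and "\<And>u. u \<in> carrier_vec n \<Longrightarrow> u \<bullet> v = u \<bullet> w"
  shows "v = w"
proof (rule eq_vecI)
  fix i assume "i < dim_vec w"
  then show "v $ i = w $ i" using assms(3)[of "unit_vec n i"] assms(1,2) by simp
qed (use assms in auto)

lemma mat_eq_by_mult_vec:
  fixes X Y :: "real mat"
  assumes "X \<in> carrier_mat m n" "Y \<in> carrier_mat m n"
    and "\<And>v. v \<in> carrier_vec n \<Longrightarrow> X *\<^sub>v v = Y *\<^sub>v v"
  shows "X = Y"
proof (rule eq_matI)
  fix i j assume ij: "i < dim_row Y" "j < dim_col Y"
  have "(X *\<^sub>v unit_vec n j) $ i = (Y *\<^sub>v unit_vec n j) $ i" using assms(3) by simp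
  with ij assms(1,2) show "X $$ (i, j) = Y $$ (i, j)" by simp
qed (use assms in auto)

text \<open>Identities that involve transposes and inverses are reduced to scalars here, since in
  \<open>u \<bullet> (X *\<^sub>v v)\<close> the factors of X can be moved to the other side one at
  a time.\<close>

lemma mat_eq_by_form:
  fixes X Y :: "real mat"
  assumes "X \<in> carrier_mat m n" "Y \<in> carrier_mat m n"
    and "\<And>u v. u \<in> carrier_vec m \<Longrightarrow> v \<in> carrier_vec n \<Longrightarrow> u \<bullet> (X *\<^sub>v v) = u \<bullet> (Y *\<^sub>v v)"
  shows "X = Y"
  using assms by (intro mat_eq_by_mult_vec[of _ m n] vec_eq_by_scalar_prod[of _ m]) auto

lemma symmetric_form:
  fixes A :: "real mat"
  assumes "A \<in> carrier_mat n n" "A\<^sup>T = A" "u \<in> carrier_vec n" "v \<in> carrier_vec n"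
  shows "(A *\<^sub>v u) \<bullet> v = u \<bullet> (A *\<^sub>v v)"
  using transpose_vec_mult_scalar[of A n n v u] assms by simp

lemma symmetric_formI:
  fixes A :: "real mat"
  assumes A: "A \<in> carrier_mat n n"
    and sym: "\<And>u v. u \<in> carrier_vec n \<Longrightarrow> v \<in> carrier_vec n \<Longrightarrow> (A *\<^sub>v u) \<bullet> v = u \<bullet> (A *\<^sub>v v)"
  shows "A\<^sup>T = A"
proof (rule mat_eq_by_form[of _ n n])
  fix u v :: "real vec" assume uv: "u \<in> carrier_vec n" "v \<in> carrier_vec n"
  have "u \<bullet> (A\<^sup>T *\<^sub>v v) = (A\<^sup>T *\<^sub>v v) \<bullet> u"
    using A uv by (intro comm_scalar_prod[of _ n]) auto
  also have "\<dots> = v \<bullet> (A *\<^sub>v u)" using A uv by (intro transpose_vec_mult_scalar) auto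
  also have "\<dots> = (A *\<^sub>v u) \<bullet> v" using A uv by (intro comm_scalar_prod[of _ n]) auto
  finally show "u \<bullet> (A\<^sup>T *\<^sub>v v) = u \<bullet> (A *\<^sub>v v)" using sym uv by simp
qed (use A in auto)

lemma psd_iff:
  assumes "A \<in> carrier_mat n n"
  shows "psd A \<longleftrightarrow> A\<^sup>T = A \<and> (\<forall>v\<in>carrier_vec n. 0 \<le> v \<bullet> (A *\<^sub>v v))"
  using assms by (auto simp: psd_def)

lemma spd_iff:
  assumes "A \<in> carrier_mat n n"
  shows "spd A \<longleftrightarrow>
    A\<^sup>T = A \<and> (\<forall>v\<in>carrier_vec n. v \<noteq> 0\<^sub>v n \<longrightarrow> 0 < v \<bullet> (A *\<^sub>v v))"
  using assms by (auto simp: spd_def)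

lemma spd_imp_psd:
  assumes A: "A \<in> carrier_mat n n" "spd A"
  shows "psd A"
proof -
  have "0 \<le> v \<bullet> (A *\<^sub>v v)" if v: "v \<in> carrier_vec n" for v
  proof (cases "v = 0\<^sub>v n")
    case True
    have "A *\<^sub>v v \<in> carrier_vec n" using A v by simp
    then show ?thesis unfolding True by simp
  next
    case False
    then have "0 < v \<bullet> (A *\<^sub>v v)" using A v by (simp add: spd_iff)
    then show ?thesis by simp
  qed
  then show ?thesis using A by (simp add: psd_iff spd_iff)
qed

text \<open>The form of A at u + t v is a nonnegative polynomial in t, so its discriminant is not
  positive. As A is only semidefinite, the leading coefficient \<open>c\<close> may vanish and needs
  its own case.\<close>

lemma psd_Cauchy_Schwarz:
  fixes A :: "real mat"
  assumes A: "A \<in> carrier_mat n n" "psd A" and u: "u \<in> carrier_vec n" and v: "v \<in> carrier_vec n"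
  shows "(u \<bullet> (A *\<^sub>v v))\<^sup>2 \<le> (u \<bullet> (A *\<^sub>v u)) * (v \<bullet> (A *\<^sub>v v))"
proof -
  define a b c where "a = u \<bullet> (A *\<^sub>v u)" and "b = u \<bullet> (A *\<^sub>v v)" and "c = v \<bullet> (A *\<^sub>v v)"
  have sym: "A\<^sup>T = A" and nonneg: "\<And>v. v \<in> carrier_vec n \<Longrightarrow> 0 \<le> v \<bullet> (A *\<^sub>v v)"
    using A by (auto simp: psd_iff)
  have ba: "v \<bullet> (A *\<^sub>v u) = b"
    using symmetric_form[OF A(1) sym v u] comm_scalar_prod[of "A *\<^sub>v v" n u] A u v
    by (simp add: b_def)
  have quad: "0 \<le> a + 2 * t * b + t\<^sup>2 * c" for t
  proof -
    have "0 \<le> (u + t \<cdot>\<^sub>v v) \<bullet> (A *\<^sub>v (u + t \<cdot>\<^sub>v v))" using u v by (intro nonneg) auto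
    also have "A *\<^sub>v (u + t \<cdot>\<^sub>v v) = A *\<^sub>v u + t \<cdot>\<^sub>v (A *\<^sub>v v)"
      using A u v by (simp add: mult_add_distrib_mat_vec[of A n n] mult_mat_vec[of A n n])
    also have "(u + t \<cdot>\<^sub>v v) \<bullet> \<dots> = a + 2 * t * b + t\<^sup>2 * c"
      using A u v ba
      by (simp add: add_scalar_prod_distrib[of _ n] scalar_prod_add_distrib[of _ n]
          a_def b_def c_def power2_eq_square algebra_simps)
    finally show ?thesis .
  qed
  have "b\<^sup>2 \<le> a * c"
  proof (cases "c = 0")
    case True
    have "b = 0"
    proof (rule ccontr)
      assume "b \<noteq> 0"
      \<comment> \<open>For c = 0 the polynomial is affine in t; at this t its value is -1.\<close>
      with quad[of "- (a + 1) / (2 * b)"] True show False by (simp add: field_simps)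
    qed
    then show ?thesis using True by simp
  next
    case False
    then have "c > 0" using nonneg[OF v] by (simp add: c_def)
    \<comment> \<open>The minimiser of the quadratic.\<close>
    with quad[of "- b / c"] show ?thesis by (simp add: field_simps power2_eq_square)
  qed
  then show ?thesis by (simp add: a_def b_def c_def)
qed

text \<open>With w = X v, Cauchy-Schwarz in the form of X gives |w|^4 = (w X v)^2 <= (w X w) (v X v)
  <= c^2 |w|^2 |v|^2. This replaces the description of the norm of a semidefinite matrix by its
  largest eigenvalue.\<close>

lemma symmetric_spec_norm_le:
  assumes X: "X \<in> carrier_mat n n" "psd X"
    and le: "\<And>v. v \<in> carrier_vec n \<Longrightarrow> v \<bullet> (X *\<^sub>v v) \<le> c * (v \<bullet> v)" and c: "0 \<le> c"
  shows "spec_norm X \<le> c"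
proof (rule spec_norm_leI)
  fix v :: "real vec" assume "v \<in> carrier_vec (dim_col X)"
  then have v: "v \<in> carrier_vec n" using X by simp
  define w where "w = X *\<^sub>v v"
  have w: "w \<in> carrier_vec n" using X v by (simp add: w_def)
  have pos: "0 \<le> v \<bullet> (X *\<^sub>v v)" using X v by (simp add: psd_iff)
  have "((norm2 w)\<^sup>2)\<^sup>2 = (w \<bullet> (X *\<^sub>v v))\<^sup>2" by (simp add: norm2_squared w_def)
  also have "\<dots> \<le> (w \<bullet> (X *\<^sub>v w)) * (v \<bullet> (X *\<^sub>v v))" by (rule psd_Cauchy_Schwarz[OF X w v])
  also have "\<dots> \<le> (c * (w \<bullet> w)) * (c * (v \<bullet> v))"
    by (rule mult_mono) (use le w v pos c in auto)
  also have "\<dots> = (norm2 w)\<^sup>2 * (c * norm2 v)\<^sup>2" by (simp add: norm2_squared[symmetric] power2_eq_square)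
  finally have *: "(norm2 w)\<^sup>2 * (norm2 w)\<^sup>2 \<le> (norm2 w)\<^sup>2 * (c * norm2 v)\<^sup>2"
    by (simp add: power2_eq_square)
  have "norm2 w \<le> c * norm2 v"
  proof (cases "norm2 w = 0")
    case False
    then have "0 < (norm2 w)\<^sup>2" by simp
    with * have "(norm2 w)\<^sup>2 \<le> (c * norm2 v)\<^sup>2" by (simp only: mult_le_cancel_left_pos)
    then show ?thesis using c by (simp add: power2_le_iff_abs_le)
  qed (use c in simp)
  then show "norm2 (X *\<^sub>v v) \<le> c * norm2 v" by (simp add: w_def)
qed (rule c)

text \<open>A definite form has trivial kernel, so the determinant is nonzero and
  \<open>mat_inverse\<close> returns \<open>Some\<close>; only then is the \<open>the\<close> in
  \<open>mat_inv\<close> meaningful.\<close>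

lemma spd_invertible:
  assumes A: "A \<in> carrier_mat n n" and "spd A"
  shows "mat_inv A \<in> carrier_mat n n" "A * mat_inv A = 1\<^sub>m n" "mat_inv A * A = 1\<^sub>m n"
proof -
  have "det A \<noteq> 0"
    using assms by (auto simp: det_0_iff_vec_prod_zero_field[OF A] spd_iff[OF A])
  from det_non_zero_imp_unit[OF A this, of "()"] mat_inverse(1)[OF A, of "()"]
  obtain B where "mat_inverse A = Some B" by (cases "mat_inverse A") auto
  with mat_inverse(2)[OF A]
  show "mat_inv A \<in> carrier_mat n n" "A * mat_inv A = 1\<^sub>m n" "mat_inv A * A = 1\<^sub>m n"
    by (auto simp: mat_inv_def)
qed

lemma spd_inverse_mult_vec:
  assumes A: "A \<in> carrier_mat n n" and "spd A" and v: "v \<in> carrier_vec n"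
  shows "mat_inv A *\<^sub>v v \<in> carrier_vec n" "A *\<^sub>v (mat_inv A *\<^sub>v v) = v"
    "mat_inv A *\<^sub>v (A *\<^sub>v v) = v"
proof -
  note inv = spd_invertible[OF assms(1,2)]
  show "mat_inv A *\<^sub>v v \<in> carrier_vec n" using inv v by simp
  show "A *\<^sub>v (mat_inv A *\<^sub>v v) = v" using assoc_mult_mat_vec[OF A inv(1) v] inv v by simp
  show "mat_inv A *\<^sub>v (A *\<^sub>v v) = v" using assoc_mult_mat_vec[OF inv(1) A v] inv v by simp
qed

text \<open>Writing v = A w turns the form of A^-1 at v into the form of A at w.\<close>

lemma spd_inverse:
  assumes A: "A \<in> carrier_mat n n" "spd A"
  shows "spd (mat_inv A)"
proof -
  note inv = spd_invertible[OF A] and inv_vec = spd_inverse_mult_vec[OF A]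
  have sym: "A\<^sup>T = A" using A by (simp add: spd_iff)
  have 1: "(mat_inv A)\<^sup>T = mat_inv A"
  proof (rule symmetric_formI[OF inv(1)])
    fix u v :: "real vec" assume uv: "u \<in> carrier_vec n" "v \<in> carrier_vec n"
    have "(mat_inv A *\<^sub>v u) \<bullet> v = (mat_inv A *\<^sub>v u) \<bullet> (A *\<^sub>v (mat_inv A *\<^sub>v v))"
      using inv_vec uv by simp
    also have "\<dots> = u \<bullet> (mat_inv A *\<^sub>v v)"
      using symmetric_form[OF A(1) sym, of "mat_inv A *\<^sub>v u" "mat_inv A *\<^sub>v v"] inv_vec uv by simp
    finally show "(mat_inv A *\<^sub>v u) \<bullet> v = u \<bullet> (mat_inv A *\<^sub>v v)" .
  qed
  have 2: "0 < v \<bullet> (mat_inv A *\<^sub>v v)" if v: "v \<in> carrier_vec n" "v \<noteq> 0\<^sub>v n" for v :: "real vec"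
  proof -
    define w where "w = mat_inv A *\<^sub>v v"
    have w: "w \<in> carrier_vec n" "A *\<^sub>v w = v" using inv_vec v by (auto simp: w_def)
    have "w \<noteq> 0\<^sub>v n" using w v A by auto
    then have "0 < w \<bullet> (A *\<^sub>v w)" using A w by (auto simp: spd_iff)
    also have "w \<bullet> (A *\<^sub>v w) = v \<bullet> w" using w v comm_scalar_prod[of w n v] by simp
    finally show ?thesis by (simp add: w_def)
  qed
  show ?thesis using 1 2 inv by (simp add: spd_iff)
qed

section \<open>The square root of a positive definite matrix\<close>

lemma spec_norm_add_le:
  assumes "X \<in> carrier_mat m n" "Y \<in> carrier_mat m n"
  shows "spec_norm (X + Y) \<le> spec_norm X + spec_norm Y"
proof (rule spec_norm_leI)
  fix v :: "real vec" assume "v \<in> carrier_vec (dim_col (X + Y))"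
  then have v: "v \<in> carrier_vec n" using assms by simp
  have "norm2 ((X + Y) *\<^sub>v v) = norm2 (X *\<^sub>v v + Y *\<^sub>v v)"
    using assms v by (simp add: add_mult_distrib_mat_vec[of X m n])
  also have "\<dots> \<le> norm2 (X *\<^sub>v v) + norm2 (Y *\<^sub>v v)"
    using assms v by (intro norm2_triangle[of _ m]) auto
  also have "\<dots> \<le> spec_norm X * norm2 v + spec_norm Y * norm2 v"
    using assms v by (intro add_mono norm2_mult_le_spec_norm) auto
  finally show "norm2 ((X + Y) *\<^sub>v v) \<le> (spec_norm X + spec_norm Y) * norm2 v"
    by (simp add: algebra_simps)
qed (simp add: add_nonneg_nonneg)

lemma smult_mat_mult_vec:
  fixes X :: "real mat"
  assumes "v \<in> carrier_vec (dim_col X)"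
  shows "(c \<cdot>\<^sub>m X) *\<^sub>v v = c \<cdot>\<^sub>v (X *\<^sub>v v)"
  using assms by (intro eq_vecI) auto

lemma spec_norm_smult_le: "spec_norm (c \<cdot>\<^sub>m X) \<le> \<bar>c\<bar> * spec_norm X"
proof (rule spec_norm_leI)
  fix v :: "real vec" assume "v \<in> carrier_vec (dim_col (c \<cdot>\<^sub>m X))"
  then have v: "v \<in> carrier_vec (dim_col X)" by simp
  then show "norm2 ((c \<cdot>\<^sub>m X) *\<^sub>v v) \<le> \<bar>c\<bar> * spec_norm X * norm2 v"
    using mult_left_mono[OF norm2_mult_le_spec_norm[OF v], of "\<bar>c\<bar>"]
    by (simp add: smult_mat_mult_vec norm2_smult mult.assoc)
qed simp

section \<open>Entrywise limits of square matrices\<close>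

definition mat_tendsto :: "nat \<Rightarrow> (nat \<Rightarrow> real mat) \<Rightarrow> real mat \<Rightarrow> bool" where
  "mat_tendsto n Y Z \<longleftrightarrow> (\<forall>i<n. \<forall>j<n. (\<lambda>k. Y k $$ (i, j)) \<longlonglongrightarrow> Z $$ (i, j))"

lemma mat_tendsto_mult:
  assumes "mat_tendsto n Y Z" "mat_tendsto n Y' Z'"
    and "\<And>k. Y k \<in> carrier_mat n n" "\<And>k. Y' k \<in> carrier_mat n n"
    and "Z \<in> carrier_mat n n" "Z' \<in> carrier_mat n n"
  shows "mat_tendsto n (\<lambda>k. Y k * Y' k) (Z * Z')"
  unfolding mat_tendsto_def
proof (intro allI impI)
  fix i j assume ij: "i < n" "j < n"
  have eq: "(X * X') $$ (i, j) = (\<Sum>l\<in>{0..<n}. X $$ (i, l) * X' $$ (l, j))"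
    if "X \<in> carrier_mat n n" "X' \<in> carrier_mat n n" for X X' :: "real mat"
    using that ij by (auto simp: scalar_prod_def)
  have "(\<lambda>k. \<Sum>l\<in>{0..<n}. Y k $$ (i, l) * Y' k $$ (l, j))
      \<longlonglongrightarrow> (\<Sum>l\<in>{0..<n}. Z $$ (i, l) * Z' $$ (l, j))"
    using assms(1,2) ij by (intro tendsto_sum tendsto_mult) (auto simp: mat_tendsto_def)
  then show "(\<lambda>k. (Y k * Y' k) $$ (i, j)) \<longlonglongrightarrow> (Z * Z') $$ (i, j)"
    using assms(3-6) by (simp add: eq)
qed

lemma mat_tendsto_unique:
  assumes "mat_tendsto n Y Z" "mat_tendsto n Y Z'" "Z \<in> carrier_mat n n" "Z' \<in> carrier_mat n n"
  shows "Z = Z'"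
proof (rule eq_matI)
  fix i j assume "i < dim_row Z'" "j < dim_col Z'"
  then have "i < n" "j < n" using assms(4) by auto
  then have "(\<lambda>k. Y k $$ (i, j)) \<longlonglongrightarrow> Z $$ (i, j)" "(\<lambda>k. Y k $$ (i, j)) \<longlonglongrightarrow> Z' $$ (i, j)"
    using assms(1,2) by (auto simp: mat_tendsto_def)
  then show "Z $$ (i, j) = Z' $$ (i, j)" by (rule LIMSEQ_unique)
qed (use assms in auto)

lemma mat_tendsto_const: "mat_tendsto n (\<lambda>_. Z) Z"
  by (simp add: mat_tendsto_def)

lemma mat_tendsto_form:
  assumes Y: "mat_tendsto n Y Z" "\<And>k. Y k \<in> carrier_mat n n" "Z \<in> carrier_mat n n"
    and u: "u \<in> carrier_vec n" and v: "v \<in> carrier_vec n"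
  shows "(\<lambda>k. u \<bullet> (Y k *\<^sub>v v)) \<longlonglongrightarrow> u \<bullet> (Z *\<^sub>v v)"
proof -
  have eq: "u \<bullet> (X *\<^sub>v v) = (\<Sum>i\<in>{0..<n}. u $ i * (\<Sum>j\<in>{0..<n}. X $$ (i, j) * v $ j))"
    if "X \<in> carrier_mat n n" for X :: "real mat"
    using that u v by (auto simp: scalar_prod_def intro!: sum.cong)
  show ?thesis
    unfolding eq[OF Y(2)] eq[OF Y(3)]
    using Y(1) by (intro tendsto_sum tendsto_mult tendsto_const) (auto simp: mat_tendsto_def)
qed

text \<open>The increments are dominated by a geometric series and telescope to x m - x 0.\<close>

lemma convergent_of_geometric_increments:
  fixes x :: "nat \<Rightarrow> real"
  assumes "\<And>k. \<bar>x (Suc k) - x k\<bar> \<le> q ^ k" "0 \<le> q" "q < 1"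
  shows "convergent x"
proof -
  have "summable (\<lambda>k. x (Suc k) - x k)"
  proof (rule summable_comparison_test'[where g = "\<lambda>k. q ^ k" and N = 0])
    show "summable (\<lambda>k. q ^ k)" using assms(2,3) by (intro summable_geometric) simp
    show "norm (x (Suc k) - x k) \<le> q ^ k" for k using assms(1) by simp
  qed
  then have "convergent (\<lambda>m. x m - x 0)"
    by (simp add: summable_iff_convergent sum_lessThan_telescope)
  then have "convergent (\<lambda>m. (x m - x 0) + x 0)"
    by (intro convergent_add convergent_const)
  then show ?thesis by simp
qed

text \<open>If \<open>Y\<close> solves \<open>2 Y = B + Y\<^sup>2\<close> then \<open>1 - Y\<close> is a square root of \<open>1 - B\<close>.\<close>

fun sqrt_iter :: "real mat \<Rightarrow> nat \<Rightarrow> real mat" where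
  "sqrt_iter B 0 = 0\<^sub>m (dim_row B) (dim_row B)"
| "sqrt_iter B (Suc k) = (1 / 2) \<cdot>\<^sub>m (B + sqrt_iter B k * sqrt_iter B k)"

lemma sqrt_iter_carrier: "B \<in> carrier_mat n n \<Longrightarrow> sqrt_iter B k \<in> carrier_mat n n"
  by (induction k) auto

text \<open>The ball of radius q is invariant under the iteration: (q + q^2) / 2 <= q because q <
  1.\<close>

lemma spec_norm_sqrt_iter:
  assumes B: "B \<in> carrier_mat n n" and q: "spec_norm B \<le> q" "q < 1"
  shows "spec_norm (sqrt_iter B k) \<le> q"
proof (induction k)
  case 0
  have "spec_norm (0\<^sub>m n n) \<le> 0"
  proof (rule spec_norm_leI)
    fix v :: "real vec" assume "v \<in> carrier_vec (dim_col (0\<^sub>m n n :: real mat))"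
    then have "0\<^sub>m n n *\<^sub>v v = 0\<^sub>v n" by (intro eq_vecI) auto
    then show "norm2 (0\<^sub>m n n *\<^sub>v v) \<le> 0 * norm2 v" by simp
  qed simp
  moreover have "0 \<le> q" using q spec_norm_nonneg[of B] by linarith
  ultimately show ?case using B by simp
next
  case (Suc k)
  let ?Y = "sqrt_iter B k"
  note Y = sqrt_iter_carrier[OF B, of k]
  have "0 \<le> q" using q spec_norm_nonneg[of B] by linarith
  have "spec_norm (?Y * ?Y) \<le> spec_norm ?Y * spec_norm ?Y" by (rule spec_norm_mult_le[OF Y Y])
  also have "\<dots> \<le> q * 1" using Suc q \<open>0 \<le> q\<close> by (intro mult_mono) auto
  finally have "spec_norm (?Y * ?Y) \<le> q" by simp
  then have "spec_norm (B + ?Y * ?Y) \<le> q + q"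
    using spec_norm_add_le[OF B, of "?Y * ?Y"] Y q by auto
  then show ?case using spec_norm_smult_le[of "1/2" "B + ?Y * ?Y"] by simp
qed

text \<open>With consecutive iterates Y, Z and D = Z - Y, the next increment is (Z^2 - Y^2) / 2 = (Z
  D + D Y) / 2, a splitting that uses no commutativity. Both iterates have norm at most q, so the
  increments shrink by the factor q.\<close>

lemma sqrt_iter_increment:
  assumes B: "B \<in> carrier_mat n n" and q: "spec_norm B \<le> q" "q < 1"
  shows "spec_norm (sqrt_iter B (Suc k) - sqrt_iter B k) \<le> q ^ k"
proof (induction k)
  case 0
  have "sqrt_iter B (Suc 0) - sqrt_iter B 0 = sqrt_iter B (Suc 0)"
    using B sqrt_iter_carrier[OF B, of "Suc 0"] by (intro eq_matI) auto
  then show ?case using spec_norm_sqrt_iter[OF assms, of "Suc 0"] q by simp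
next
  case (Suc k)
  let ?Y = "sqrt_iter B k" and ?Z = "sqrt_iter B (Suc k)"
  note Y = sqrt_iter_carrier[OF B, of k] and Z = sqrt_iter_carrier[OF B, of "Suc k"]
  define D where "D = ?Z - ?Y"
  have D: "D \<in> carrier_mat n n" unfolding D_def by (rule minus_carrier_mat[OF Y])
  have "0 \<le> q" using q spec_norm_nonneg[of B] by linarith
  have "sqrt_iter B (Suc (Suc k)) - ?Z = (1 / 2) \<cdot>\<^sub>m (?Z * ?Z - ?Y * ?Y)"
    unfolding sqrt_iter.simps(2)[of B "Suc k"] using B Y Z
    by (intro eq_matI) (auto simp: sqrt_iter.simps(2)[of B k] field_simps simp del: index_mult_mat(1))
  also have "?Z * ?Z - ?Y * ?Y = ?Z * D + D * ?Y"
  proof -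
    have "?Z * D = ?Z * ?Z - ?Z * ?Y" "D * ?Y = ?Z * ?Y - ?Y * ?Y"
      unfolding D_def using Y Z
      by (simp_all only: mult_minus_distrib_mat[OF Z Z Y] minus_mult_distrib_mat[OF Z Y Y])
    then show ?thesis using Y Z by (intro eq_matI) (auto simp del: index_mult_mat(1))
  qed
  finally have eq: "sqrt_iter B (Suc (Suc k)) - ?Z = (1 / 2) \<cdot>\<^sub>m (?Z * D + D * ?Y)" .
  have IH: "spec_norm D \<le> q ^ k" using Suc by (simp add: D_def)
  have "spec_norm (?Z * D) \<le> q * q ^ k"
    by (rule order_trans[OF spec_norm_mult_le[OF Z D]], rule mult_mono)
      (use IH spec_norm_sqrt_iter[OF assms, of "Suc k"] \<open>0 \<le> q\<close> in auto)
  moreover have "spec_norm (D * ?Y) \<le> q ^ k * q"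
    by (rule order_trans[OF spec_norm_mult_le[OF D Y]], rule mult_mono)
      (use IH spec_norm_sqrt_iter[OF assms, of k] \<open>0 \<le> q\<close> in auto)
  moreover have "spec_norm (?Z * D + D * ?Y) \<le> spec_norm (?Z * D) + spec_norm (D * ?Y)"
    using Y Z D by (intro spec_norm_add_le[of _ n n]) auto
  ultimately have "spec_norm (?Z * D + D * ?Y) \<le> 2 * q ^ Suc k"
    by (simp del: sqrt_iter.simps add: mult.commute)
  then show ?case
    unfolding eq using spec_norm_smult_le[of "1/2" "?Z * D + D * ?Y"] by simp
qed

lemma smult_commutes:
  fixes X C :: "real mat"
  assumes "X \<in> carrier_mat n n" "C \<in> carrier_mat n n" "C * X = X * C"
  shows "C * (c \<cdot>\<^sub>m X) = (c \<cdot>\<^sub>m X) * C"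
  using assms mult_smult_distrib[of C n n X n c] mult_smult_assoc_mat[of X n n C n c] by simp

text \<open>Every iterate is a polynomial in B. The commutation survives in the limit and is what
  makes the square root unique.\<close>

lemma sqrt_iter_commutes:
  assumes B: "B \<in> carrier_mat n n" and C: "C \<in> carrier_mat n n" "C * B = B * C"
  shows "C * sqrt_iter B k = sqrt_iter B k * C"
proof (induction k)
  case 0
  then show ?case using B C by simp
next
  case (Suc k)
  let ?Y = "sqrt_iter B k"
  note Y = sqrt_iter_carrier[OF B, of k]
  have YY: "?Y * ?Y \<in> carrier_mat n n" using Y by simp
  have "C * (?Y * ?Y) = (C * ?Y) * ?Y" using C Y by (simp add: assoc_mult_mat[of C n n])
  also have "\<dots> = ?Y * (C * ?Y)" using C Y Suc by (simp add: assoc_mult_mat[of _ n n _ n _ n])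
  also have "\<dots> = (?Y * ?Y) * C" using C Y Suc by (simp add: assoc_mult_mat[of _ n n _ n _ n])
  finally have "C * (B + ?Y * ?Y) = (B + ?Y * ?Y) * C"
    using B C YY by (simp add: mult_add_distrib_mat[of C n n] add_mult_distrib_mat[of B n n])
  then show ?case using B C YY by (simp add: smult_commutes[of _ n])
qed

lemma sqrt_iter_symmetric:
  assumes B: "B \<in> carrier_mat n n" "B\<^sup>T = B"
  shows "(sqrt_iter B k)\<^sup>T = sqrt_iter B k"
proof (induction k)
  case 0
  then show ?case using B by simp
next
  case (Suc k)
  note Y = sqrt_iter_carrier[OF B(1), of k]
  have "(c \<cdot>\<^sub>m X)\<^sup>T = c \<cdot>\<^sub>m X\<^sup>T" for c and X :: "real mat"
    by (intro eq_matI) auto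
  then show ?case
    using B Y Suc by (simp add: transpose_add[of B n n] transpose_mult[OF Y Y])
qed

text \<open>Increments bounded by q^k make every entry converge, and symmetry, the fixed-point
  equation, the form bound and commutation all pass to the limit. The bound by q < 1 is what will
  make 1 - Y positive definite.\<close>

lemma sqrt_iter_limit:
  assumes B: "B \<in> carrier_mat n n" "B\<^sup>T = B" and q: "spec_norm B \<le> q" "q < 1"
  obtains Y where "Y \<in> carrier_mat n n" "Y\<^sup>T = Y"
    "Y = (1 / 2) \<cdot>\<^sub>m (B + Y * Y)" "\<And>v. v \<in> carrier_vec n \<Longrightarrow> v \<bullet> (Y *\<^sub>v v) \<le> q * (v \<bullet> v)"
    "\<And>C. C \<in> carrier_mat n n \<Longrightarrow> C * B = B * C \<Longrightarrow> C * Y = Y * C"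
proof -
  let ?Y = "sqrt_iter B"
  note carr = sqrt_iter_carrier[OF B(1)]
  have "0 \<le> q" using q spec_norm_nonneg[of B] by linarith
  \<comment> \<open>\<open>lim\<close> carries information only if the entry converges, which the
    next fact establishes.\<close>
  define Y where "Y = mat n n (\<lambda>(i, j). lim (\<lambda>k. ?Y k $$ (i, j)))"
  have Y: "Y \<in> carrier_mat n n" by (simp add: Y_def)
  have lim: "mat_tendsto n ?Y Y"
    unfolding mat_tendsto_def
  proof (intro allI impI)
    fix i j assume ij: "i < n" "j < n"
    have "convergent (\<lambda>k. ?Y k $$ (i, j))"
    proof (rule convergent_of_geometric_increments[OF _ \<open>0 \<le> q\<close> q(2)])
      fix k
      have "\<bar>(?Y (Suc k) - ?Y k) $$ (i, j)\<bar> \<le> spec_norm (?Y (Suc k) - ?Y k)"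
        using carr[of k] carr[of "Suc k"] ij by (intro abs_index_le_spec_norm) auto
      also have "\<dots> \<le> q ^ k" by (rule sqrt_iter_increment[OF B(1) q])
      finally show "\<bar>?Y (Suc k) $$ (i, j) - ?Y k $$ (i, j)\<bar> \<le> q ^ k"
        using carr[of k] carr[of "Suc k"] ij by (simp del: sqrt_iter.simps)
    qed
    then show "(\<lambda>k. ?Y k $$ (i, j)) \<longlonglongrightarrow> Y $$ (i, j)"
      using ij by (simp add: Y_def convergent_LIMSEQ_iff)
  qed
  have symY: "Y\<^sup>T = Y"
  proof (rule mat_tendsto_unique[OF _ lim])
    have "?Y k $$ (j, i) = (?Y k)\<^sup>T $$ (i, j)" if "i < n" "j < n" for i j k
      using carr[of k] that by simp
    then have sym: "?Y k $$ (j, i) = ?Y k $$ (i, j)" if "i < n" "j < n" for i j k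
      using that by (simp add: sqrt_iter_symmetric[OF B])
    then show "mat_tendsto n ?Y (Y\<^sup>T)"
      unfolding mat_tendsto_def
    proof (intro allI impI)
      fix i j assume ij: "i < n" "j < n"
      have "(\<lambda>k. ?Y k $$ (j, i)) \<longlonglongrightarrow> Y $$ (j, i)" using lim ij by (simp add: mat_tendsto_def)
      with sym[OF ij] show "(\<lambda>k. ?Y k $$ (i, j)) \<longlonglongrightarrow> Y\<^sup>T $$ (i, j)"
        using Y ij by simp
    qed
  qed (use Y in auto)
  have fix_Y: "Y = (1 / 2) \<cdot>\<^sub>m (B + Y * Y)"
  proof (rule mat_tendsto_unique)
    show "mat_tendsto n (\<lambda>k. ?Y (Suc k)) Y"
      using lim by (auto simp: mat_tendsto_def simp del: sqrt_iter.simps intro: LIMSEQ_Suc)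
    have "mat_tendsto n (\<lambda>k. ?Y k * ?Y k) (Y * Y)"
      by (rule mat_tendsto_mult[OF lim lim carr carr Y Y])
    then have "mat_tendsto n (\<lambda>k. (1 / 2) \<cdot>\<^sub>m (B + ?Y k * ?Y k)) ((1 / 2) \<cdot>\<^sub>m (B + Y * Y))"
      using B Y carrier_matD[OF carr]
      by (auto simp: mat_tendsto_def simp del: index_mult_mat(1) intro!: tendsto_intros)
    then show "mat_tendsto n (\<lambda>k. ?Y (Suc k)) ((1 / 2) \<cdot>\<^sub>m (B + Y * Y))" by simp
  qed (use B Y in auto)
  have bound: "v \<bullet> (Y *\<^sub>v v) \<le> q * (v \<bullet> v)" if v: "v \<in> carrier_vec n" for v
  proof (rule LIMSEQ_le_const2[OF mat_tendsto_form[OF lim carr Y v v]], intro exI allI impI)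
    fix k
    have "v \<bullet> (?Y k *\<^sub>v v) \<le> norm2 v * norm2 (?Y k *\<^sub>v v)"
      using norm2_Cauchy_Schwarz[of v n "?Y k *\<^sub>v v"] carr[of k] v by auto
    also have "\<dots> \<le> norm2 v * (spec_norm (?Y k) * norm2 v)"
      using carr[of k] v by (intro mult_left_mono norm2_mult_le_spec_norm) auto
    also have "\<dots> \<le> norm2 v * (q * norm2 v)"
      using spec_norm_sqrt_iter[OF B(1) q] by (intro mult_left_mono mult_right_mono) auto
    also have "\<dots> = q * (v \<bullet> v)" by (simp add: norm2_squared[symmetric] power2_eq_square)
    finally show "v \<bullet> (?Y k *\<^sub>v v) \<le> q * (v \<bullet> v)" .
  qed
  have comm: "C * Y = Y * C" if C: "C \<in> carrier_mat n n" "C * B = B * C" for C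
  proof (rule mat_tendsto_unique)
    show "mat_tendsto n (\<lambda>k. C * ?Y k) (C * Y)"
      using mat_tendsto_mult[OF mat_tendsto_const lim] C carr Y by blast
    show "mat_tendsto n (\<lambda>k. C * ?Y k) (Y * C)"
      unfolding sqrt_iter_commutes[OF B(1) C]
      using mat_tendsto_mult[OF lim mat_tendsto_const] C carr Y by blast
  qed (use C Y in auto)
  show ?thesis by (rule that[OF Y symY fix_Y bound comm])
qed

text \<open>The upper bound is Cauchy-Schwarz with the spectral norm. For the lower one put w = A^-1
  v: then (v v)^2 = (v A w)^2 <= (v A v) (w A w), and w A w = v A^-1 v is at most s (v v). Adding 1
  to the norms makes the constants strictly positive.\<close>

lemma spd_bounds:
  assumes A: "A \<in> carrier_mat n n" "spd A"
  obtains c d where "0 < c" "0 < d" "\<And>v. v \<in> carrier_vec n \<Longrightarrow> v \<bullet> (A *\<^sub>v v) \<le> c * (v \<bullet> v)"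
    "\<And>v. v \<in> carrier_vec n \<Longrightarrow> d * (v \<bullet> v) \<le> v \<bullet> (A *\<^sub>v v)"
proof -
  note inv = spd_invertible[OF A] and inv_vec = spd_inverse_mult_vec[OF A]
  have bound: "v \<bullet> (X *\<^sub>v v) \<le> (spec_norm X + 1) * (v \<bullet> v)"
    if X: "X \<in> carrier_mat n n" and v: "v \<in> carrier_vec n" for X v
  proof -
    have "v \<bullet> (X *\<^sub>v v) \<le> norm2 v * norm2 (X *\<^sub>v v)"
      using norm2_Cauchy_Schwarz[of v n "X *\<^sub>v v"] X v by auto
    also have "\<dots> \<le> norm2 v * (spec_norm X * norm2 v)"
      using X v by (intro mult_left_mono norm2_mult_le_spec_norm) auto
    also have "\<dots> \<le> norm2 v * ((spec_norm X + 1) * norm2 v)"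
      by (intro mult_left_mono mult_right_mono) auto
    also have "\<dots> = (spec_norm X + 1) * (v \<bullet> v)"
      by (simp add: norm2_squared[symmetric] power2_eq_square)
    finally show ?thesis .
  qed
  define s where "s = spec_norm (mat_inv A) + 1"
  have s: "0 < s" by (simp add: s_def add_nonneg_pos)
  have "1 / s * (v \<bullet> v) \<le> v \<bullet> (A *\<^sub>v v)" if v: "v \<in> carrier_vec n" for v
  proof -
    let ?w = "mat_inv A *\<^sub>v v"
    have pos: "0 \<le> v \<bullet> (A *\<^sub>v v)" using spd_imp_psd[OF A] A v by (simp add: psd_iff)
    have "(v \<bullet> v)\<^sup>2 = (v \<bullet> (A *\<^sub>v ?w))\<^sup>2" using inv_vec v by simp
    also have "\<dots> \<le> (v \<bullet> (A *\<^sub>v v)) * (?w \<bullet> (A *\<^sub>v ?w))"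
      using inv_vec v by (intro psd_Cauchy_Schwarz[OF A(1) spd_imp_psd[OF A]]) auto
    also have "?w \<bullet> (A *\<^sub>v ?w) = v \<bullet> (mat_inv A *\<^sub>v v)"
      using inv_vec v by (simp add: comm_scalar_prod[of _ n])
    also have "(v \<bullet> (A *\<^sub>v v)) * \<dots> \<le> (v \<bullet> (A *\<^sub>v v)) * (s * (v \<bullet> v))"
      unfolding s_def by (rule mult_left_mono[OF bound[OF inv(1) v] pos])
    finally have *: "(v \<bullet> v) * (v \<bullet> v) \<le> (v \<bullet> v) * (s * (v \<bullet> (A *\<^sub>v v)))"
      by (simp add: power2_eq_square algebra_simps)
    have "v \<bullet> v \<le> s * (v \<bullet> (A *\<^sub>v v))"
    proof (cases "v \<bullet> v = 0")
      case False
      then have "0 < v \<bullet> v" using scalar_prod_self_nonneg[of v] by linarith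
      with * show ?thesis by (simp only: mult_le_cancel_left_pos)
    qed (use pos s in simp)
    then show ?thesis using s by (simp add: field_simps)
  qed
  then show ?thesis
    using that[of "spec_norm A + 1" "1 / s"] bound[OF A(1)] s
    by (simp add: add_nonneg_pos)
qed

lemma index_symmetric:
  assumes "A \<in> carrier_mat n n" "A\<^sup>T = A" "i < n" "j < n"
  shows "A $$ (j, i) = A $$ (i, j)"
proof -
  have "A $$ (j, i) = A\<^sup>T $$ (i, j)" using assms(1,3,4) by simp
  then show ?thesis by (simp add: assms(2))
qed

text \<open>Scaling gives A = c (1 - B) with 0 <= B <= q < 1, so the fixed point Y of the iteration
  for B yields the root sqrt c (1 - Y).\<close>

lemma spd_sqrt_exists:
  assumes A: "A \<in> carrier_mat n n" "spd A"
  obtains R where "R \<in> carrier_mat n n" "spd R" "R * R = A"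
    "\<And>C. C \<in> carrier_mat n n \<Longrightarrow> C * A = A * C \<Longrightarrow> C * R = R * C"
proof -
  have symA: "A\<^sup>T = A" using A by (simp add: spd_iff)
  obtain c d where c: "0 < c" and d: "0 < d"
    and upper: "\<And>v. v \<in> carrier_vec n \<Longrightarrow> v \<bullet> (A *\<^sub>v v) \<le> c * (v \<bullet> v)"
    and lower: "\<And>v. v \<in> carrier_vec n \<Longrightarrow> d * (v \<bullet> v) \<le> v \<bullet> (A *\<^sub>v v)"
    using spd_bounds[OF A] by blast
  define B where "B = 1\<^sub>m n - (1 / c) \<cdot>\<^sub>m A"
  \<comment> \<open>In dimension zero the two form bounds are vacuous and do not imply d <= c; the
    maximum keeps q nonnegative there too.\<close>
  define q where "q = max 0 (1 - d / c)"
  have q: "0 \<le> q" "q < 1" "1 - d / c \<le> q" using c d by (auto simp: q_def)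
  have B: "B \<in> carrier_mat n n" using A by (auto simp: B_def)
  have B_vec: "B *\<^sub>v v = v - (1 / c) \<cdot>\<^sub>v (A *\<^sub>v v)" if "v \<in> carrier_vec n" for v
    unfolding B_def using A that
    by (subst minus_mult_distrib_mat_vec[of _ n n]) (auto simp: smult_mat_mult_vec)
  have symB: "B\<^sup>T = B"
    unfolding B_def using A(1) index_symmetric[OF A(1) symA] by (intro eq_matI) auto
  have formB: "v \<bullet> (B *\<^sub>v v) = v \<bullet> v - (1 / c) * (v \<bullet> (A *\<^sub>v v))" if "v \<in> carrier_vec n" for v
    using A that by (simp add: B_vec scalar_prod_minus_distrib[of _ n])
  have "psd B"
    using upper c symB by (auto simp: psd_iff[OF B] formB field_simps)
  moreover have "v \<bullet> (B *\<^sub>v v) \<le> q * (v \<bullet> v)" if v: "v \<in> carrier_vec n" for v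
  proof -
    have "v \<bullet> (B *\<^sub>v v) \<le> (1 - d / c) * (v \<bullet> v)"
      using lower[OF v] c v by (simp add: formB field_simps)
    also have "\<dots> \<le> q * (v \<bullet> v)" using q by (intro mult_right_mono) auto
    finally show ?thesis .
  qed
  ultimately have "spec_norm B \<le> q" using B q by (intro symmetric_spec_norm_le[of _ n]) auto
  then obtain Y where Y: "Y \<in> carrier_mat n n" "Y\<^sup>T = Y"
    and fixY: "Y = (1 / 2) \<cdot>\<^sub>m (B + Y * Y)"
    and leY: "\<And>v. v \<in> carrier_vec n \<Longrightarrow> v \<bullet> (Y *\<^sub>v v) \<le> q * (v \<bullet> v)"
    and comm: "\<And>C. C \<in> carrier_mat n n \<Longrightarrow> C * B = B * C \<Longrightarrow> C * Y = Y * C"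
    using sqrt_iter_limit[OF B symB _ q(2)] by metis
  define R where "R = sqrt c \<cdot>\<^sub>m (1\<^sub>m n - Y)"
  have R: "R \<in> carrier_mat n n" using Y by (auto simp: R_def)
  have R_vec: "R *\<^sub>v v = sqrt c \<cdot>\<^sub>v (v - Y *\<^sub>v v)" if "v \<in> carrier_vec n" for v
    unfolding R_def using Y that
    by (subst smult_mat_mult_vec) (auto simp: minus_mult_distrib_mat_vec[of _ n n])
  have symR: "R\<^sup>T = R"
    unfolding R_def using Y(1) index_symmetric[OF Y(1,2)] by (intro eq_matI) auto
  have "0 < v \<bullet> (R *\<^sub>v v)" if v: "v \<in> carrier_vec n" "v \<noteq> 0\<^sub>v n" for v
  proof -
    have "v \<bullet> v \<noteq> 0" using v norm2_eq_0_iff[OF v(1)] by (auto simp: norm2_def)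
    then have pos: "0 < v \<bullet> v" using scalar_prod_self_nonneg[of v] by linarith
    have "v \<bullet> (R *\<^sub>v v) = sqrt c * (v \<bullet> v - v \<bullet> (Y *\<^sub>v v))"
      using Y v by (simp add: R_vec scalar_prod_minus_distrib[of _ n])
    moreover have "v \<bullet> (Y *\<^sub>v v) < v \<bullet> v"
      using leY[OF v(1)] mult_strict_right_mono[OF q(2) pos] by linarith
    ultimately show ?thesis using c by simp
  qed
  then have spdR: "spd R" using symR by (simp add: spd_iff[OF R])
  have RR: "R * R = A"
  proof (rule mat_eq_by_mult_vec[of _ n n])
    fix v :: "real vec" assume v: "v \<in> carrier_vec n"
    \<comment> \<open>The fixed-point equation in the shape needed to expand the square: (1 - Y)^2 =
      1 - 2 Y + Y^2 = 1 - B = A / c.\<close>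
    have YY: "2 \<cdot>\<^sub>v (Y *\<^sub>v v) = B *\<^sub>v v + Y *\<^sub>v (Y *\<^sub>v v)"
    proof -
      have "Y *\<^sub>v v = (1 / 2) \<cdot>\<^sub>v (B *\<^sub>v v + Y *\<^sub>v (Y *\<^sub>v v))"
        using B Y v by (subst fixY) (simp add: smult_mat_mult_vec add_mult_distrib_mat_vec[of _ n n])
      then have "2 \<cdot>\<^sub>v (Y *\<^sub>v v) = 2 \<cdot>\<^sub>v ((1 / 2) \<cdot>\<^sub>v (B *\<^sub>v v + Y *\<^sub>v (Y *\<^sub>v v)))"
        by (rule arg_cong)
      then show ?thesis by (simp add: smult_smult_assoc)
    qed
    have "(R * R) *\<^sub>v v = R *\<^sub>v (R *\<^sub>v v)" using R v by simp
    also have "\<dots> = c \<cdot>\<^sub>v ((v - Y *\<^sub>v v) - Y *\<^sub>v (v - Y *\<^sub>v v))"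
    proof -
      have "R *\<^sub>v (R *\<^sub>v v) = sqrt c \<cdot>\<^sub>v (R *\<^sub>v (v - Y *\<^sub>v v))"
        using R Y v by (subst R_vec[OF v], subst mult_mat_vec[of R n n]) auto
      also have "\<dots> = (sqrt c * sqrt c) \<cdot>\<^sub>v ((v - Y *\<^sub>v v) - Y *\<^sub>v (v - Y *\<^sub>v v))"
        using Y v by (subst R_vec) (auto simp: smult_smult_assoc)
      finally show ?thesis using c by simp
    qed
    also have "Y *\<^sub>v (v - Y *\<^sub>v v) = Y *\<^sub>v v - Y *\<^sub>v (Y *\<^sub>v v)"
      using Y v by (simp add: mult_minus_distrib_mat_vec[of Y n n])
    also have "c \<cdot>\<^sub>v ((v - Y *\<^sub>v v) - (Y *\<^sub>v v - Y *\<^sub>v (Y *\<^sub>v v))) = A *\<^sub>v v"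
    proof (rule eq_vecI)
      fix i assume "i < dim_vec (A *\<^sub>v v)"
      then have i: "i < n" using A by simp
      have "2 * (Y *\<^sub>v v) $ i = (B *\<^sub>v v) $ i + (Y *\<^sub>v (Y *\<^sub>v v)) $ i"
        using arg_cong[OF YY, of "\<lambda>x. x $ i"] i B Y by (simp del: index_mult_mat_vec)
      moreover have "(B *\<^sub>v v) $ i = v $ i - (A *\<^sub>v v) $ i / c"
        using i v A by (simp add: B_vec del: index_mult_mat_vec)
      ultimately show "(c \<cdot>\<^sub>v ((v - Y *\<^sub>v v) - (Y *\<^sub>v v - Y *\<^sub>v (Y *\<^sub>v v)))) $ i = (A *\<^sub>v v) $ i"
        using i v Y c by (simp del: index_mult_mat_vec add: field_simps)
    qed (use A Y in auto)
    finally show "(R * R) *\<^sub>v v = A *\<^sub>v v" .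
  qed (use A R in auto)
  have commR: "C * R = R * C" if C: "C \<in> carrier_mat n n" "C * A = A * C" for C
  proof -
    have one: "C * 1\<^sub>m n = 1\<^sub>m n * C" using C by simp
    have minus: "C * (X - X') = (X - X') * C"
      if "X \<in> carrier_mat n n" "X' \<in> carrier_mat n n" "C * X = X * C" "C * X' = X' * C" for X X'
      using that C by (simp add: mult_minus_distrib_mat[of C n n] minus_mult_distrib_mat[of X n n])
    have "C * B = B * C" unfolding B_def
      using A C one by (intro minus smult_commutes[of _ n]) auto
    then show ?thesis unfolding R_def
      using Y C one comm by (intro minus smult_commutes[of _ n]) auto
  qed
  show ?thesis by (rule that[OF R spdR RR commR])
qed

text \<open>Uniqueness is what justifies the \<open>THE\<close>. A second root S commutes with S^2 =
  A, hence with R. For w = (R - S) v this gives (R + S) w = 0, so the nonnegative terms w R w and w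
  S w add up to zero, and w = 0 since R is definite.\<close>

lemma mat_sqrt_spd:
  assumes A: "A \<in> carrier_mat n n" "spd A"
  shows "mat_sqrt A \<in> carrier_mat n n" "spd (mat_sqrt A)" "mat_sqrt A * mat_sqrt A = A"
proof -
  obtain R where R: "R \<in> carrier_mat n n" "spd R" "R * R = A"
    and comm: "\<And>C. C \<in> carrier_mat n n \<Longrightarrow> C * A = A * C \<Longrightarrow> C * R = R * C"
    using spd_sqrt_exists[OF A] by metis
  have "mat_sqrt A = R"
    unfolding mat_sqrt_def
  proof (rule the_equality)
    show "psd R \<and> R * R = A" using R spd_imp_psd by blast
  next
    fix S assume S: "psd S \<and> S * S = A"
    \<comment> \<open>\<open>mat_sqrt\<close> ranges over matrices of every size, so the dimension
      of S has to be read off from S S = A.\<close>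
    have "dim_row S = n" "dim_col S = n" using S A by (auto simp: psd_def)
    then have S_carr: "S \<in> carrier_mat n n" by auto
    have "S * A = A * S" using S assoc_mult_mat[OF S_carr S_carr S_carr] by simp
    from comm[OF S_carr this] have SR: "S * R = R * S" .
    show "S = R"
    proof (rule mat_eq_by_mult_vec[of _ n n])
      fix v :: "real vec" assume v: "v \<in> carrier_vec n"
      define w where "w = R *\<^sub>v v - S *\<^sub>v v"
      have w: "w \<in> carrier_vec n" using R S_carr v by (simp add: w_def)
      have Rw: "R *\<^sub>v w = A *\<^sub>v v - (R * S) *\<^sub>v v"
        unfolding R(3)[symmetric] using R(1) S_carr v
        by (simp add: w_def mult_minus_distrib_mat_vec[of R n n])
      have "S *\<^sub>v w = (S * R) *\<^sub>v v - (S * S) *\<^sub>v v"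
        using R S_carr v unfolding w_def by (simp add: mult_minus_distrib_mat_vec[of S n n])
      then have Sw: "S *\<^sub>v w = (R * S) *\<^sub>v v - A *\<^sub>v v" using S SR by simp
      have "w \<bullet> (R *\<^sub>v w) + w \<bullet> (S *\<^sub>v w) = 0"
        using R S_carr v w A by (simp add: Rw Sw scalar_prod_minus_distrib[of _ n])
      moreover have "0 \<le> w \<bullet> (S *\<^sub>v w)" using S S_carr w by (simp add: psd_iff)
      ultimately have "\<not> 0 < w \<bullet> (R *\<^sub>v w)" by simp
      then have "w = 0\<^sub>v n" using R w spd_iff[OF R(1)] by blast
      then have "(R *\<^sub>v v - S *\<^sub>v v) $ i = 0" if "i < n" for i using that by (simp add: w_def)
      then show "S *\<^sub>v v = R *\<^sub>v v"
        using R S_carr by (intro eq_vecI) (auto simp del: index_mult_mat_vec)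
    qed (use S_carr R in auto)
  qed
  with R show "mat_sqrt A \<in> carrier_mat n n" "spd (mat_sqrt A)" "mat_sqrt A * mat_sqrt A = A"
    by auto
qed

section \<open>Convergence of the V-cycle in the energy norm\<close>

text \<open>A matrix power unfolds with the new factor on the right; the induction for
  self-adjointness also needs to split it off on the left.\<close>

lemma pow_mat_mult_vec:
  fixes S :: "real mat"
  assumes S: "S \<in> carrier_mat n n" and v: "v \<in> carrier_vec n"
  shows "S ^\<^sub>m k *\<^sub>v v \<in> carrier_vec n" "S ^\<^sub>m 0 *\<^sub>v v = v"
    "S ^\<^sub>m Suc k *\<^sub>v v = S ^\<^sub>m k *\<^sub>v (S *\<^sub>v v)"
    "S ^\<^sub>m Suc k *\<^sub>v v = S *\<^sub>v (S ^\<^sub>m k *\<^sub>v v)"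
proof -
  note Sk = pow_carrier_mat[OF S]
  show "S ^\<^sub>m k *\<^sub>v v \<in> carrier_vec n" using Sk[of k] v by simp
  show "S ^\<^sub>m 0 *\<^sub>v v = v" using S v by simp
  show *: "S ^\<^sub>m Suc k *\<^sub>v v = S ^\<^sub>m k *\<^sub>v (S *\<^sub>v v)"
    using assoc_mult_mat_vec[OF Sk[of k] S v] by simp
  show "S ^\<^sub>m Suc k *\<^sub>v v = S *\<^sub>v (S ^\<^sub>m k *\<^sub>v v)"
    using v
  proof (induction k arbitrary: v)
    case 0
    then show ?case using S by simp
  next
    case (Suc k)
    have Sv: "S *\<^sub>v v \<in> carrier_vec n" using S Suc.prems by simp
    have "S ^\<^sub>m Suc (Suc k) *\<^sub>v v = S ^\<^sub>m Suc k *\<^sub>v (S *\<^sub>v v)"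
      using assoc_mult_mat_vec[OF Sk[of "Suc k"] S Suc.prems] by simp
    also have "\<dots> = S *\<^sub>v (S ^\<^sub>m k *\<^sub>v (S *\<^sub>v v))" by (rule Suc.IH[OF Sv])
    also have "S ^\<^sub>m k *\<^sub>v (S *\<^sub>v v) = S ^\<^sub>m Suc k *\<^sub>v v"
      using assoc_mult_mat_vec[OF Sk[of k] S Suc.prems] by simp
    finally show ?case .
  qed
qed

text \<open>Self-adjointness and 0 <= E <= \<delta> in the energy inner product, stated through
  forms of A so that no square root of A enters the induction over levels.\<close>

definition energy_contraction :: "nat \<Rightarrow> real mat \<Rightarrow> real mat \<Rightarrow> real \<Rightarrow> bool" where
  "energy_contraction n A E \<delta> \<longleftrightarrow> E \<in> carrier_mat n n \<and>
     (\<forall>u\<in>carrier_vec n. \<forall>v\<in>carrier_vec n. (E *\<^sub>v u) \<bullet> (A *\<^sub>v v) = u \<bullet> (A *\<^sub>v (E *\<^sub>v v))) \<and>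
     (\<forall>v\<in>carrier_vec n. 0 \<le> v \<bullet> (A *\<^sub>v (E *\<^sub>v v)) \<and>
        v \<bullet> (A *\<^sub>v (E *\<^sub>v v)) \<le> \<delta> * (v \<bullet> (A *\<^sub>v v)))"

definition smoother_mat :: "real mat \<Rightarrow> real mat \<Rightarrow> real mat" where
  "smoother_mat A M = 1\<^sub>m (dim_row A) - mat_inv M * A"

text \<open>Error propagation of a coarse correction by an inexact solver. A coarse iteration with
  iteration matrix \<open>Ec\<close>, started at zero on the residual r, returns (1 - Ec) Ac^-1 r.
  For Ec = 0 and under the Galerkin relation this is one minus the energy projection onto the range
  of \<open>P\<close>.\<close>

definition coarse_mat :: "real mat \<Rightarrow> real mat \<Rightarrow> real mat \<Rightarrow> real mat \<Rightarrow> real mat" where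
  "coarse_mat A P Ac Ec =
     1\<^sub>m (dim_row A) - P * ((1\<^sub>m (dim_row Ac) - Ec) * (mat_inv Ac * (P\<^sup>T * A)))"

text \<open>Level 0 gets the zero matrix since the exact sampler forgets its starting state.\<close>

fun vcycle_mat :: "(nat \<Rightarrow> real mat) \<Rightarrow> (nat \<Rightarrow> real mat) \<Rightarrow> (nat \<Rightarrow> real mat) \<Rightarrow> nat \<Rightarrow> nat \<Rightarrow> real mat"
  where
  "vcycle_mat A M P h 0 = 0\<^sub>m (dim_row (A 0)) (dim_row (A 0))"
| "vcycle_mat A M P h (Suc l) =
     smoother_mat (A (Suc l)) (M (Suc l)) ^\<^sub>m h *
     (coarse_mat (A (Suc l)) (P (Suc l)) (A l) (vcycle_mat A M P h l) *
      smoother_mat (A (Suc l)) (M (Suc l)) ^\<^sub>m h)"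

lemma smoother_mat_mult_vec:
  assumes A: "A \<in> carrier_mat n n" and M: "M \<in> carrier_mat n n" "spd M"
  shows "smoother_mat A M \<in> carrier_mat n n"
    "v \<in> carrier_vec n \<Longrightarrow> smoother_mat A M *\<^sub>v v = v - mat_inv M *\<^sub>v (A *\<^sub>v v)"
proof -
  note Mi = spd_invertible(1)[OF M]
  show "smoother_mat A M \<in> carrier_mat n n"
    unfolding smoother_mat_def using A Mi by (auto intro!: minus_carrier_mat)
  show "v \<in> carrier_vec n \<Longrightarrow> smoother_mat A M *\<^sub>v v = v - mat_inv M *\<^sub>v (A *\<^sub>v v)"
    unfolding smoother_mat_def using A Mi
    by (subst minus_mult_distrib_mat_vec[of _ n n]) auto
qed

lemma coarse_mat_mult_vec:
  assumes A: "A \<in> carrier_mat n n" and P: "P \<in> carrier_mat n k"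
    and Ac: "Ac \<in> carrier_mat k k" "spd Ac" and Ec: "Ec \<in> carrier_mat k k"
  shows "coarse_mat A P Ac Ec \<in> carrier_mat n n"
    "v \<in> carrier_vec n \<Longrightarrow> y = mat_inv Ac *\<^sub>v (P\<^sup>T *\<^sub>v (A *\<^sub>v v)) \<Longrightarrow>
       coarse_mat A P Ac Ec *\<^sub>v v = v - P *\<^sub>v (y - Ec *\<^sub>v y)"
proof -
  note Aci = spd_invertible(1)[OF Ac]
  have PT: "P\<^sup>T \<in> carrier_mat k n" using P by simp
  have 1: "mat_inv Ac * (P\<^sup>T * A) \<in> carrier_mat k n" using Aci PT A by simp
  have 2: "1\<^sub>m k - Ec \<in> carrier_mat k k" using Ec by (rule minus_carrier_mat)
  show "coarse_mat A P Ac Ec \<in> carrier_mat n n"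
    unfolding coarse_mat_def using A P Ac 1 2 by (auto intro!: minus_carrier_mat)
  assume v: "v \<in> carrier_vec n" and y: "y = mat_inv Ac *\<^sub>v (P\<^sup>T *\<^sub>v (A *\<^sub>v v))"
  have yc: "y \<in> carrier_vec k" using y Aci by (simp add: carrier_vecI)
  have "coarse_mat A P Ac Ec *\<^sub>v v =
      v - (P * ((1\<^sub>m k - Ec) * (mat_inv Ac * (P\<^sup>T * A)))) *\<^sub>v v"
    unfolding coarse_mat_def using A P Ac v 1 2
    by (subst minus_mult_distrib_mat_vec[of _ n n]) auto
  also have "(P * ((1\<^sub>m k - Ec) * (mat_inv Ac * (P\<^sup>T * A)))) *\<^sub>v v =
      P *\<^sub>v ((1\<^sub>m k - Ec) *\<^sub>v ((mat_inv Ac * (P\<^sup>T * A)) *\<^sub>v v))"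
    using assoc_mult_mat_vec[OF P mult_carrier_mat[OF 2 1] v] assoc_mult_mat_vec[OF 2 1 v] by simp
  also have "(mat_inv Ac * (P\<^sup>T * A)) *\<^sub>v v = y"
    using assoc_mult_mat_vec[OF Aci mult_carrier_mat[OF PT A] v] assoc_mult_mat_vec[OF PT A v] y by simp
  also have "(1\<^sub>m k - Ec) *\<^sub>v y = y - Ec *\<^sub>v y"
    using Ec yc by (subst minus_mult_distrib_mat_vec[of _ k k]) auto
  finally show "coarse_mat A P Ac Ec *\<^sub>v v = v - P *\<^sub>v (y - Ec *\<^sub>v y)" .
qed

text \<open>For x = M^-1 v and y = A^-1 v, Cauchy-Schwarz in the form of A gives (x v)^2 = (x A y)^2
  <= (x A x) (y A y) <= (x v) (y v), where x A x <= x M x = x v. It remains to divide by x v; if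
  that is zero, y v >= 0 suffices.\<close>

lemma inverse_antimono:
  assumes A: "A \<in> carrier_mat n n" "spd A" and M: "M \<in> carrier_mat n n" "spd M"
    and le: "\<And>v. v \<in> carrier_vec n \<Longrightarrow> v \<bullet> (A *\<^sub>v v) \<le> v \<bullet> (M *\<^sub>v v)" and v: "v \<in> carrier_vec n"
  shows "v \<bullet> (mat_inv M *\<^sub>v v) \<le> v \<bullet> (mat_inv A *\<^sub>v v)"
proof -
  define x y where "x = mat_inv M *\<^sub>v v" and "y = mat_inv A *\<^sub>v v"
  have x: "x \<in> carrier_vec n" "M *\<^sub>v x = v" using spd_inverse_mult_vec[OF M v] by (auto simp: x_def)
  have y: "y \<in> carrier_vec n" "A *\<^sub>v y = v" using spd_inverse_mult_vec[OF A v] by (auto simp: y_def)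
  have nonneg: "0 \<le> x \<bullet> v" using spd_imp_psd[OF M] x by (simp add: psd_iff[OF M(1)] flip: x(2))
  have "(x \<bullet> v)\<^sup>2 = (x \<bullet> (A *\<^sub>v y))\<^sup>2" using y by simp
  also have "\<dots> \<le> (x \<bullet> (A *\<^sub>v x)) * (y \<bullet> (A *\<^sub>v y))"
    by (rule psd_Cauchy_Schwarz[OF A(1) spd_imp_psd[OF A] x(1) y(1)])
  also have "\<dots> \<le> (x \<bullet> v) * (y \<bullet> v)"
  proof (rule mult_mono)
    show "x \<bullet> (A *\<^sub>v x) \<le> x \<bullet> v" using le[OF x(1)] x(2) by simp
    show "0 \<le> y \<bullet> (A *\<^sub>v y)" using spd_imp_psd[OF A] y(1) by (simp only: psd_iff[OF A(1)])
  qed (use y nonneg in auto)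
  finally have *: "(x \<bullet> v) * (x \<bullet> v) \<le> (x \<bullet> v) * (y \<bullet> v)" by (simp add: power2_eq_square)
  have "0 \<le> y \<bullet> v" using spd_imp_psd[OF A] y by (simp add: psd_iff[OF A(1)] flip: y(2))
  then have "x \<bullet> v \<le> y \<bullet> v"
  proof (cases "x \<bullet> v = 0")
    case False
    then have "0 < x \<bullet> v" using nonneg by simp
    with * show ?thesis by (simp only: mult_le_cancel_left_pos)
  qed simp
  then show ?thesis
    using x y v comm_scalar_prod[of v n x] comm_scalar_prod[of v n y] by (simp add: x_def y_def)
qed

section \<open>Powers of the smoother and the two-level estimate\<close>

context
  fixes n :: nat and A M :: "real mat"
  assumes A: "A \<in> carrier_mat n n" "spd A" and M: "M \<in> carrier_mat n n" "spd M"
    and AM: "\<And>v. v \<in> carrier_vec n \<Longrightarrow> v \<bullet> (A *\<^sub>v v) \<le> v \<bullet> (M *\<^sub>v v)"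
begin

abbreviation (input) "S \<equiv> smoother_mat A M"

text \<open>Both sides are u A v minus the symmetric expression (A u) M^-1 (A v).\<close>

lemma smoother_selfadjoint:
  assumes u: "u \<in> carrier_vec n" and v: "v \<in> carrier_vec n"
  shows "(S *\<^sub>v u) \<bullet> (A *\<^sub>v v) = u \<bullet> (A *\<^sub>v (S *\<^sub>v v))"
proof -
  note Mi = spd_invertible(1)[OF M]
  have symA: "A\<^sup>T = A" using A by (simp add: spd_iff)
  have symM: "(mat_inv M)\<^sup>T = mat_inv M" using spd_inverse[OF M] Mi by (simp add: spd_iff)
  have "(mat_inv M *\<^sub>v (A *\<^sub>v u)) \<bullet> (A *\<^sub>v v) = (A *\<^sub>v u) \<bullet> (mat_inv M *\<^sub>v (A *\<^sub>v v))"
    using A u v by (intro symmetric_form[OF Mi symM]) auto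
  also have "\<dots> = u \<bullet> (A *\<^sub>v (mat_inv M *\<^sub>v (A *\<^sub>v v)))"
    using A Mi u v by (intro symmetric_form[OF A(1) symA]) auto
  finally show ?thesis
    using A Mi u v smoother_mat_mult_vec[OF A(1) M]
    by (simp add: minus_scalar_prod_distrib[of _ n] mult_minus_distrib_mat_vec[of A n n]
        scalar_prod_minus_distrib[of _ n])
qed

lemma smoother_pow_selfadjoint:
  assumes "u \<in> carrier_vec n" "v \<in> carrier_vec n"
  shows "(S ^\<^sub>m k *\<^sub>v u) \<bullet> (A *\<^sub>v v) = u \<bullet> (A *\<^sub>v (S ^\<^sub>m k *\<^sub>v v))"
  using assms
proof (induction k arbitrary: u v)
  case 0
  note S = smoother_mat_mult_vec(1)[OF A(1) M]
  then show ?case using 0 by (simp only: pow_mat_mult_vec[OF S])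
next
  case (Suc k)
  note S = smoother_mat_mult_vec(1)[OF A(1) M]
  have "(S ^\<^sub>m Suc k *\<^sub>v u) \<bullet> (A *\<^sub>v v) = (S *\<^sub>v u) \<bullet> (A *\<^sub>v (S ^\<^sub>m k *\<^sub>v v))"
    using Suc S by (simp only: pow_mat_mult_vec(3)[OF S]) simp
  also have "\<dots> = u \<bullet> (A *\<^sub>v (S *\<^sub>v (S ^\<^sub>m k *\<^sub>v v)))"
    using Suc.prems pow_mat_mult_vec(1)[OF S] by (intro smoother_selfadjoint) auto
  also have "S *\<^sub>v (S ^\<^sub>m k *\<^sub>v v) = S ^\<^sub>m Suc k *\<^sub>v v"
    using Suc.prems by (simp only: pow_mat_mult_vec(4)[OF S])
  finally show ?case .
qed

text \<open>By self-adjointness the form of S^(k+2) at v is the form of S^k at S v, so an induction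
  in steps of two leaves k = 0 and k = 1. The latter says A M^-1 A <= A, which is
  \<open>inverse_antimono\<close> applied to A v.\<close>

lemma smoother_pow_nonneg:
  assumes "v \<in> carrier_vec n"
  shows "0 \<le> v \<bullet> (A *\<^sub>v (S ^\<^sub>m k *\<^sub>v v))"
  using assms
proof (induction k arbitrary: v rule: induct_nat_012)
  case 0
  note S = smoother_mat_mult_vec(1)[OF A(1) M]
  show ?case using 0 spd_imp_psd[OF A] by (simp only: pow_mat_mult_vec[OF S] psd_iff[OF A(1)])
next
  case 1
  note S = smoother_mat_mult_vec(1)[OF A(1) M] and Mi = spd_invertible(1)[OF M]
  have symA: "A\<^sup>T = A" using A by (simp add: spd_iff)
  let ?w = "A *\<^sub>v v"
  have w: "?w \<in> carrier_vec n" using A 1 by simp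
  have "S ^\<^sub>m Suc 0 *\<^sub>v v = v - mat_inv M *\<^sub>v ?w"
    using 1 S pow_mat_mult_vec(3)[OF S 1, of 0] smoother_mat_mult_vec[OF A(1) M] by simp
  then have "v \<bullet> (A *\<^sub>v (S ^\<^sub>m Suc 0 *\<^sub>v v)) = v \<bullet> ?w - v \<bullet> (A *\<^sub>v (mat_inv M *\<^sub>v ?w))"
    using A 1 Mi w
    by (simp add: mult_minus_distrib_mat_vec[of A n n] scalar_prod_minus_distrib[of _ n])
  also have "v \<bullet> (A *\<^sub>v (mat_inv M *\<^sub>v ?w)) = ?w \<bullet> (mat_inv M *\<^sub>v ?w)"
    using 1 Mi w by (intro symmetric_form[OF A(1) symA, symmetric]) auto
  also have "v \<bullet> ?w = ?w \<bullet> (mat_inv A *\<^sub>v ?w)"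
    using 1 w spd_inverse_mult_vec[OF A] by (simp add: comm_scalar_prod[of _ n])
  finally show ?case using inverse_antimono[OF A M AM w] by simp
next
  case (ge2 k)
  note S = smoother_mat_mult_vec(1)[OF A(1) M]
  have Sv: "S *\<^sub>v v \<in> carrier_vec n" using S ge2.prems by simp
  have "v \<bullet> (A *\<^sub>v (S ^\<^sub>m Suc (Suc k) *\<^sub>v v)) = v \<bullet> (A *\<^sub>v (S *\<^sub>v (S ^\<^sub>m k *\<^sub>v (S *\<^sub>v v))))"
    using pow_mat_mult_vec(4)[OF S ge2.prems, of "Suc k"] pow_mat_mult_vec(3)[OF S ge2.prems, of k]
    by simp
  also have "\<dots> = (S *\<^sub>v v) \<bullet> (A *\<^sub>v (S ^\<^sub>m k *\<^sub>v (S *\<^sub>v v)))"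
    using ge2.prems Sv pow_mat_mult_vec(1)[OF S] by (intro smoother_selfadjoint[symmetric]) auto
  finally show ?case using ge2.IH(1)[OF Sv] by simp
qed

text \<open>The operator form of \<open>(1 - t)\<^sup>k (1 + k t) \<le> 1\<close> on \<open>[0, 1]\<close>: the left-hand side decreases
  in \<open>k\<close> by \<open>(k + 1) t\<^sup>2 (1 - t)\<^sup>k\<close>.\<close>

lemma smoother_moments:
  assumes v: "v \<in> carrier_vec n"
  defines "p \<equiv> \<lambda>k. v \<bullet> (A *\<^sub>v (S ^\<^sub>m k *\<^sub>v v))"
  shows "p k + real k * (p k - p (Suc k)) \<le> p 0"
proof (induction k)
  case 0
  then show ?case by simp
next
  case (Suc k)
  note S = smoother_mat_mult_vec(1)[OF A(1) M]
  have Sv: "S *\<^sub>v v \<in> carrier_vec n" using S v by simp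
  have Sk: "S ^\<^sub>m k *\<^sub>v w \<in> carrier_vec n" if "w \<in> carrier_vec n" for w k
    using that by (rule pow_mat_mult_vec(1)[OF S])
  have 1: "(S *\<^sub>v v) \<bullet> (A *\<^sub>v (S ^\<^sub>m j *\<^sub>v v)) = p (Suc j)" for j
    using smoother_selfadjoint[OF v Sk[OF v]] pow_mat_mult_vec(4)[OF S v] by (simp add: p_def)
  have 2: "x \<bullet> (A *\<^sub>v (S ^\<^sub>m j *\<^sub>v (v - S *\<^sub>v v))) =
      x \<bullet> (A *\<^sub>v (S ^\<^sub>m j *\<^sub>v v)) - x \<bullet> (A *\<^sub>v (S ^\<^sub>m Suc j *\<^sub>v v))" if "x \<in> carrier_vec n" for x j
    unfolding pow_mat_mult_vec(3)[OF S v] using that A v Sv Sk pow_carrier_mat[OF S]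
    by (simp add: mult_minus_distrib_mat_vec[of _ n n] scalar_prod_minus_distrib[of _ n])
  \<comment> \<open>With t = 1 - S, the term t^2 (1 - t)^k is the form of S^k at v - S v; expanded,
    it is the second difference of \<open>p\<close>.\<close>
  have "0 \<le> (v - S *\<^sub>v v) \<bullet> (A *\<^sub>v (S ^\<^sub>m k *\<^sub>v (v - S *\<^sub>v v)))"
    using v Sv by (intro smoother_pow_nonneg) auto
  also have "\<dots> = v \<bullet> (A *\<^sub>v (S ^\<^sub>m k *\<^sub>v (v - S *\<^sub>v v))) - (S *\<^sub>v v) \<bullet> (A *\<^sub>v (S ^\<^sub>m k *\<^sub>v (v - S *\<^sub>v v)))"
    using A v Sv Sk by (intro minus_scalar_prod_distrib[of _ n]) auto
  also have "\<dots> = p k - 2 * p (Suc k) + p (Suc (Suc k))"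
    using v Sv by (simp only: 2 1) (simp add: p_def)
  finally have "0 \<le> real (Suc k) * (p k - 2 * p (Suc k) + p (Suc (Suc k)))" by simp
  also have "\<dots> = (p k + real k * (p k - p (Suc k))) - (p (Suc k) + real (Suc k) * (p (Suc k) - p (Suc (Suc k))))"
    by (simp add: algebra_simps)
  finally show ?case using Suc by linarith
qed

text \<open>The argument of Braess and Hackbusch. With \<open>Q\<close> the energy projection onto the coarse space
  and \<open>T = M\<^sup>-\<^sup>1 A\<close>, the coarse correction is at most
  \<open>(1 - Q) + \<delta> Q = \<delta> + (1 - \<delta>) (1 - Q) \<le> \<delta> + (1 - \<delta>) C T = \<delta> (1 + 2 h T)\<close>: the value
  \<open>\<delta> = C / (C + 2 h)\<close> is chosen so that \<open>(1 - \<delta>) C = 2 h \<delta>\<close>.\<close>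

lemma two_level_contraction:
  assumes P: "P \<in> carrier_mat n k" and Ac: "Ac \<in> carrier_mat k k" "spd Ac"
    and galerkin: "Ac = P\<^sup>T * A * P"
    and Ec: "energy_contraction k Ac Ec (C / (C + real (2 * h)))" and C: "0 < C"
    and approx: "\<And>z. z \<in> carrier_vec n \<Longrightarrow>
      z \<bullet> (mat_inv A *\<^sub>v z) - (P\<^sup>T *\<^sub>v z) \<bullet> (mat_inv Ac *\<^sub>v (P\<^sup>T *\<^sub>v z))
        \<le> C * (z \<bullet> (mat_inv M *\<^sub>v z))"
  shows "energy_contraction n A (S ^\<^sub>m h * (coarse_mat A P Ac Ec * S ^\<^sub>m h)) (C / (C + real (2 * h)))"
proof -
  define \<delta> where "\<delta> = C / (C + real (2 * h))"
  define K where "K = coarse_mat A P Ac Ec"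
  \<comment> \<open>\<open>P *\<^sub>v y w\<close> is the energy projection of w onto the coarse
    space.\<close>
  define y where "y w = mat_inv Ac *\<^sub>v (P\<^sup>T *\<^sub>v (A *\<^sub>v w))" for w
  define e where "e u v = (Ec *\<^sub>v y u) \<bullet> (Ac *\<^sub>v y v)" for u v
  note S = smoother_mat_mult_vec(1)[OF A(1) M]
  have symA: "A\<^sup>T = A" and symAc: "Ac\<^sup>T = Ac"
    using A Ac by (auto simp: spd_iff)
  have PT: "P\<^sup>T \<in> carrier_mat k n" using P by simp
  have Ec_carr: "Ec \<in> carrier_mat k k"
    and Ec_sym: "\<And>u v. u \<in> carrier_vec k \<Longrightarrow> v \<in> carrier_vec k \<Longrightarrow>
      (Ec *\<^sub>v u) \<bullet> (Ac *\<^sub>v v) = u \<bullet> (Ac *\<^sub>v (Ec *\<^sub>v v))"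
    and Ec_bounds: "\<And>v. v \<in> carrier_vec k \<Longrightarrow> 0 \<le> v \<bullet> (Ac *\<^sub>v (Ec *\<^sub>v v))"
      "\<And>v. v \<in> carrier_vec k \<Longrightarrow> v \<bullet> (Ac *\<^sub>v (Ec *\<^sub>v v)) \<le> \<delta> * (v \<bullet> (Ac *\<^sub>v v))"
    using Ec by (auto simp: energy_contraction_def \<delta>_def)
  have \<delta>: "0 \<le> \<delta>" "\<delta> \<le> 1" "(1 - \<delta>) * C = \<delta> * real (2 * h)"
    using C by (auto simp: \<delta>_def field_simps)
  have y: "y w \<in> carrier_vec k" "Ac *\<^sub>v y w = P\<^sup>T *\<^sub>v (A *\<^sub>v w)" if "w \<in> carrier_vec n" for w
    using spd_inverse_mult_vec[OF Ac, of "P\<^sup>T *\<^sub>v (A *\<^sub>v w)"] PT A that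
    by (auto simp: y_def)
  have K: "K \<in> carrier_mat n n"
    unfolding K_def by (rule coarse_mat_mult_vec(1)[OF A(1) P Ac Ec_carr])
  have K_vec: "K *\<^sub>v w = w - P *\<^sub>v (y w - Ec *\<^sub>v y w)" if "w \<in> carrier_vec n" for w
    unfolding K_def using coarse_mat_mult_vec(2)[OF A(1) P Ac Ec_carr that] by (simp add: y_def)
  have PA: "(P *\<^sub>v x) \<bullet> (A *\<^sub>v v) = x \<bullet> (Ac *\<^sub>v y v)"
    if x: "x \<in> carrier_vec k" and v: "v \<in> carrier_vec n" for x v
  proof -
    have "(P *\<^sub>v x) \<bullet> (A *\<^sub>v v) = ((P\<^sup>T)\<^sup>T *\<^sub>v x) \<bullet> (A *\<^sub>v v)" by simp
    also have "\<dots> = x \<bullet> (P\<^sup>T *\<^sub>v (A *\<^sub>v v))"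
      using A x v by (intro transpose_vec_mult_scalar[OF PT]) auto
    finally show ?thesis using y(2)[OF v] by simp
  qed
  \<comment> \<open>The energy, minus the part seen by the coarse space, plus what the inexact
    coarse cycle leaves of that part; each of the three terms is symmetric in u and v.\<close>
  have K_form: "(K *\<^sub>v u) \<bullet> (A *\<^sub>v v) = u \<bullet> (A *\<^sub>v v) - y u \<bullet> (Ac *\<^sub>v y v) + e u v"
    if u: "u \<in> carrier_vec n" and v: "v \<in> carrier_vec n" for u v
  proof -
    have Eu: "Ec *\<^sub>v y u \<in> carrier_vec k" using Ec_carr y(1)[OF u] by simp
    have d: "y u - Ec *\<^sub>v y u \<in> carrier_vec k" using Eu y(1)[OF u] by simp
    have "(K *\<^sub>v u) \<bullet> (A *\<^sub>v v) = u \<bullet> (A *\<^sub>v v) - (P *\<^sub>v (y u - Ec *\<^sub>v y u)) \<bullet> (A *\<^sub>v v)"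
      unfolding K_vec[OF u] using A P u v d by (intro minus_scalar_prod_distrib[of _ n]) auto
    also have "(P *\<^sub>v (y u - Ec *\<^sub>v y u)) \<bullet> (A *\<^sub>v v) = y u \<bullet> (Ac *\<^sub>v y v) - e u v"
      unfolding PA[OF d v] e_def
      using Ac y(1)[OF u] y(1)[OF v] Eu by (intro minus_scalar_prod_distrib[of _ k]) auto
    finally show ?thesis by simp
  qed
  have comm: "u \<bullet> (B *\<^sub>v v) = v \<bullet> (B *\<^sub>v u)"
    if "B \<in> carrier_mat j j" "B\<^sup>T = B" "u \<in> carrier_vec j" "v \<in> carrier_vec j"
    for B :: "real mat" and j u v
    unfolding symmetric_form[OF that, symmetric] using that
    by (intro comm_scalar_prod[of _ j]) auto
  have e_sym: "e u v = e v u" if u: "u \<in> carrier_vec n" and v: "v \<in> carrier_vec n" for u v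
  proof -
    have "e u v = y u \<bullet> (Ac *\<^sub>v (Ec *\<^sub>v y v))" unfolding e_def by (rule Ec_sym[OF y(1)[OF u] y(1)[OF v]])
    also have "\<dots> = e v u" unfolding e_def
      using y(1)[OF u] y(1)[OF v] Ec_carr by (intro comm[OF Ac(1) symAc]) auto
    finally show ?thesis .
  qed
  have K_sym: "(K *\<^sub>v u) \<bullet> (A *\<^sub>v v) = u \<bullet> (A *\<^sub>v (K *\<^sub>v v))"
    if u: "u \<in> carrier_vec n" and v: "v \<in> carrier_vec n" for u v
  proof -
    have "u \<bullet> (A *\<^sub>v (K *\<^sub>v v)) = (K *\<^sub>v v) \<bullet> (A *\<^sub>v u)"
      using K u v by (intro comm[OF A(1) symA]) auto
    then show ?thesis
      unfolding K_form[OF v u] K_form[OF u v] e_sym[OF v u]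
      using comm[OF A(1) symA v u] comm[OF Ac(1) symAc y(1)[OF v] y(1)[OF u]] by simp
  qed
  have K_bounds: "0 \<le> w \<bullet> (A *\<^sub>v (K *\<^sub>v w))"
    "w \<bullet> (A *\<^sub>v (K *\<^sub>v w)) \<le> \<delta> * (w \<bullet> (A *\<^sub>v w) + real (2 * h) * (w \<bullet> (A *\<^sub>v w) - w \<bullet> (A *\<^sub>v (S *\<^sub>v w))))"
    if w: "w \<in> carrier_vec n" for w
  proof -
    \<comment> \<open>\<open>\<rho>\<close> is the energy of the coarse projection of w and
      \<open>a\<close> the energy of w, so a - \<rho> belongs to the part that the coarse space does
      not see.\<close>
    define \<rho> where "\<rho> = y w \<bullet> (Ac *\<^sub>v y w)"
    define a where "a = w \<bullet> (A *\<^sub>v w)"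
    have Aw: "A *\<^sub>v w \<in> carrier_vec n" using A w by simp
    have Py: "P *\<^sub>v y w \<in> carrier_vec n" using P y(1)[OF w] by simp
    have form: "w \<bullet> (A *\<^sub>v (K *\<^sub>v w)) = a - \<rho> + y w \<bullet> (Ac *\<^sub>v (Ec *\<^sub>v y w))"
      unfolding K_sym[OF w w, symmetric] K_form[OF w w] e_def Ec_sym[OF y(1)[OF w] y(1)[OF w]]
      by (simp add: a_def \<rho>_def)
    have \<rho>0: "0 \<le> \<rho>" unfolding \<rho>_def using spd_imp_psd[OF Ac] y(1)[OF w] by (simp add: psd_iff[OF Ac(1)])
    have a0: "0 \<le> a" unfolding a_def using spd_imp_psd[OF A] w by (simp add: psd_iff[OF A(1)])
    \<comment> \<open>The Galerkin relation enters here: the coarse energy of \<open>y w\<close>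
      equals the fine energy of its prolongation.\<close>
    have Py_form: "(P *\<^sub>v y w) \<bullet> (A *\<^sub>v (P *\<^sub>v y w)) = \<rho>"
    proof -
      have "Ac *\<^sub>v y w = P\<^sup>T *\<^sub>v (A *\<^sub>v (P *\<^sub>v y w))"
        unfolding galerkin using PT A P y(1)[OF w]
          assoc_mult_mat_vec[OF mult_carrier_mat[OF PT A(1)] P y(1)[OF w]]
          assoc_mult_mat_vec[OF PT A(1) Py] by simp
      then have "\<rho> = y w \<bullet> (P\<^sup>T *\<^sub>v (A *\<^sub>v (P *\<^sub>v y w)))" by (simp add: \<rho>_def)
      also have "\<dots> = (P *\<^sub>v y w) \<bullet> (A *\<^sub>v (P *\<^sub>v y w))"
        using transpose_vec_mult_scalar[OF PT, of "A *\<^sub>v (P *\<^sub>v y w)" "y w"] A Py y(1)[OF w] by simp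
      finally show ?thesis by simp
    qed
    have "\<rho>\<^sup>2 = ((P *\<^sub>v y w) \<bullet> (A *\<^sub>v w))\<^sup>2"
      unfolding PA[OF y(1)[OF w] w] by (simp add: \<rho>_def)
    also have "\<dots> \<le> \<rho> * a"
      using psd_Cauchy_Schwarz[OF A(1) spd_imp_psd[OF A] Py w] unfolding Py_form a_def .
    \<comment> \<open>Division of \<rho>^2 <= \<rho> a by \<rho>: a projection does not increase the
      energy.\<close>
    finally have \<rho>a: "\<rho> \<le> a"
      using \<rho>0 a0 by (cases "\<rho> = 0") (auto simp: power2_eq_square)
    show "0 \<le> w \<bullet> (A *\<^sub>v (K *\<^sub>v w))"
      unfolding form using \<rho>a Ec_bounds(1)[OF y(1)[OF w]] by simp
    have AiA: "(A *\<^sub>v w) \<bullet> (mat_inv A *\<^sub>v (A *\<^sub>v w)) = a"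
      using spd_inverse_mult_vec(3)[OF A w] comm_scalar_prod[OF Aw w] by (simp add: a_def)
    have PP: "(P\<^sup>T *\<^sub>v (A *\<^sub>v w)) \<bullet> (mat_inv Ac *\<^sub>v (P\<^sup>T *\<^sub>v (A *\<^sub>v w))) = \<rho>"
      unfolding y(2)[OF w, symmetric] spd_inverse_mult_vec(3)[OF Ac y(1)[OF w]] \<rho>_def
      using Ac y(1)[OF w] by (intro comm_scalar_prod[of _ k]) auto
    have MM: "(A *\<^sub>v w) \<bullet> (mat_inv M *\<^sub>v (A *\<^sub>v w)) = a - w \<bullet> (A *\<^sub>v (S *\<^sub>v w))"
    proof -
      have Mw: "mat_inv M *\<^sub>v (A *\<^sub>v w) \<in> carrier_vec n"
        by (rule spd_inverse_mult_vec(1)[OF M Aw])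
      have "w \<bullet> (A *\<^sub>v (S *\<^sub>v w)) = a - w \<bullet> (A *\<^sub>v (mat_inv M *\<^sub>v (A *\<^sub>v w)))"
        unfolding smoother_mat_mult_vec(2)[OF A(1) M w] using A w Mw Aw
        by (simp add: mult_minus_distrib_mat_vec[of A n n] scalar_prod_minus_distrib[of _ n] a_def)
      then show ?thesis using symmetric_form[OF A(1) symA w Mw] by simp
    qed
    have "w \<bullet> (A *\<^sub>v (K *\<^sub>v w)) \<le> a - \<rho> + \<delta> * \<rho>"
      unfolding form using Ec_bounds(2)[OF y(1)[OF w]] by (simp add: \<rho>_def)
    also have "\<dots> = \<delta> * a + (1 - \<delta>) * (a - \<rho>)" by (simp add: algebra_simps)
    \<comment> \<open>The approximation property at z = A w reads a - \<rho> <= C (a - w A S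
      w).\<close>
    also have "\<dots> \<le> \<delta> * a + (1 - \<delta>) * (C * (a - w \<bullet> (A *\<^sub>v (S *\<^sub>v w))))"
      using approx[OF Aw] \<delta> by (intro add_left_mono mult_left_mono) (auto simp: AiA PP MM)
    also have "(1 - \<delta>) * (C * (a - w \<bullet> (A *\<^sub>v (S *\<^sub>v w)))) =
        \<delta> * real (2 * h) * (a - w \<bullet> (A *\<^sub>v (S *\<^sub>v w)))"
      using \<delta>(3) by (simp only: mult.assoc[symmetric])
    also have "\<delta> * a + \<dots> = \<delta> * (a + real (2 * h) * (a - w \<bullet> (A *\<^sub>v (S *\<^sub>v w))))"
      by (simp add: algebra_simps)
    finally show "w \<bullet> (A *\<^sub>v (K *\<^sub>v w)) \<le>
        \<delta> * (w \<bullet> (A *\<^sub>v w) + real (2 * h) * (w \<bullet> (A *\<^sub>v w) - w \<bullet> (A *\<^sub>v (S *\<^sub>v w))))"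
      by (simp add: a_def)
  qed
  note Sh = pow_carrier_mat[OF S, of h]
  let ?E = "S ^\<^sub>m h * (K * S ^\<^sub>m h)"
  have E: "?E \<in> carrier_mat n n" using Sh K by simp
  have Sv: "S ^\<^sub>m j *\<^sub>v v \<in> carrier_vec n" if "v \<in> carrier_vec n" for v j
    using that by (rule pow_mat_mult_vec(1)[OF S])
  have E_vec: "?E *\<^sub>v v = S ^\<^sub>m h *\<^sub>v (K *\<^sub>v (S ^\<^sub>m h *\<^sub>v v))" if "v \<in> carrier_vec n" for v
    using assoc_mult_mat_vec[OF Sh mult_carrier_mat[OF K Sh] that] assoc_mult_mat_vec[OF K Sh that]
    by simp
  have E_form: "u \<bullet> (A *\<^sub>v (?E *\<^sub>v v)) = (S ^\<^sub>m h *\<^sub>v u) \<bullet> (A *\<^sub>v (K *\<^sub>v (S ^\<^sub>m h *\<^sub>v v)))"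
    if "u \<in> carrier_vec n" "v \<in> carrier_vec n" for u v
    unfolding E_vec[OF that(2)] using that Sv K by (intro smoother_pow_selfadjoint[symmetric]) auto
  have E_sym: "(?E *\<^sub>v u) \<bullet> (A *\<^sub>v v) = u \<bullet> (A *\<^sub>v (?E *\<^sub>v v))"
    if u: "u \<in> carrier_vec n" and v: "v \<in> carrier_vec n" for u v
  proof -
    have KSu: "K *\<^sub>v (S ^\<^sub>m h *\<^sub>v u) \<in> carrier_vec n" using K Sv[OF u] by simp
    show ?thesis
      unfolding E_form[OF u v] unfolding E_vec[OF u] smoother_pow_selfadjoint[OF KSu v]
      by (rule K_sym[OF Sv[OF u] Sv[OF v]])
  qed
  have add: "S ^\<^sub>m i *\<^sub>v (S ^\<^sub>m j *\<^sub>v v) = S ^\<^sub>m (i + j) *\<^sub>v v" if v: "v \<in> carrier_vec n" for i j v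
  proof (induction i)
    case 0
    show ?case using pow_mat_mult_vec(2)[OF S Sv[OF v]] by simp
  next
    case (Suc i)
    show ?case
      unfolding pow_mat_mult_vec(4)[OF S Sv[OF v]] Suc add_Suc pow_mat_mult_vec(4)[OF S v] ..
  qed
  have E_bounds: "0 \<le> v \<bullet> (A *\<^sub>v (?E *\<^sub>v v)) \<and> v \<bullet> (A *\<^sub>v (?E *\<^sub>v v)) \<le> \<delta> * (v \<bullet> (A *\<^sub>v v))"
    if v: "v \<in> carrier_vec n" for v
  proof -
    \<comment> \<open>The \<open>h\<close> pre- and \<open>h\<close> post-smoothing steps merge into
      S^(2 h) by self-adjointness, which turns the coarse bound into the expression of
      \<open>smoother_moments\<close> at 2 h.\<close>
    define p where "p j = v \<bullet> (A *\<^sub>v (S ^\<^sub>m j *\<^sub>v v))" for j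
    let ?w = "S ^\<^sub>m h *\<^sub>v v"
    have 1: "?w \<bullet> (A *\<^sub>v ?w) = p (2 * h)"
      unfolding smoother_pow_selfadjoint[OF v Sv[OF v]] add[OF v] by (simp add: p_def mult_2)
    have 2: "?w \<bullet> (A *\<^sub>v (S *\<^sub>v ?w)) = p (Suc (2 * h))"
      unfolding pow_mat_mult_vec(4)[OF S v, symmetric] smoother_pow_selfadjoint[OF v Sv[OF v]] add[OF v]
      by (simp add: p_def mult_2)
    have "v \<bullet> (A *\<^sub>v (?E *\<^sub>v v)) \<le> \<delta> * (p (2 * h) + real (2 * h) * (p (2 * h) - p (Suc (2 * h))))"
      unfolding E_form[OF v v] using K_bounds(2)[OF Sv[OF v, of h]] unfolding 1 2 .
    also have "\<dots> \<le> \<delta> * p 0"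
      using smoother_moments[OF v, of "2 * h"] \<delta>(1) unfolding p_def by (rule mult_left_mono)
    also have "p 0 = v \<bullet> (A *\<^sub>v v)" unfolding p_def pow_mat_mult_vec(2)[OF S v] ..
    finally show ?thesis using K_bounds(1)[OF Sv[OF v, of h]] E_form[OF v v] by simp
  qed
  show ?thesis
    unfolding energy_contraction_def K_def[symmetric] \<delta>_def[symmetric] using E E_sym E_bounds by blast
qed

end

text \<open>Substituting z = M^{1/2} x turns the norm bound on M^{1/2} N M^{1/2} into an inequality
  of forms, because z M^-1 z = x x.\<close>

lemma approximation_form:
  assumes M: "M \<in> carrier_mat n n" "spd M" and N: "N \<in> carrier_mat n n"
    and le: "spec_norm (mat_sqrt M * N * mat_sqrt M) \<le> C" and z: "z \<in> carrier_vec n"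
  shows "z \<bullet> (N *\<^sub>v z) \<le> C * (z \<bullet> (mat_inv M *\<^sub>v z))"
proof -
  define R where "R = mat_sqrt M"
  have R: "R \<in> carrier_mat n n" "spd R" and RR: "R * R = M" using mat_sqrt_spd[OF M] by (auto simp: R_def)
  have symR: "R\<^sup>T = R" using R by (simp add: spd_iff)
  define x where "x = mat_inv R *\<^sub>v z"
  have x: "x \<in> carrier_vec n" "R *\<^sub>v x = z" using spd_inverse_mult_vec[OF R z] by (auto simp: x_def)
  let ?y = "mat_inv R *\<^sub>v x"
  have y: "?y \<in> carrier_vec n" "R *\<^sub>v ?y = x" using spd_inverse_mult_vec[OF R x(1)] by auto
  have "M *\<^sub>v ?y = z" using assoc_mult_mat_vec[OF R(1) R(1) y(1)] x y by (simp add: RR)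
  then have Mi: "mat_inv M *\<^sub>v z = ?y" using spd_inverse_mult_vec(3)[OF M y(1)] by simp
  have "z \<bullet> (mat_inv M *\<^sub>v z) = (R *\<^sub>v x) \<bullet> ?y" by (simp add: Mi x)
  also have "\<dots> = x \<bullet> x" using symmetric_form[OF R(1) symR x(1) y(1)] y by simp
  finally have xx: "z \<bullet> (mat_inv M *\<^sub>v z) = x \<bullet> x" .
  have Nz: "N *\<^sub>v z \<in> carrier_vec n" using N z by simp
  have RN: "R * N * R *\<^sub>v x = R *\<^sub>v (N *\<^sub>v z)"
    using assoc_mult_mat_vec[OF mult_carrier_mat[OF R(1) N] R(1) x(1)] assoc_mult_mat_vec[OF R(1) N z] x
    by simp
  have "z \<bullet> (N *\<^sub>v z) = x \<bullet> (R * N * R *\<^sub>v x)"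
    unfolding RN using symmetric_form[OF R(1) symR x(1) Nz] x by simp
  also have "\<dots> \<le> norm2 x * norm2 (R * N * R *\<^sub>v x)"
  proof -
    have "R * N * R *\<^sub>v x \<in> carrier_vec n" unfolding RN using R Nz by simp
    from norm2_Cauchy_Schwarz[OF x(1) this] show ?thesis by linarith
  qed
  also have "\<dots> \<le> norm2 x * (spec_norm (R * N * R) * norm2 x)"
    using R x by (intro mult_left_mono norm2_mult_le_spec_norm) auto
  also have "\<dots> \<le> norm2 x * (C * norm2 x)"
    using le unfolding R_def by (intro mult_left_mono mult_right_mono) auto
  also have "\<dots> = C * (x \<bullet> x)" by (simp add: norm2_squared[symmetric] power2_eq_square)
  finally show ?thesis unfolding xx .
qed

text \<open>A coarse factor C / (C + 2 h) yields the same factor on the next finer level, so the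
  rate does not deteriorate with the number of levels. The induction starts from the zero matrix of
  the exact coarse solver.\<close>

lemma vcycle_contraction:
  fixes n :: "nat \<Rightarrow> nat" and A M P :: "nat \<Rightarrow> real mat"
  assumes P: "\<And>l. 1 \<le> l \<Longrightarrow> P l \<in> carrier_mat (n l) (n (l - 1))"
    and A: "\<And>l. A l \<in> carrier_mat (n l) (n l)" "\<And>l. spd (A l)"
    and galerkin: "\<And>l. 1 \<le> l \<Longrightarrow> A (l - 1) = (P l)\<^sup>T * A l * P l"
    and M: "\<And>l. 1 \<le> l \<Longrightarrow> M l \<in> carrier_mat (n l) (n l)" "\<And>l. 1 \<le> l \<Longrightarrow> spd (M l)"
    and AM: "\<And>l v. 1 \<le> l \<Longrightarrow> v \<in> carrier_vec (n l) \<Longrightarrow> v \<bullet> (A l *\<^sub>v v) \<le> v \<bullet> (M l *\<^sub>v v)"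
    and C: "0 < C"
    and approx: "\<And>l. 1 \<le> l \<Longrightarrow>
         spec_norm (mat_sqrt (M l) *
           (mat_inv (A l) - P l * mat_inv (A (l - 1)) * (P l)\<^sup>T) *
           mat_sqrt (M l)) \<le> C"
  shows "energy_contraction (n l) (A l) (vcycle_mat A M P h l) (C / (C + real (2 * h)))"
proof (induction l)
  case 0
  have "0\<^sub>m (n 0) (n 0) *\<^sub>v v = 0\<^sub>v (n 0)" if "v \<in> carrier_vec (n 0)" for v :: "real vec"
    using that by (intro eq_vecI) auto
  moreover have "A 0 *\<^sub>v 0\<^sub>v (n 0) = 0\<^sub>v (n 0)"
    using A(1)[of 0] by (intro eq_vecI) auto
  moreover have "0 \<le> v \<bullet> (A 0 *\<^sub>v v)" if "v \<in> carrier_vec (n 0)" for v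
    using spd_imp_psd[OF A, of 0] that by (simp add: psd_iff[OF A(1)])
  moreover have "A 0 *\<^sub>v v \<in> carrier_vec (n 0)" if "v \<in> carrier_vec (n 0)" for v
    using A(1)[of 0] that by simp
  ultimately show ?case using C A(1)[of 0] by (simp add: energy_contraction_def)
next
  case (Suc l)
  note Pl = P[of "Suc l", simplified] and A' = A[of "Suc l"] and M' = M[of "Suc l", simplified]
  show ?case
    unfolding vcycle_mat.simps
  proof (rule two_level_contraction[OF A' M' _ Pl A _ Suc C])
    show "v \<bullet> (A (Suc l) *\<^sub>v v) \<le> v \<bullet> (M (Suc l) *\<^sub>v v)" if "v \<in> carrier_vec (n (Suc l))" for v
      using AM[of "Suc l"] that by simp
    show "A l = (P (Suc l))\<^sup>T * A (Suc l) * P (Suc l)" using galerkin[of "Suc l"] by simp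
    fix z :: "real vec" assume z: "z \<in> carrier_vec (n (Suc l))"
    note Ai = spd_invertible(1)[OF A'] and Aci = spd_invertible(1)[OF A, of l]
    let ?Q = "P (Suc l) * mat_inv (A l) * (P (Suc l))\<^sup>T"
    let ?N = "mat_inv (A (Suc l)) - ?Q"
    have PT: "(P (Suc l))\<^sup>T \<in> carrier_mat (n l) (n (Suc l))" using Pl by simp
    have Q: "?Q \<in> carrier_mat (n (Suc l)) (n (Suc l))" using Pl Aci by simp
    have N: "?N \<in> carrier_mat (n (Suc l)) (n (Suc l))" using Q by (rule minus_carrier_mat)
    let ?r = "(P (Suc l))\<^sup>T *\<^sub>v z"
    have r: "?r \<in> carrier_vec (n l)" using PT z by simp
    have Qz: "?Q *\<^sub>v z = P (Suc l) *\<^sub>v (mat_inv (A l) *\<^sub>v ?r)"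
      using assoc_mult_mat_vec[OF mult_carrier_mat[OF Pl Aci] PT z] assoc_mult_mat_vec[OF Pl Aci r] by simp
    have ir: "mat_inv (A l) *\<^sub>v ?r \<in> carrier_vec (n l)" using Aci r by simp
    have "z \<bullet> (?N *\<^sub>v z) = z \<bullet> (mat_inv (A (Suc l)) *\<^sub>v z) - z \<bullet> (?Q *\<^sub>v z)"
      using minus_mult_distrib_mat_vec[OF Ai Q z] z Ai Q
      by (simp del: assoc_mult_mat_vec add: scalar_prod_minus_distrib[of _ "n (Suc l)"])
    also have "z \<bullet> (?Q *\<^sub>v z) = ?r \<bullet> (mat_inv (A l) *\<^sub>v ?r)"
      unfolding Qz by (rule transpose_vec_mult_scalar[OF Pl ir z, symmetric])
    finally show "z \<bullet> (mat_inv (A (Suc l)) *\<^sub>v z) - ?r \<bullet> (mat_inv (A l) *\<^sub>v ?r)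
        \<le> C * (z \<bullet> (mat_inv (M (Suc l)) *\<^sub>v z))"
      using approximation_form[OF M' N _ z, of C] approx[of "Suc l"] by simp
  qed
qed

section \<open>Second moments\<close>

definition square_integrable :: "'w measure \<Rightarrow> ('w \<Rightarrow> real) \<Rightarrow> bool" where
  "square_integrable \<Omega> f \<longleftrightarrow> f \<in> borel_measurable \<Omega> \<and> integrable \<Omega> (\<lambda>\<omega>. (f \<omega>)\<^sup>2)"

text \<open>The centred product is kept as in \<open>cov_mat\<close>, so that matrix entries are
  scalar covariances by definition; bilinearity is derived afterwards from the uncentred
  formula.\<close>

definition covariance :: "'w measure \<Rightarrow> ('w \<Rightarrow> real) \<Rightarrow> ('w \<Rightarrow> real) \<Rightarrow> real" where
  "covariance \<Omega> f g = (\<integral>\<omega>. (f \<omega> - (\<integral>\<omega>. f \<omega> \<partial>\<Omega>)) * (g \<omega> - (\<integral>\<omega>. g \<omega> \<partial>\<Omega>)) \<partial>\<Omega>)"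

lemma covariance_commute: "covariance \<Omega> f g = covariance \<Omega> g f"
  by (simp add: covariance_def mult.commute)

lemma covariance_cong:
  assumes "\<And>\<omega>. \<omega> \<in> space \<Omega> \<Longrightarrow> f \<omega> = f' \<omega>" "\<And>\<omega>. \<omega> \<in> space \<Omega> \<Longrightarrow> g \<omega> = g' \<omega>"
  shows "covariance \<Omega> f g = covariance \<Omega> f' g'"
proof -
  have "(\<integral>\<omega>. f \<omega> \<partial>\<Omega>) = (\<integral>\<omega>. f' \<omega> \<partial>\<Omega>)" "(\<integral>\<omega>. g \<omega> \<partial>\<Omega>) = (\<integral>\<omega>. g' \<omega> \<partial>\<Omega>)"
    using assms by (auto intro: Bochner_Integration.integral_cong)
  then show ?thesis
    unfolding covariance_def using assms by (auto intro!: Bochner_Integration.integral_cong)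
qed

lemma square_integrable_mult:
  assumes "square_integrable \<Omega> f" "square_integrable \<Omega> g"
  shows "integrable \<Omega> (\<lambda>\<omega>. f \<omega> * g \<omega>)"
proof (rule Bochner_Integration.integrable_bound)
  show "integrable \<Omega> (\<lambda>\<omega>. (f \<omega>)\<^sup>2 + (g \<omega>)\<^sup>2)" using assms by (auto simp: square_integrable_def)
  show "(\<lambda>\<omega>. f \<omega> * g \<omega>) \<in> borel_measurable \<Omega>" using assms by (auto simp: square_integrable_def)
  have "\<bar>x * y\<bar> \<le> \<bar>x\<^sup>2 + y\<^sup>2\<bar>" for x y :: real
  proof -
    have "0 \<le> (\<bar>x\<bar> - \<bar>y\<bar>)\<^sup>2" by simp
    then have "2 * (\<bar>x\<bar> * \<bar>y\<bar>) \<le> x\<^sup>2 + y\<^sup>2" by (simp add: power2_eq_square algebra_simps)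
    moreover have "0 \<le> \<bar>x\<bar> * \<bar>y\<bar>" by simp
    ultimately have "\<bar>x\<bar> * \<bar>y\<bar> \<le> x\<^sup>2 + y\<^sup>2" by linarith
    then show ?thesis by (simp add: abs_mult)
  qed
  then show "AE \<omega> in \<Omega>. norm (f \<omega> * g \<omega>) \<le> norm ((f \<omega>)\<^sup>2 + (g \<omega>)\<^sup>2)" by auto
qed

lemma square_integrable_cmult:
  "square_integrable \<Omega> f \<Longrightarrow> square_integrable \<Omega> (\<lambda>\<omega>. c * f \<omega>)"
  by (auto simp: square_integrable_def power_mult_distrib)

lemma square_integrable_add:
  assumes "square_integrable \<Omega> f" "square_integrable \<Omega> g"
  shows "square_integrable \<Omega> (\<lambda>\<omega>. f \<omega> + g \<omega>)"
proof -
  have "integrable \<Omega> (\<lambda>\<omega>. (f \<omega>)\<^sup>2 + 2 * (f \<omega> * g \<omega>) + (g \<omega>)\<^sup>2)"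
    using assms square_integrable_mult[OF assms] by (auto simp: square_integrable_def)
  then show ?thesis using assms by (auto simp: square_integrable_def power2_sum ac_simps)
qed

lemma square_integrable_cong:
  assumes "\<And>\<omega>. \<omega> \<in> space \<Omega> \<Longrightarrow> f \<omega> = g \<omega>"
  shows "square_integrable \<Omega> f \<longleftrightarrow> square_integrable \<Omega> g"
proof -
  have "f \<in> borel_measurable \<Omega> \<longleftrightarrow> g \<in> borel_measurable \<Omega>"
    by (rule measurable_cong) (rule assms)
  moreover have "integrable \<Omega> (\<lambda>\<omega>. (f \<omega>)\<^sup>2) \<longleftrightarrow> integrable \<Omega> (\<lambda>\<omega>. (g \<omega>)\<^sup>2)"
    by (rule Bochner_Integration.integrable_cong) (simp_all add: assms)
  ultimately show ?thesis by (simp add: square_integrable_def)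
qed

context prob_space
begin

lemma square_integrable_const: "square_integrable M (\<lambda>_. c)"
  by (simp add: square_integrable_def)

lemma square_integrable_integrable: "square_integrable M f \<Longrightarrow> integrable M f"
  unfolding square_integrable_def by (blast intro: square_integrable_imp_integrable)

lemma covariance_eq:
  assumes "square_integrable M f" "square_integrable M g"
  shows "covariance M f g = expectation (\<lambda>\<omega>. f \<omega> * g \<omega>) - expectation f * expectation g"
proof -
  have "covariance M f g = expectation (\<lambda>\<omega>. f \<omega> * g \<omega> - expectation g * f \<omega>
      - expectation f * g \<omega> + expectation f * expectation g)"
    unfolding covariance_def by (simp add: algebra_simps)
  also have "\<dots> = expectation (\<lambda>\<omega>. f \<omega> * g \<omega>) - expectation g * expectation f
      - expectation f * expectation g + expectation f * expectation g"
    using square_integrable_mult[OF assms] square_integrable_integrable[OF assms(1)]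
      square_integrable_integrable[OF assms(2)] by (simp add: prob_space)
  finally show ?thesis by simp
qed

lemma covariance_add_left:
  assumes f: "square_integrable M f" and g: "square_integrable M g" and h: "square_integrable M h"
  shows "covariance M (\<lambda>\<omega>. f \<omega> + g \<omega>) h = covariance M f h + covariance M g h"
proof -
  have "expectation (\<lambda>\<omega>. (f \<omega> + g \<omega>) * h \<omega>)
      = expectation (\<lambda>\<omega>. f \<omega> * h \<omega>) + expectation (\<lambda>\<omega>. g \<omega> * h \<omega>)"
    using square_integrable_mult[OF f h] square_integrable_mult[OF g h] by (simp add: distrib_right)
  then show ?thesis
    using square_integrable_integrable[OF f] square_integrable_integrable[OF g]
    by (simp add: covariance_eq assms square_integrable_add algebra_simps)
qed

lemma covariance_cmult_left:
  assumes "square_integrable M f" "square_integrable M h"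
  shows "covariance M (\<lambda>\<omega>. c * f \<omega>) h = c * covariance M f h"
  by (simp add: covariance_eq assms square_integrable_cmult mult.assoc algebra_simps)

lemma covariance_const_left:
  assumes "square_integrable M h"
  shows "covariance M (\<lambda>_. c) h = 0"
  using assms by (simp add: covariance_eq square_integrable_const prob_space)

lemma covariance_sum_left:
  assumes "finite J" "\<And>j. j \<in> J \<Longrightarrow> square_integrable M (f j)" "square_integrable M h"
  shows "square_integrable M (\<lambda>\<omega>. \<Sum>j\<in>J. c j * f j \<omega>) \<and>
    covariance M (\<lambda>\<omega>. \<Sum>j\<in>J. c j * f j \<omega>) h = (\<Sum>j\<in>J. c j * covariance M (f j) h)"
  using assms(1,2)
proof (induction J)
  case empty
  then show ?case using covariance_const_left[OF assms(3), of 0] by (simp add: square_integrable_const)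
next
  case (insert j J)
  then show ?case
    using assms(3)
    by (simp add: square_integrable_add square_integrable_cmult covariance_add_left covariance_cmult_left)
qed

end

section \<open>Uncorrelated random vectors\<close>

text \<open>Only second moments are claimed, so of the independence of the draws we keep no more than
  that distinct draws are uncorrelated.\<close>

locale uncorrelated_draws = prob_space \<Omega>
  for \<Omega> :: "'w measure" and I :: "'d set" and dm :: "'d \<Rightarrow> nat" and Z :: "'d \<Rightarrow> 'w \<Rightarrow> real vec" +
  assumes draw_carrier: "\<And>d \<omega>. d \<in> I \<Longrightarrow> \<omega> \<in> space \<Omega> \<Longrightarrow> Z d \<omega> \<in> carrier_vec (dm d)"
    and draw_square_integrable: "\<And>d a. d \<in> I \<Longrightarrow> a \<in> carrier_vec (dm d) \<Longrightarrow>
      square_integrable \<Omega> (\<lambda>\<omega>. a \<bullet> Z d \<omega>)"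
    and draw_uncorrelated: "\<And>d d' a b. d \<in> I \<Longrightarrow> d' \<in> I \<Longrightarrow> d \<noteq> d' \<Longrightarrow> a \<in> carrier_vec (dm d) \<Longrightarrow>
      b \<in> carrier_vec (dm d') \<Longrightarrow> covariance \<Omega> (\<lambda>\<omega>. a \<bullet> Z d \<omega>) (\<lambda>\<omega>. b \<bullet> Z d' \<omega>) = 0"
begin

text \<open>Affine functions of the draws indexed by D. The index set records which draws a variable
  depends on, and disjoint index sets then mean no correlation. Closure under equality on the sample
  space is included because draws are known to lie in their carriers only there.\<close>

inductive_set lin :: "'d set \<Rightarrow> ('w \<Rightarrow> real) set" for D where
  const: "(\<lambda>_. c) \<in> lin D"
| draw: "d \<in> D \<Longrightarrow> d \<in> I \<Longrightarrow> a \<in> carrier_vec (dm d) \<Longrightarrow> (\<lambda>\<omega>. a \<bullet> Z d \<omega>) \<in> lin D"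
| add: "f \<in> lin D \<Longrightarrow> g \<in> lin D \<Longrightarrow> (\<lambda>\<omega>. f \<omega> + g \<omega>) \<in> lin D"
| cmult: "f \<in> lin D \<Longrightarrow> (\<lambda>\<omega>. c * f \<omega>) \<in> lin D"
| eq_on: "f \<in> lin D \<Longrightarrow> (\<And>\<omega>. \<omega> \<in> space \<Omega> \<Longrightarrow> f \<omega> = g \<omega>) \<Longrightarrow> g \<in> lin D"

lemma lin_square_integrable:
  assumes "f \<in> lin D"
  shows "square_integrable \<Omega> f"
  using assms
proof (induction rule: lin.induct)
  case (const c)
  show ?case by (rule square_integrable_const)
next
  case (draw d a)
  then show ?case by (intro draw_square_integrable)
next
  case (add f g)
  then show ?case by (intro square_integrable_add)
next
  case (cmult f c)
  then show ?case by (intro square_integrable_cmult)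
next
  case (eq_on f g)
  then show ?case using square_integrable_cong[of \<Omega> f g] by blast
qed

lemma lin_mono:
  assumes "f \<in> lin D" "D \<subseteq> D'"
  shows "f \<in> lin D'"
  using assms(1)
proof (induction rule: lin.induct)
  case (const c)
  show ?case by (rule lin.const)
next
  case (draw d a)
  then show ?case using assms(2) by (intro lin.draw) auto
next
  case (add f g)
  then show ?case by (intro lin.add)
next
  case (cmult f c)
  then show ?case by (intro lin.cmult)
next
  case (eq_on f g)
  show ?case by (rule lin.eq_on[OF eq_on.IH eq_on.hyps(2)])
qed

lemma lin_uncorrelated_draw:
  assumes "g \<in> lin D'" "d \<in> I" "d \<notin> D'" "a \<in> carrier_vec (dm d)"
  shows "covariance \<Omega> g (\<lambda>\<omega>. a \<bullet> Z d \<omega>) = 0"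
  using assms(1)
proof (induction rule: lin.induct)
  case (const c)
  then show ?case using assms by (intro covariance_const_left draw_square_integrable)
next
  case (draw d' b)
  then show ?case using assms by (intro draw_uncorrelated) auto
next
  case (add f g)
  then show ?case using assms by (simp add: covariance_add_left lin_square_integrable draw_square_integrable)
next
  case (cmult f c)
  then show ?case using assms by (simp add: covariance_cmult_left lin_square_integrable draw_square_integrable)
next
  case (eq_on f g)
  then show ?case using covariance_cong[of \<Omega> f g] by metis
qed

text \<open>Bilinearity reduces the claim to pairs of distinct draws, one argument at a time: the
  other argument is settled in \<open>lin_uncorrelated_draw\<close>.\<close>

lemma lin_uncorrelated:
  assumes "f \<in> lin D" "g \<in> lin D'" "D \<inter> D' = {}"
  shows "covariance \<Omega> f g = 0"
  using assms(1)
proof (induction rule: lin.induct)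
  case (const c)
  then show ?case using assms by (intro covariance_const_left lin_square_integrable)
next
  case (draw d a)
  then have "d \<notin> D'" using assms(3) by auto
  with draw show ?case
    using lin_uncorrelated_draw[OF assms(2)] by (simp add: covariance_commute[of _ _ g])
next
  case (add f f')
  then show ?case using assms(2) by (simp add: covariance_add_left lin_square_integrable)
next
  case (cmult f c)
  then show ?case using assms(2) by (simp add: covariance_cmult_left lin_square_integrable)
next
  case (eq_on f f')
  then show ?case using covariance_cong[of \<Omega> f f' g g] by metis
qed

text \<open>All scalar products are tested, rather than the components, so that a matrix factor is
  absorbed by applying its transpose to the test vector.\<close>

definition lin_vec :: "'d set \<Rightarrow> nat \<Rightarrow> ('w \<Rightarrow> real vec) \<Rightarrow> bool" where
  "lin_vec D n X \<longleftrightarrow> (\<forall>\<omega>\<in>space \<Omega>. X \<omega> \<in> carrier_vec n) \<and>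
     (\<forall>a\<in>carrier_vec n. (\<lambda>\<omega>. a \<bullet> X \<omega>) \<in> lin D)"

lemma lin_vecD:
  assumes "lin_vec D n X"
  shows "\<omega> \<in> space \<Omega> \<Longrightarrow> X \<omega> \<in> carrier_vec n"
    "a \<in> carrier_vec n \<Longrightarrow> (\<lambda>\<omega>. a \<bullet> X \<omega>) \<in> lin D"
    "a \<in> carrier_vec n \<Longrightarrow> square_integrable \<Omega> (\<lambda>\<omega>. a \<bullet> X \<omega>)"
    "a \<in> carrier_vec n \<Longrightarrow> integrable \<Omega> (\<lambda>\<omega>. a \<bullet> X \<omega>)"
  using assms lin_square_integrable square_integrable_integrable by (auto simp: lin_vec_def)

lemma lin_vec_draw: "d \<in> D \<Longrightarrow> d \<in> I \<Longrightarrow> lin_vec D (dm d) (Z d)"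
  by (auto simp: lin_vec_def draw_carrier intro: lin.draw)

lemma lin_vec_const: "c \<in> carrier_vec n \<Longrightarrow> lin_vec D n (\<lambda>_. c)"
  by (auto simp: lin_vec_def intro: lin.const)

lemma lin_vec_mono: "lin_vec D n X \<Longrightarrow> D \<subseteq> D' \<Longrightarrow> lin_vec D' n X"
  by (auto simp: lin_vec_def intro: lin_mono)

lemma lin_vec_cong:
  assumes "lin_vec D n X" "\<And>\<omega>. \<omega> \<in> space \<Omega> \<Longrightarrow> X \<omega> = Y \<omega>"
  shows "lin_vec D n Y"
  unfolding lin_vec_def
proof (intro conjI ballI)
  show "Y \<omega> \<in> carrier_vec n" if "\<omega> \<in> space \<Omega>" for \<omega>
    using lin_vecD(1)[OF assms(1) that] assms(2)[OF that] by simp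
  show "(\<lambda>\<omega>. a \<bullet> Y \<omega>) \<in> lin D" if "a \<in> carrier_vec n" for a
    using lin_vecD(2)[OF assms(1) that] by (rule lin.eq_on) (simp add: assms(2))
qed

lemma lin_vec_add:
  assumes X: "lin_vec D n X" and Y: "lin_vec D n Y"
  shows "lin_vec D n (\<lambda>\<omega>. X \<omega> + Y \<omega>)"
  unfolding lin_vec_def
proof (intro conjI ballI)
  show "X \<omega> + Y \<omega> \<in> carrier_vec n" if "\<omega> \<in> space \<Omega>" for \<omega>
    using lin_vecD(1)[OF X that] lin_vecD(1)[OF Y that] by simp
  fix a :: "real vec" assume a: "a \<in> carrier_vec n"
  show "(\<lambda>\<omega>. a \<bullet> (X \<omega> + Y \<omega>)) \<in> lin D"
    by (rule lin.eq_on[OF lin.add[OF lin_vecD(2)[OF X a] lin_vecD(2)[OF Y a]]])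
      (use lin_vecD(1)[OF X] lin_vecD(1)[OF Y] a in \<open>simp add: scalar_prod_add_distrib[of _ n]\<close>)
qed

lemma lin_vec_mult:
  assumes B: "B \<in> carrier_mat k n" and X: "lin_vec D n X"
  shows "lin_vec D k (\<lambda>\<omega>. B *\<^sub>v X \<omega>)"
  unfolding lin_vec_def
proof (intro conjI ballI)
  show "B *\<^sub>v X \<omega> \<in> carrier_vec k" if "\<omega> \<in> space \<Omega>" for \<omega>
    using lin_vecD(1)[OF X that] B by simp
  fix a :: "real vec" assume a: "a \<in> carrier_vec k"
  then have Ba: "B\<^sup>T *\<^sub>v a \<in> carrier_vec n" using B by simp
  show "(\<lambda>\<omega>. a \<bullet> (B *\<^sub>v X \<omega>)) \<in> lin D"
    by (rule lin.eq_on[OF lin_vecD(2)[OF X Ba]])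
      (simp add: scalar_prod_mult_mat_vec[OF B a lin_vecD(1)[OF X]])
qed

section \<open>Mean vectors and covariance matrices through scalar functionals\<close>

abbreviation (input) "mean u X \<equiv> expectation (\<lambda>\<omega>. u \<bullet> X \<omega>)"

abbreviation (input) "cov u X v Y \<equiv> covariance \<Omega> (\<lambda>\<omega>. u \<bullet> X \<omega>) (\<lambda>\<omega>. v \<bullet> Y \<omega>)"

lemma mean_vec_scalar_prod:
  assumes X: "lin_vec D n X" and u: "u \<in> carrier_vec n"
  shows "u \<bullet> mean_vec \<Omega> n X = mean u X"
proof -
  have index: "X \<omega> $ i = unit_vec n i \<bullet> X \<omega>" if "i < n" "\<omega> \<in> space \<Omega>" for i \<omega>
    using lin_vecD(1)[OF X that(2)] that(1) by simp
  have int: "integrable \<Omega> (\<lambda>\<omega>. X \<omega> $ i)" if "i < n" for i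
  proof -
    have "integrable \<Omega> (\<lambda>\<omega>. X \<omega> $ i) \<longleftrightarrow> integrable \<Omega> (\<lambda>\<omega>. unit_vec n i \<bullet> X \<omega>)"
      by (rule Bochner_Integration.integrable_cong[OF refl]) (rule index[OF that])
    then show ?thesis using lin_vecD(4)[OF X, of "unit_vec n i"] by simp
  qed
  have "mean u X = expectation (\<lambda>\<omega>. \<Sum>i\<in>{0..<n}. u $ i * X \<omega> $ i)"
    using carrier_vecD[OF lin_vecD(1)[OF X]]
    by (intro Bochner_Integration.integral_cong) (auto simp: scalar_prod_def)
  also have "\<dots> = (\<Sum>i\<in>{0..<n}. u $ i * expectation (\<lambda>\<omega>. X \<omega> $ i))"
    using int by (subst Bochner_Integration.integral_sum) auto
  also have "\<dots> = u \<bullet> mean_vec \<Omega> n X" by (simp add: scalar_prod_def mean_vec_def)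
  finally show ?thesis by simp
qed

lemma cov_mat_form:
  assumes X: "lin_vec D n X" and Y: "lin_vec D' n Y" and u: "u \<in> carrier_vec n" and v: "v \<in> carrier_vec n"
  shows "u \<bullet> (cov_mat \<Omega> n X Y *\<^sub>v v) = cov u X v Y"
proof -
  \<comment> \<open>Stated for an arbitrary affine vector, as it is needed in each of the two
    arguments of the covariance.\<close>
  have expand: "covariance \<Omega> (\<lambda>\<omega>. u \<bullet> X \<omega>) h = (\<Sum>i\<in>{0..<n}. u $ i * covariance \<Omega> (\<lambda>\<omega>. X \<omega> $ i) h)"
    "\<And>i. i < n \<Longrightarrow> square_integrable \<Omega> (\<lambda>\<omega>. X \<omega> $ i)"
    if X: "lin_vec D n X" and u: "u \<in> carrier_vec n" and h: "square_integrable \<Omega> h" for D X u h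
  proof -
    have sq: "square_integrable \<Omega> (\<lambda>\<omega>. X \<omega> $ i)" if i: "i < n" for i
    proof -
      have "X \<omega> $ i = unit_vec n i \<bullet> X \<omega>" if "\<omega> \<in> space \<Omega>" for \<omega>
        using lin_vecD(1)[OF X that] i by simp
      then show ?thesis
        using lin_vecD(3)[OF X, of "unit_vec n i"]
          square_integrable_cong[of \<Omega> "\<lambda>\<omega>. X \<omega> $ i" "\<lambda>\<omega>. unit_vec n i \<bullet> X \<omega>"] by simp
    qed
    have "covariance \<Omega> (\<lambda>\<omega>. u \<bullet> X \<omega>) h = covariance \<Omega> (\<lambda>\<omega>. \<Sum>i\<in>{0..<n}. u $ i * X \<omega> $ i) h"
      using carrier_vecD[OF lin_vecD(1)[OF X]] by (intro covariance_cong) (auto simp: scalar_prod_def)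
    also have "\<dots> = (\<Sum>i\<in>{0..<n}. u $ i * covariance \<Omega> (\<lambda>\<omega>. X \<omega> $ i) h)"
      using covariance_sum_left[of "{0..<n}" "\<lambda>i \<omega>. X \<omega> $ i" h "\<lambda>i. u $ i"] sq h by simp
    finally show "covariance \<Omega> (\<lambda>\<omega>. u \<bullet> X \<omega>) h = (\<Sum>i\<in>{0..<n}. u $ i * covariance \<Omega> (\<lambda>\<omega>. X \<omega> $ i) h)" .
    show "square_integrable \<Omega> (\<lambda>\<omega>. X \<omega> $ i)" if "i < n" for i using sq that .
  qed
  \<comment> \<open>The arguments are swapped so that the expansion in the left argument applies to
    \<open>Y\<close>.\<close>
  have entry: "cov_mat \<Omega> n X Y $$ (i, j) = covariance \<Omega> (\<lambda>\<omega>. Y \<omega> $ j) (\<lambda>\<omega>. X \<omega> $ i)"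
    if "i < n" "j < n" for i j
    using that by (simp add: cov_mat_def covariance_def mean_vec_def mult.commute)
  have Yv: "square_integrable \<Omega> (\<lambda>\<omega>. v \<bullet> Y \<omega>)" by (rule lin_vecD(3)[OF Y v])
  have inner: "covariance \<Omega> (\<lambda>\<omega>. X \<omega> $ i) (\<lambda>\<omega>. v \<bullet> Y \<omega>) = (\<Sum>j\<in>{0..<n}. cov_mat \<Omega> n X Y $$ (i, j) * v $ j)"
    if i: "i < n" for i
    using expand(1)[OF Y v expand(2)[OF X u Yv i]] i
    by (simp add: covariance_commute[of _ "\<lambda>\<omega>. X \<omega> $ i"] entry mult.commute)
  show ?thesis
    unfolding expand(1)[OF X u Yv] using u v inner
    by (simp add: scalar_prod_def cov_mat_def[of _ _ X Y] row_def)
qed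

lemma cov_mat_carrier: "cov_mat \<Omega> n X Y \<in> carrier_mat n n" "mean_vec \<Omega> n X \<in> carrier_vec n"
  by (simp_all add: cov_mat_def mean_vec_def)

section \<open>Affine updates that leave a normal distribution invariant\<close>

text \<open>The prescribed noise covariance \<open>A\<^sup>-\<^sup>1 - E A\<^sup>-\<^sup>1 E\<^sup>T\<close> says that a state of covariance
  \<open>A\<^sup>-\<^sup>1\<close> keeps it, whatever \<open>f\<close> is.\<close>

definition invariant_noise :: "'d set \<Rightarrow> nat \<Rightarrow> real mat \<Rightarrow> real mat \<Rightarrow> ('w \<Rightarrow> real vec) \<Rightarrow> bool" where
  "invariant_noise D n A E W \<longleftrightarrow> lin_vec D n W \<and> (\<forall>u\<in>carrier_vec n. mean u W = 0) \<and>
     (\<forall>u\<in>carrier_vec n. \<forall>v\<in>carrier_vec n. cov u W v W =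
        u \<bullet> (mat_inv A *\<^sub>v v) - (E\<^sup>T *\<^sub>v u) \<bullet> (mat_inv A *\<^sub>v (E\<^sup>T *\<^sub>v v)))"

lemma invariant_noiseD:
  assumes "invariant_noise D n A E W"
  shows "lin_vec D n W" "u \<in> carrier_vec n \<Longrightarrow> mean u W = 0"
    "u \<in> carrier_vec n \<Longrightarrow> v \<in> carrier_vec n \<Longrightarrow> cov u W v W =
      u \<bullet> (mat_inv A *\<^sub>v v) - (E\<^sup>T *\<^sub>v u) \<bullet> (mat_inv A *\<^sub>v (E\<^sup>T *\<^sub>v v))"
  using assms unfolding invariant_noise_def by blast+

text \<open>The noise \<open>W\<close> is chosen before \<open>f\<close> and
  \<open>\<theta>\<close>. This uniformity is what lets the update be used with a right-hand side
  computed from the random state, as the coarse correction does.\<close>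

definition affine_update ::
  "'d set \<Rightarrow> nat \<Rightarrow> real mat \<Rightarrow> real mat \<Rightarrow> ('w \<Rightarrow> real vec \<Rightarrow> real vec \<Rightarrow> real vec) \<Rightarrow> bool" where
  "affine_update D n A E \<Phi> \<longleftrightarrow> E \<in> carrier_mat n n \<and>
     (\<exists>W. invariant_noise D n A E W \<and> (\<forall>\<omega>\<in>space \<Omega>. \<forall>f\<in>carrier_vec n. \<forall>\<theta>\<in>carrier_vec n.
        \<Phi> \<omega> f \<theta> = mat_inv A *\<^sub>v f + (E *\<^sub>v (\<theta> - mat_inv A *\<^sub>v f) + W \<omega>)))"

end

lemma mult_mat_uminus_vec:
  fixes B :: "real mat"
  assumes "B \<in> carrier_mat k n" "w \<in> carrier_vec n"
  shows "B *\<^sub>v (- w) = - (B *\<^sub>v w)"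
  using assms by (intro eq_vecI) auto

text \<open>For the smoother and for the coarse correction alike, the transposed iteration matrix
  has the shape E^T u = u - A x with x linear in u. The prescribed noise covariance then becomes an
  expression without A^-1, to be compared with the actual one.\<close>

lemma inverse_form_diff:
  assumes A: "A \<in> carrier_mat n n" "spd A" and u: "u \<in> carrier_vec n" and v: "v \<in> carrier_vec n"
    and x: "x \<in> carrier_vec n" and y: "y \<in> carrier_vec n"
  shows "u \<bullet> (mat_inv A *\<^sub>v v) - (u - A *\<^sub>v x) \<bullet> (mat_inv A *\<^sub>v (v - A *\<^sub>v y)) =
    u \<bullet> y + x \<bullet> v - x \<bullet> (A *\<^sub>v y)"
proof -
  have symA: "A\<^sup>T = A" using A by (simp add: spd_iff)
  note Ai = spd_invertible(1)[OF A]
  let ?w = "mat_inv A *\<^sub>v v"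
  have w: "?w \<in> carrier_vec n" "A *\<^sub>v ?w = v" using spd_inverse_mult_vec[OF A v] by auto
  have Ax: "A *\<^sub>v x \<in> carrier_vec n" and Ay: "A *\<^sub>v y \<in> carrier_vec n" using A x y by auto
  have "mat_inv A *\<^sub>v (v - A *\<^sub>v y) = ?w - y"
    using mult_minus_distrib_mat_vec[OF Ai v Ay] spd_inverse_mult_vec(3)[OF A y] by simp
  moreover have "(u - A *\<^sub>v x) \<bullet> (?w - y) = u \<bullet> ?w - u \<bullet> y - ((A *\<^sub>v x) \<bullet> ?w - (A *\<^sub>v x) \<bullet> y)"
    using u w y Ax by (simp add: minus_scalar_prod_distrib[of _ n] scalar_prod_minus_distrib[of _ n])
  moreover have "(A *\<^sub>v x) \<bullet> ?w = x \<bullet> v" using symmetric_form[OF A(1) symA x w(1)] w by simp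
  moreover have "(A *\<^sub>v x) \<bullet> y = x \<bullet> (A *\<^sub>v y)" by (rule symmetric_form[OF A(1) symA x y])
  ultimately show ?thesis by simp
qed

context uncorrelated_draws
begin

lemma affine_updateI:
  assumes "E \<in> carrier_mat n n" "lin_vec D n W"
    and "\<And>u. u \<in> carrier_vec n \<Longrightarrow> mean u W = 0"
    and "\<And>u v. u \<in> carrier_vec n \<Longrightarrow> v \<in> carrier_vec n \<Longrightarrow>
      cov u W v W =
        u \<bullet> (mat_inv A *\<^sub>v v) - (E\<^sup>T *\<^sub>v u) \<bullet> (mat_inv A *\<^sub>v (E\<^sup>T *\<^sub>v v))"
    and "\<And>\<omega> f \<theta>. \<omega> \<in> space \<Omega> \<Longrightarrow> f \<in> carrier_vec n \<Longrightarrow> \<theta> \<in> carrier_vec n \<Longrightarrow>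
      \<Phi> \<omega> f \<theta> = mat_inv A *\<^sub>v f + (E *\<^sub>v (\<theta> - mat_inv A *\<^sub>v f) + W \<omega>)"
  shows "affine_update D n A E \<Phi>"
  unfolding affine_update_def invariant_noise_def using assms by blast

text \<open>E moves to the test vectors as its transpose, and the mixed covariances vanish because
  \<open>X\<close> and \<open>W\<close> use disjoint sets of draws.\<close>

lemma lin_vec_moments:
  assumes E: "E \<in> carrier_mat n k" and X: "lin_vec D k X" and W: "lin_vec D' n W" and "D \<inter> D' = {}"
    and u: "u \<in> carrier_vec n" and v: "v \<in> carrier_vec n"
  shows "expectation (\<lambda>\<omega>. u \<bullet> (E *\<^sub>v X \<omega> + W \<omega>)) =
      mean (E\<^sup>T *\<^sub>v u) X + mean u W"
    and "covariance \<Omega> (\<lambda>\<omega>. u \<bullet> (E *\<^sub>v X \<omega> + W \<omega>)) (\<lambda>\<omega>. v \<bullet> (E *\<^sub>v X \<omega> + W \<omega>)) =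
      cov (E\<^sup>T *\<^sub>v u) X (E\<^sup>T *\<^sub>v v) X +
      cov u W v W"
proof -
  define a b where "a = E\<^sup>T *\<^sub>v u" and "b = E\<^sup>T *\<^sub>v v"
  have a: "a \<in> carrier_vec k" and b: "b \<in> carrier_vec k" using E u v by (auto simp: a_def b_def)
  have eq: "w \<bullet> (E *\<^sub>v X \<omega> + W \<omega>) = (E\<^sup>T *\<^sub>v w) \<bullet> X \<omega> + w \<bullet> W \<omega>"
    if "w \<in> carrier_vec n" "\<omega> \<in> space \<Omega>" for w \<omega>
    using scalar_prod_mult_mat_vec[OF E that(1) lin_vecD(1)[OF X that(2)]]
      lin_vecD(1)[OF X that(2)] lin_vecD(1)[OF W that(2)] E that(1)
    by (simp add: scalar_prod_add_distrib[of _ n])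
  have "expectation (\<lambda>\<omega>. u \<bullet> (E *\<^sub>v X \<omega> + W \<omega>)) = expectation (\<lambda>\<omega>. a \<bullet> X \<omega> + u \<bullet> W \<omega>)"
    unfolding a_def by (rule Bochner_Integration.integral_cong[OF refl]) (rule eq[OF u])
  also have "\<dots> = mean a X + mean u W"
    using lin_vecD(4)[OF X a] lin_vecD(4)[OF W u] by simp
  finally show "expectation (\<lambda>\<omega>. u \<bullet> (E *\<^sub>v X \<omega> + W \<omega>)) =
      mean (E\<^sup>T *\<^sub>v u) X + mean u W"
    by (simp add: a_def)
  note sq = lin_vecD(3)[OF X a] lin_vecD(3)[OF W u] lin_vecD(3)[OF X b] lin_vecD(3)[OF W v]
  have cross: "cov a X v W = 0"
    "cov b X u W = 0"
    using lin_uncorrelated[OF lin_vecD(2)[OF X a] lin_vecD(2)[OF W v] assms(4)]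
      lin_uncorrelated[OF lin_vecD(2)[OF X b] lin_vecD(2)[OF W u] assms(4)] .
  have "covariance \<Omega> (\<lambda>\<omega>. u \<bullet> (E *\<^sub>v X \<omega> + W \<omega>)) (\<lambda>\<omega>. v \<bullet> (E *\<^sub>v X \<omega> + W \<omega>)) =
      covariance \<Omega> (\<lambda>\<omega>. a \<bullet> X \<omega> + u \<bullet> W \<omega>) (\<lambda>\<omega>. b \<bullet> X \<omega> + v \<bullet> W \<omega>)"
    unfolding a_def b_def by (rule covariance_cong; rule eq) (use u v in auto)
  also have "\<dots> = covariance \<Omega> (\<lambda>\<omega>. b \<bullet> X \<omega> + v \<bullet> W \<omega>) (\<lambda>\<omega>. a \<bullet> X \<omega>) +
      covariance \<Omega> (\<lambda>\<omega>. b \<bullet> X \<omega> + v \<bullet> W \<omega>) (\<lambda>\<omega>. u \<bullet> W \<omega>)"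
    unfolding covariance_add_left[OF sq(1,2) square_integrable_add[OF sq(3,4)]]
    by (intro arg_cong2[where f = "(+)"] covariance_commute)
  also have "\<dots> = cov a X b X + cov u W v W"
    unfolding covariance_add_left[OF sq(3,4,1)] covariance_add_left[OF sq(3,4,2)] cross(2)
    using cross(1) covariance_commute[of \<Omega> "\<lambda>\<omega>. v \<bullet> W \<omega>" "\<lambda>\<omega>. a \<bullet> X \<omega>"]
      covariance_commute[of \<Omega> "\<lambda>\<omega>. v \<bullet> W \<omega>" "\<lambda>\<omega>. u \<bullet> W \<omega>"]
      covariance_commute[of \<Omega> "\<lambda>\<omega>. b \<bullet> X \<omega>" "\<lambda>\<omega>. a \<bullet> X \<omega>"] by linarith
  finally show "covariance \<Omega> (\<lambda>\<omega>. u \<bullet> (E *\<^sub>v X \<omega> + W \<omega>)) (\<lambda>\<omega>. v \<bullet> (E *\<^sub>v X \<omega> + W \<omega>)) =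
      cov (E\<^sup>T *\<^sub>v u) X (E\<^sup>T *\<^sub>v v) X +
      cov u W v W"
    by (simp add: a_def b_def)
qed

text \<open>The composed noise is E2 W1 + W2. Its covariance E2 (A^-1 - E1 A^-1 E1^T) E2^T + A^-1 -
  E2 A^-1 E2^T telescopes to A^-1 - (E2 E1) A^-1 (E2 E1)^T.\<close>

lemma affine_update_comp:
  assumes A: "A \<in> carrier_mat n n" "spd A"
    and 1: "affine_update D1 n A E1 \<Phi>1" and 2: "affine_update D2 n A E2 \<Phi>2" and disj: "D1 \<inter> D2 = {}"
  shows "affine_update (D1 \<union> D2) n A (E2 * E1) (\<lambda>\<omega> f \<theta>. \<Phi>2 \<omega> f (\<Phi>1 \<omega> f \<theta>))"
proof -
  obtain W1 where E1: "E1 \<in> carrier_mat n n" and N1: "invariant_noise D1 n A E1 W1"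
    and step1: "\<And>\<omega> f \<theta>. \<omega> \<in> space \<Omega> \<Longrightarrow> f \<in> carrier_vec n \<Longrightarrow> \<theta> \<in> carrier_vec n \<Longrightarrow>
      \<Phi>1 \<omega> f \<theta> = mat_inv A *\<^sub>v f + (E1 *\<^sub>v (\<theta> - mat_inv A *\<^sub>v f) + W1 \<omega>)"
    using 1 unfolding affine_update_def by blast
  note W1 = invariant_noiseD(1)[OF N1] and mean1 = invariant_noiseD(2)[OF N1] and cov1 = invariant_noiseD(3)[OF N1]
  obtain W2 where E2: "E2 \<in> carrier_mat n n" and N2: "invariant_noise D2 n A E2 W2"
    and step2: "\<And>\<omega> f \<theta>. \<omega> \<in> space \<Omega> \<Longrightarrow> f \<in> carrier_vec n \<Longrightarrow> \<theta> \<in> carrier_vec n \<Longrightarrow>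
      \<Phi>2 \<omega> f \<theta> = mat_inv A *\<^sub>v f + (E2 *\<^sub>v (\<theta> - mat_inv A *\<^sub>v f) + W2 \<omega>)"
    using 2 unfolding affine_update_def by blast
  note W2 = invariant_noiseD(1)[OF N2] and mean2 = invariant_noiseD(2)[OF N2] and cov2 = invariant_noiseD(3)[OF N2]
  have T: "(E2 * E1)\<^sup>T *\<^sub>v u = E1\<^sup>T *\<^sub>v (E2\<^sup>T *\<^sub>v u)"
    "E2\<^sup>T *\<^sub>v u \<in> carrier_vec n" if "u \<in> carrier_vec n" for u
    using transpose_mult[OF E2 E1] E1 E2 that by (auto intro: assoc_mult_mat_vec[of _ n n _ n])
  show ?thesis
  proof (rule affine_updateI[where W = "\<lambda>\<omega>. E2 *\<^sub>v W1 \<omega> + W2 \<omega>"])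
    show "E2 * E1 \<in> carrier_mat n n" using E1 E2 by simp
    show "lin_vec (D1 \<union> D2) n (\<lambda>\<omega>. E2 *\<^sub>v W1 \<omega> + W2 \<omega>)"
      by (intro lin_vec_add lin_vec_mono[OF lin_vec_mult[OF E2 W1]] lin_vec_mono[OF W2]) auto
    fix u v :: "real vec" assume u: "u \<in> carrier_vec n" and v: "v \<in> carrier_vec n"
    note moments = lin_vec_moments[OF E2 W1 W2 disj u v]
    show "expectation (\<lambda>\<omega>. u \<bullet> (E2 *\<^sub>v W1 \<omega> + W2 \<omega>)) = 0"
      unfolding moments(1) using mean1[OF T(2)[OF u]] mean2[OF u] by simp
    show "covariance \<Omega> (\<lambda>\<omega>. u \<bullet> (E2 *\<^sub>v W1 \<omega> + W2 \<omega>)) (\<lambda>\<omega>. v \<bullet> (E2 *\<^sub>v W1 \<omega> + W2 \<omega>)) =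
        u \<bullet> (mat_inv A *\<^sub>v v) -
        ((E2 * E1)\<^sup>T *\<^sub>v u) \<bullet> (mat_inv A *\<^sub>v ((E2 * E1)\<^sup>T *\<^sub>v v))"
      unfolding moments(2) cov1[OF T(2)[OF u] T(2)[OF v]] cov2[OF u v] T(1)[OF u] T(1)[OF v] by simp
  next
    fix \<omega> and f \<theta> :: "real vec"
    assume \<omega>: "\<omega> \<in> space \<Omega>" and f: "f \<in> carrier_vec n" and \<theta>: "\<theta> \<in> carrier_vec n"
    define t where "t = mat_inv A *\<^sub>v f"
    define d where "d = \<theta> - t"
    have t: "t \<in> carrier_vec n" using spd_inverse_mult_vec(1)[OF A f] by (simp add: t_def)
    have d: "d \<in> carrier_vec n" using \<theta> t by (simp add: d_def)
    note W1' = lin_vecD(1)[OF W1 \<omega>] and W2' = lin_vecD(1)[OF W2 \<omega>]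
    have E1d: "E1 *\<^sub>v d \<in> carrier_vec n" using E1 d by simp
    have \<Phi>1: "\<Phi>1 \<omega> f \<theta> = t + (E1 *\<^sub>v d + W1 \<omega>)" using step1[OF \<omega> f \<theta>] by (simp add: t_def d_def)
    have "\<Phi>1 \<omega> f \<theta> - t = E1 *\<^sub>v d + W1 \<omega>"
      unfolding \<Phi>1 using t E1d W1' by (intro eq_vecI) auto
    moreover have "\<Phi>1 \<omega> f \<theta> \<in> carrier_vec n" unfolding \<Phi>1 using t E1d W1' by simp
    ultimately have "\<Phi>2 \<omega> f (\<Phi>1 \<omega> f \<theta>) = t + (E2 *\<^sub>v (E1 *\<^sub>v d + W1 \<omega>) + W2 \<omega>)"
      using step2[OF \<omega> f] by (simp add: t_def)
    also have "E2 *\<^sub>v (E1 *\<^sub>v d + W1 \<omega>) + W2 \<omega> = (E2 * E1) *\<^sub>v d + (E2 *\<^sub>v W1 \<omega> + W2 \<omega>)"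
      using mult_add_distrib_mat_vec[OF E2 E1d W1'] E1 E2 d W1' W2' E1d
      by (simp add: assoc_add_vec[of _ n])
    finally show "\<Phi>2 \<omega> f (\<Phi>1 \<omega> f \<theta>) = mat_inv A *\<^sub>v f +
        ((E2 * E1) *\<^sub>v (\<theta> - mat_inv A *\<^sub>v f) + (E2 *\<^sub>v W1 \<omega> + W2 \<omega>))"
      by (simp add: t_def d_def)
  qed
qed

lemma affine_update_id:
  assumes A: "A \<in> carrier_mat n n" "spd A"
  shows "affine_update {} n A (1\<^sub>m n) (\<lambda>\<omega> f \<theta>. \<theta>)"
proof (rule affine_updateI[where W = "\<lambda>_. 0\<^sub>v n"])
  show "lin_vec {} n (\<lambda>_. 0\<^sub>v n)" by (rule lin_vec_const) simp
  show "covariance \<Omega> (\<lambda>\<omega>. u \<bullet> 0\<^sub>v n) (\<lambda>\<omega>. v \<bullet> 0\<^sub>v n) = u \<bullet> (mat_inv A *\<^sub>v v) -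
      ((1\<^sub>m n)\<^sup>T *\<^sub>v u) \<bullet> (mat_inv A *\<^sub>v ((1\<^sub>m n)\<^sup>T *\<^sub>v v))"
    if "u \<in> carrier_vec n" "v \<in> carrier_vec n" for u v
    using that covariance_const_left[OF square_integrable_const, of 0 0] by simp
  show "\<theta> = mat_inv A *\<^sub>v f + (1\<^sub>m n *\<^sub>v (\<theta> - mat_inv A *\<^sub>v f) + 0\<^sub>v n)"
    if f: "f \<in> carrier_vec n" and \<theta>: "\<theta> \<in> carrier_vec n" for f \<theta>
  proof -
    define t where "t = mat_inv A *\<^sub>v f"
    have t: "t \<in> carrier_vec n" using spd_inverse_mult_vec(1)[OF A f] by (simp add: t_def)
    then have "1\<^sub>m n *\<^sub>v (\<theta> - t) = \<theta> - t" using \<theta> by simp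
    then show ?thesis unfolding t_def[symmetric] using t \<theta> by (intro eq_vecI) auto
  qed
qed auto

text \<open>The noise M^-1 \<xi> has covariance M^-1 (2 M - A) M^-1, and this equals A^-1 - S A^-1
  S^T for S = 1 - M^-1 A: the covariance of \<xi> is made for this identity. In terms of forms, S^T
  u = u - A x with x = M^-1 u.\<close>

lemma affine_update_smoother:
  assumes A: "A \<in> carrier_mat n n" "spd A" and M: "M \<in> carrier_mat n n" "spd M"
    and d: "d \<in> I" "dm d = n"
    and mean: "\<And>a. a \<in> carrier_vec n \<Longrightarrow> mean a (Z d) = 0"
    and cov: "\<And>a b. a \<in> carrier_vec n \<Longrightarrow> b \<in> carrier_vec n \<Longrightarrow>
      cov a (Z d) b (Z d) = a \<bullet> ((M + M\<^sup>T - A) *\<^sub>v b)"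
  shows "affine_update {d} n A (smoother_mat A M) (\<lambda>\<omega> f \<theta>. random_smoother A M f (Z d \<omega>) \<theta>)"
proof -
  have symA: "A\<^sup>T = A" and symM: "M\<^sup>T = M" using A M by (auto simp: spd_iff)
  note Mi = spd_invertible(1)[OF M] and S = smoother_mat_mult_vec[OF A(1) M]
  have symMi: "(mat_inv M)\<^sup>T = mat_inv M" using spd_inverse[OF M] Mi by (simp add: spd_iff)
  have Zd: "lin_vec {d} n (Z d)" using lin_vec_draw[of d "{d}"] d by simp
  have Mi_form: "u \<bullet> (mat_inv M *\<^sub>v Z d \<omega>) = (mat_inv M *\<^sub>v u) \<bullet> Z d \<omega>"
    if "u \<in> carrier_vec n" "\<omega> \<in> space \<Omega>" for u \<omega>
    using scalar_prod_mult_mat_vec[OF Mi that(1) lin_vecD(1)[OF Zd that(2)]] symMi by simp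
  have ST: "(smoother_mat A M)\<^sup>T *\<^sub>v u = u - A *\<^sub>v (mat_inv M *\<^sub>v u)"
    if u: "u \<in> carrier_vec n" for u
  proof (rule vec_eq_by_scalar_prod[of _ n])
    fix w :: "real vec" assume w: "w \<in> carrier_vec n"
    have Mu: "mat_inv M *\<^sub>v u \<in> carrier_vec n" using Mi u by simp
    have Aw: "A *\<^sub>v w \<in> carrier_vec n" using A w by simp
    have "w \<bullet> ((smoother_mat A M)\<^sup>T *\<^sub>v u) = u \<bullet> (smoother_mat A M *\<^sub>v w)"
      using scalar_prod_mult_mat_vec[OF S(1) u w] S(1) u w
      by (simp add: comm_scalar_prod[of w n])
    also have "\<dots> = u \<bullet> w - u \<bullet> (mat_inv M *\<^sub>v (A *\<^sub>v w))"
      unfolding S(2)[OF w] using Mi Aw u w by (intro scalar_prod_minus_distrib[of _ n]) auto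
    also have "u \<bullet> (mat_inv M *\<^sub>v (A *\<^sub>v w)) = w \<bullet> (A *\<^sub>v (mat_inv M *\<^sub>v u))"
      unfolding symmetric_form[OF Mi symMi u Aw, symmetric] symmetric_form[OF A(1) symA w Mu, symmetric]
      by (rule comm_scalar_prod[OF Mu Aw])
    also have "u \<bullet> w - \<dots> = w \<bullet> (u - A *\<^sub>v (mat_inv M *\<^sub>v u))"
      using A Mu u w by (simp add: scalar_prod_minus_distrib[of _ n] comm_scalar_prod[of u n])
    finally show "w \<bullet> ((smoother_mat A M)\<^sup>T *\<^sub>v u) = w \<bullet> (u - A *\<^sub>v (mat_inv M *\<^sub>v u))" .
  qed (use S A Mi u in auto)
  show ?thesis
  proof (rule affine_updateI[where W = "\<lambda>\<omega>. mat_inv M *\<^sub>v Z d \<omega>"])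
    show "smoother_mat A M \<in> carrier_mat n n" by (rule S(1))
    show "lin_vec {d} n (\<lambda>\<omega>. mat_inv M *\<^sub>v Z d \<omega>)" by (rule lin_vec_mult[OF Mi Zd])
    fix u v :: "real vec" assume u: "u \<in> carrier_vec n" and v: "v \<in> carrier_vec n"
    define x y where "x = mat_inv M *\<^sub>v u" and "y = mat_inv M *\<^sub>v v"
    have x: "x \<in> carrier_vec n" "M *\<^sub>v x = u" and y: "y \<in> carrier_vec n" "M *\<^sub>v y = v"
      using spd_inverse_mult_vec[OF M u] spd_inverse_mult_vec[OF M v] by (auto simp: x_def y_def)
    have "expectation (\<lambda>\<omega>. u \<bullet> (mat_inv M *\<^sub>v Z d \<omega>)) = mean x (Z d)"
      unfolding x_def by (rule Bochner_Integration.integral_cong[OF refl]) (rule Mi_form[OF u])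
    then show "expectation (\<lambda>\<omega>. u \<bullet> (mat_inv M *\<^sub>v Z d \<omega>)) = 0" using mean[OF x(1)] by simp
    have "covariance \<Omega> (\<lambda>\<omega>. u \<bullet> (mat_inv M *\<^sub>v Z d \<omega>)) (\<lambda>\<omega>. v \<bullet> (mat_inv M *\<^sub>v Z d \<omega>)) =
        cov x (Z d) y (Z d)"
      unfolding x_def y_def by (rule covariance_cong) (simp_all add: Mi_form u v)
    also have "\<dots> = x \<bullet> ((M + M - A) *\<^sub>v y)" unfolding cov[OF x(1) y(1)] symM ..
    also have "(M + M - A) *\<^sub>v y = (v + v) - A *\<^sub>v y"
      using minus_mult_distrib_mat_vec[of "M + M" n n A y] add_mult_distrib_mat_vec[of M n n M y]
        M(1) A(1) y by simp
    also have "x \<bullet> (v + v - A *\<^sub>v y) = x \<bullet> v + x \<bullet> v - x \<bullet> (A *\<^sub>v y)"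
      using A x y v by (simp add: scalar_prod_minus_distrib[of _ n] scalar_prod_add_distrib[of _ n])
    \<comment> \<open>One of the two copies is rewritten by symmetry of M to match
      \<open>inverse_form_diff\<close>.\<close>
    also have "x \<bullet> v + x \<bullet> v = u \<bullet> y + x \<bullet> v"
      using symmetric_form[OF M(1) symM x(1) y(1)] x y by simp
    finally show "covariance \<Omega> (\<lambda>\<omega>. u \<bullet> (mat_inv M *\<^sub>v Z d \<omega>)) (\<lambda>\<omega>. v \<bullet> (mat_inv M *\<^sub>v Z d \<omega>)) =
        u \<bullet> (mat_inv A *\<^sub>v v) - ((smoother_mat A M)\<^sup>T *\<^sub>v u) \<bullet>
          (mat_inv A *\<^sub>v ((smoother_mat A M)\<^sup>T *\<^sub>v v))"
      unfolding ST[OF u] ST[OF v] x_def[symmetric] y_def[symmetric]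
        inverse_form_diff[OF A u v x(1) y(1)] .
  next
    fix \<omega> and f \<theta> :: "real vec"
    assume \<omega>: "\<omega> \<in> space \<Omega>" and f: "f \<in> carrier_vec n" and \<theta>: "\<theta> \<in> carrier_vec n"
    define t e where "t = mat_inv A *\<^sub>v f" and "e = \<theta> - t"
    have t: "t \<in> carrier_vec n" "A *\<^sub>v t = f" using spd_inverse_mult_vec[OF A f] by (auto simp: t_def)
    have e: "e \<in> carrier_vec n" using \<theta> t by (simp add: e_def)
    have Ae: "A *\<^sub>v e \<in> carrier_vec n" using A e by simp
    note Z' = lin_vecD(1)[OF Zd \<omega>]
    have "A *\<^sub>v e = A *\<^sub>v \<theta> - f"
      unfolding e_def using mult_minus_distrib_mat_vec[OF A(1) \<theta> t(1)] t by simp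
    then have "f + Z d \<omega> - A *\<^sub>v \<theta> = Z d \<omega> - A *\<^sub>v e"
      using f Z' A \<theta> by (intro eq_vecI) (auto simp del: index_mult_mat_vec)
    then have "random_smoother A M f (Z d \<omega>) \<theta> = \<theta> + (mat_inv M *\<^sub>v Z d \<omega> - mat_inv M *\<^sub>v (A *\<^sub>v e))"
      unfolding random_smoother_def using mult_minus_distrib_mat_vec[OF Mi Z' Ae] by simp
    also have "\<dots> = t + (smoother_mat A M *\<^sub>v e + mat_inv M *\<^sub>v Z d \<omega>)"
      unfolding S(2)[OF e] using t \<theta> Mi
      by (intro eq_vecI) (auto simp: e_def simp del: index_mult_mat_vec)
    finally show "random_smoother A M f (Z d \<omega>) \<theta> = mat_inv A *\<^sub>v f +
        (smoother_mat A M *\<^sub>v (\<theta> - mat_inv A *\<^sub>v f) + mat_inv M *\<^sub>v Z d \<omega>)"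
      by (simp add: t_def e_def)
  qed
qed

text \<open>Injectivity of \<open>d\<close> keeps the noises of different steps distinct, so each
  step is composed with earlier ones that use other draws.\<close>

lemma affine_update_smooth:
  assumes A: "A \<in> carrier_mat n n" "spd A" and M: "M \<in> carrier_mat n n" "spd M"
    and d: "\<And>j. j < k \<Longrightarrow> d j \<in> I" "\<And>j. j < k \<Longrightarrow> dm (d j) = n" and inj: "inj_on d {..<k}"
    and mean: "\<And>j a. j < k \<Longrightarrow> a \<in> carrier_vec n \<Longrightarrow> mean a (Z (d j)) = 0"
    and cov: "\<And>j a b. j < k \<Longrightarrow> a \<in> carrier_vec n \<Longrightarrow> b \<in> carrier_vec n \<Longrightarrow>
      cov a (Z (d j)) b (Z (d j)) = a \<bullet> ((M + M\<^sup>T - A) *\<^sub>v b)"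
  shows "affine_update (d ` {..<k}) n A (smoother_mat A M ^\<^sub>m k)
    (\<lambda>\<omega> f \<theta>. smooth A M f (\<lambda>j. Z (d j) \<omega>) k \<theta>)"
  using d inj mean cov
proof (induction k)
  case 0
  have "dim_row (smoother_mat A M) = n" using smoother_mat_mult_vec(1)[OF A(1) M] by simp
  then show ?case using affine_update_id[OF A] by simp
next
  case (Suc k)
  note S = smoother_mat_mult_vec(1)[OF A(1) M]
  have IH: "affine_update (d ` {..<k}) n A (smoother_mat A M ^\<^sub>m k)
      (\<lambda>\<omega> f \<theta>. smooth A M f (\<lambda>j. Z (d j) \<omega>) k \<theta>)"
    using Suc.prems by (intro Suc.IH) (auto simp: inj_on_def)
  have last: "affine_update {d k} n A (smoother_mat A M)
      (\<lambda>\<omega> f \<theta>. random_smoother A M f (Z (d k) \<omega>) \<theta>)"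
    using Suc.prems by (intro affine_update_smoother[OF A M]) auto
  have disj: "d ` {..<k} \<inter> {d k} = {}" using inj_onD[OF Suc.prems(3), of _ k] by fastforce
  \<comment> \<open>The latest step acts from the left, whereas the matrix power grows on the
    right.\<close>
  have "smoother_mat A M * smoother_mat A M ^\<^sub>m k = smoother_mat A M ^\<^sub>m Suc k"
  proof (rule mat_eq_by_mult_vec[of _ n n])
    fix v :: "real vec" assume v: "v \<in> carrier_vec n"
    show "(smoother_mat A M * smoother_mat A M ^\<^sub>m k) *\<^sub>v v = smoother_mat A M ^\<^sub>m Suc k *\<^sub>v v"
      unfolding pow_mat_mult_vec(4)[OF S v] by (rule assoc_mult_mat_vec[OF S pow_carrier_mat[OF S] v])
  qed (use S pow_carrier_mat[OF S] in auto)
  moreover have "d ` {..<k} \<union> {d k} = d ` {..<Suc k}" by (auto simp: lessThan_Suc)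
  ultimately show ?case using affine_update_comp[OF A IH last disj] by simp
qed

text \<open>With e the error on the fine level, the restricted residual is - P^T A e and its exact
  coarse solution is -y. Started at zero, the coarse update has error y and returns -y + Ec y + W,
  so the new fine error is the coarse matrix applied to e, plus P W. The coarse right-hand side
  depends on the state, yet \<open>W\<close> does not.\<close>

lemma affine_update_coarse:
  assumes A: "A \<in> carrier_mat n n" "spd A" and P: "P \<in> carrier_mat n k"
    and Ac: "Ac \<in> carrier_mat k k" "spd Ac" and galerkin: "Ac = P\<^sup>T * A * P"
    and c: "affine_update D k Ac Ec \<Phi>"
  shows "affine_update D n A (coarse_mat A P Ac Ec)
    (\<lambda>\<omega> f \<theta>. \<theta> + P *\<^sub>v \<Phi> \<omega> (P\<^sup>T *\<^sub>v (f - A *\<^sub>v \<theta>)) (0\<^sub>v k))"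
proof -
  obtain W where Ec: "Ec \<in> carrier_mat k k" and N: "invariant_noise D k Ac Ec W"
    and step: "\<And>\<omega> f \<theta>. \<omega> \<in> space \<Omega> \<Longrightarrow> f \<in> carrier_vec k \<Longrightarrow> \<theta> \<in> carrier_vec k \<Longrightarrow>
      \<Phi> \<omega> f \<theta> = mat_inv Ac *\<^sub>v f + (Ec *\<^sub>v (\<theta> - mat_inv Ac *\<^sub>v f) + W \<omega>)"
    using c unfolding affine_update_def by blast
  note W = invariant_noiseD(1)[OF N] and mean = invariant_noiseD(2)[OF N] and cov = invariant_noiseD(3)[OF N]
  have symA: "A\<^sup>T = A" using A by (simp add: spd_iff)
  note K = coarse_mat_mult_vec[OF A(1) P Ac Ec] and Aci = spd_invertible(1)[OF Ac]
  have symAci: "(mat_inv Ac)\<^sup>T = mat_inv Ac" using spd_inverse[OF Ac] Aci by (simp add: spd_iff)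
  have PT: "P\<^sup>T \<in> carrier_mat k n" using P by simp
  have adj: "u \<bullet> (P *\<^sub>v x) = (P\<^sup>T *\<^sub>v u) \<bullet> x" if "u \<in> carrier_vec n" "x \<in> carrier_vec k" for u x
    using scalar_prod_mult_mat_vec[OF P that] .
  \<comment> \<open>Equals Ac^-1 (1 - Ec^T) P^T u. It is chosen so that Ec^T sends P^T u to P^T u -
    Ac (x u), while the transposed coarse matrix sends u to u - A (P (x u)); thus
    \<open>inverse_form_diff\<close> applies on both levels.\<close>
  define x where "x u = mat_inv Ac *\<^sub>v (P\<^sup>T *\<^sub>v u - Ec\<^sup>T *\<^sub>v (P\<^sup>T *\<^sub>v u))" for u
  have x: "x u \<in> carrier_vec k"
    "Ec\<^sup>T *\<^sub>v (P\<^sup>T *\<^sub>v u) = P\<^sup>T *\<^sub>v u - Ac *\<^sub>v x u"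
    if u: "u \<in> carrier_vec n" for u
  proof -
    let ?a = "P\<^sup>T *\<^sub>v u"
    have a: "?a \<in> carrier_vec k" "Ec\<^sup>T *\<^sub>v ?a \<in> carrier_vec k" using PT Ec u by auto
    then have "?a - Ec\<^sup>T *\<^sub>v ?a \<in> carrier_vec k" by simp
    note inv = spd_inverse_mult_vec[OF Ac this]
    show "x u \<in> carrier_vec k" unfolding x_def by (rule inv(1))
    show "Ec\<^sup>T *\<^sub>v ?a = ?a - Ac *\<^sub>v x u"
      unfolding x_def inv(2) using a by (intro eq_vecI) (auto simp del: index_mult_mat_vec)
  qed
  have KT: "(coarse_mat A P Ac Ec)\<^sup>T *\<^sub>v u = u - A *\<^sub>v (P *\<^sub>v x u)" if u: "u \<in> carrier_vec n" for u
  proof (rule vec_eq_by_scalar_prod[of _ n])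
    fix w :: "real vec" assume w: "w \<in> carrier_vec n"
    define a y where "a = P\<^sup>T *\<^sub>v u" and "y = mat_inv Ac *\<^sub>v (P\<^sup>T *\<^sub>v (A *\<^sub>v w))"
    have Aw: "A *\<^sub>v w \<in> carrier_vec n" using A w by simp
    have PAw: "P\<^sup>T *\<^sub>v (A *\<^sub>v w) \<in> carrier_vec k" using PT Aw by simp
    have a: "a \<in> carrier_vec k" using PT u by (simp add: a_def)
    have Ea: "Ec\<^sup>T *\<^sub>v a \<in> carrier_vec k" using Ec a by simp
    have y: "y \<in> carrier_vec k" using Aci PAw by (simp add: y_def)
    have Ey: "Ec *\<^sub>v y \<in> carrier_vec k" using Ec y by simp
    have Px: "P *\<^sub>v x u \<in> carrier_vec n" using P x(1)[OF u] by simp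
    have "w \<bullet> ((coarse_mat A P Ac Ec)\<^sup>T *\<^sub>v u) = u \<bullet> (coarse_mat A P Ac Ec *\<^sub>v w)"
      using scalar_prod_mult_mat_vec[OF K(1) u w] K(1) u w by (simp add: comm_scalar_prod[of w n])
    also have "\<dots> = u \<bullet> w - u \<bullet> (P *\<^sub>v (y - Ec *\<^sub>v y))"
      unfolding K(2)[OF w y_def] using P y Ey u w by (intro scalar_prod_minus_distrib[of _ n]) auto
    also have "u \<bullet> (P *\<^sub>v (y - Ec *\<^sub>v y)) = a \<bullet> y - a \<bullet> (Ec *\<^sub>v y)"
      using adj[OF u, of "y - Ec *\<^sub>v y"] y Ey a by (simp add: a_def[symmetric] scalar_prod_minus_distrib[of _ k])
    also have "\<dots> = (a - Ec\<^sup>T *\<^sub>v a) \<bullet> y"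
      using scalar_prod_mult_mat_vec[OF Ec a y] a Ea y by (simp add: minus_scalar_prod_distrib[of _ k])
    also have "\<dots> = x u \<bullet> (P\<^sup>T *\<^sub>v (A *\<^sub>v w))"
      unfolding y_def x_def a_def[symmetric] using a Ea PAw
      by (intro symmetric_form[OF Aci symAci, symmetric]) auto
    also have "\<dots> = (P *\<^sub>v x u) \<bullet> (A *\<^sub>v w)"
      using scalar_prod_mult_mat_vec[OF PT x(1)[OF u] Aw] by simp
    also have "\<dots> = w \<bullet> (A *\<^sub>v (P *\<^sub>v x u))"
      unfolding symmetric_form[OF A(1) symA w Px, symmetric] by (rule comm_scalar_prod[OF Px Aw])
    also have "u \<bullet> w - \<dots> = w \<bullet> (u - A *\<^sub>v (P *\<^sub>v x u))"
      using A Px u w by (simp add: scalar_prod_minus_distrib[of _ n] comm_scalar_prod[of u n])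
    finally show "w \<bullet> ((coarse_mat A P Ac Ec)\<^sup>T *\<^sub>v u) = w \<bullet> (u - A *\<^sub>v (P *\<^sub>v x u))" .
  qed (use K(1) A P x(1)[OF u] u in auto)
  show ?thesis
  proof (rule affine_updateI[where W = "\<lambda>\<omega>. P *\<^sub>v W \<omega>"])
    show "coarse_mat A P Ac Ec \<in> carrier_mat n n" by (rule K(1))
    show "lin_vec D n (\<lambda>\<omega>. P *\<^sub>v W \<omega>)" by (rule lin_vec_mult[OF P W])
    fix u v :: "real vec" assume u: "u \<in> carrier_vec n" and v: "v \<in> carrier_vec n"
    let ?a = "P\<^sup>T *\<^sub>v u" and ?b = "P\<^sup>T *\<^sub>v v"
    have a: "?a \<in> carrier_vec k" and b: "?b \<in> carrier_vec k" using PT u v by auto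
    have Pxu: "P *\<^sub>v x u \<in> carrier_vec n" and Pxv: "P *\<^sub>v x v \<in> carrier_vec n"
      using P x(1)[OF u] x(1)[OF v] by auto
    have "expectation (\<lambda>\<omega>. u \<bullet> (P *\<^sub>v W \<omega>)) = mean ?a W"
      by (rule Bochner_Integration.integral_cong[OF refl]) (rule adj[OF u lin_vecD(1)[OF W]])
    then show "expectation (\<lambda>\<omega>. u \<bullet> (P *\<^sub>v W \<omega>)) = 0" using mean[OF a] by simp
    have "covariance \<Omega> (\<lambda>\<omega>. u \<bullet> (P *\<^sub>v W \<omega>)) (\<lambda>\<omega>. v \<bullet> (P *\<^sub>v W \<omega>)) =
        cov ?a W ?b W"
      by (rule covariance_cong) (rule adj[OF u lin_vecD(1)[OF W]] adj[OF v lin_vecD(1)[OF W]], assumption)+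
    also have "\<dots> = ?a \<bullet> x v + x u \<bullet> ?b - x u \<bullet> (Ac *\<^sub>v x v)"
      unfolding cov[OF a b] x(2)[OF u] x(2)[OF v]
      by (rule inverse_form_diff[OF Ac a b x(1)[OF u] x(1)[OF v]])
    also have "?a \<bullet> x v = u \<bullet> (P *\<^sub>v x v)" using adj[OF u x(1)[OF v]] by simp
    also have "x u \<bullet> ?b = (P *\<^sub>v x u) \<bullet> v" using scalar_prod_mult_mat_vec[OF PT x(1)[OF u] v] by simp
    \<comment> \<open>The Galerkin relation turns the quadratic term of the coarse reduction into
      that of the fine one, so the two reductions agree.\<close>
    also have "Ac *\<^sub>v x v = P\<^sup>T *\<^sub>v (A *\<^sub>v (P *\<^sub>v x v))"
      unfolding galerkin using assoc_mult_mat_vec[OF mult_carrier_mat[OF PT A(1)] P x(1)[OF v]]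
        assoc_mult_mat_vec[OF PT A(1) Pxv] by simp
    also have "x u \<bullet> \<dots> = (P *\<^sub>v x u) \<bullet> (A *\<^sub>v (P *\<^sub>v x v))"
      using scalar_prod_mult_mat_vec[OF PT x(1)[OF u], of "A *\<^sub>v (P *\<^sub>v x v)"] A Pxv by simp
    finally show "covariance \<Omega> (\<lambda>\<omega>. u \<bullet> (P *\<^sub>v W \<omega>)) (\<lambda>\<omega>. v \<bullet> (P *\<^sub>v W \<omega>)) =
        u \<bullet> (mat_inv A *\<^sub>v v) - ((coarse_mat A P Ac Ec)\<^sup>T *\<^sub>v u) \<bullet>
          (mat_inv A *\<^sub>v ((coarse_mat A P Ac Ec)\<^sup>T *\<^sub>v v))"
      unfolding KT[OF u] KT[OF v] inverse_form_diff[OF A u v Pxu Pxv] .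
  next
    fix \<omega> and f \<theta> :: "real vec"
    assume \<omega>: "\<omega> \<in> space \<Omega>" and f: "f \<in> carrier_vec n" and \<theta>: "\<theta> \<in> carrier_vec n"
    define t e where "t = mat_inv A *\<^sub>v f" and "e = \<theta> - t"
    have t: "t \<in> carrier_vec n" "A *\<^sub>v t = f" using spd_inverse_mult_vec[OF A f] by (auto simp: t_def)
    have e: "e \<in> carrier_vec n" using \<theta> t by (simp add: e_def)
    have Ae: "A *\<^sub>v e \<in> carrier_vec n" using A e by simp
    have PAe: "P\<^sup>T *\<^sub>v (A *\<^sub>v e) \<in> carrier_vec k" using PT Ae by simp
    define y where "y = mat_inv Ac *\<^sub>v (P\<^sup>T *\<^sub>v (A *\<^sub>v e))"
    have y: "y \<in> carrier_vec k" using Aci PAe by (simp add: y_def)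
    have Ey: "Ec *\<^sub>v y \<in> carrier_vec k" using Ec y by simp
    note W' = lin_vecD(1)[OF W \<omega>]
    have "A *\<^sub>v e = A *\<^sub>v \<theta> - f"
      unfolding e_def using mult_minus_distrib_mat_vec[OF A(1) \<theta> t(1)] t by simp
    then have "f - A *\<^sub>v \<theta> = - (A *\<^sub>v e)"
      using f A \<theta> by (intro eq_vecI) (auto simp del: index_mult_mat_vec)
    then have r: "P\<^sup>T *\<^sub>v (f - A *\<^sub>v \<theta>) = - (P\<^sup>T *\<^sub>v (A *\<^sub>v e))"
      using mult_mat_uminus_vec[OF PT Ae] by simp
    then have r_carr: "P\<^sup>T *\<^sub>v (f - A *\<^sub>v \<theta>) \<in> carrier_vec k" using PAe by simp
    have "mat_inv Ac *\<^sub>v (P\<^sup>T *\<^sub>v (f - A *\<^sub>v \<theta>)) = - y"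
      unfolding r y_def by (rule mult_mat_uminus_vec[OF Aci PAe])
    then have "\<Phi> \<omega> (P\<^sup>T *\<^sub>v (f - A *\<^sub>v \<theta>)) (0\<^sub>v k) = - y + (Ec *\<^sub>v y + W \<omega>)"
      using step[OF \<omega> r_carr, of "0\<^sub>v k"] y by simp
    also have "\<dots> = W \<omega> - (y - Ec *\<^sub>v y)"
      using y Ec W' by (intro eq_vecI) (auto simp del: index_mult_mat_vec)
    finally have "P *\<^sub>v \<Phi> \<omega> (P\<^sup>T *\<^sub>v (f - A *\<^sub>v \<theta>)) (0\<^sub>v k) = P *\<^sub>v W \<omega> - P *\<^sub>v (y - Ec *\<^sub>v y)"
      using mult_minus_distrib_mat_vec[OF P W', of "y - Ec *\<^sub>v y"] y Ey by simp
    then have "\<theta> + P *\<^sub>v \<Phi> \<omega> (P\<^sup>T *\<^sub>v (f - A *\<^sub>v \<theta>)) (0\<^sub>v k) =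
        t + (coarse_mat A P Ac Ec *\<^sub>v e + P *\<^sub>v W \<omega>)"
      unfolding K(2)[OF e y_def] using t \<theta> P
      by (intro eq_vecI) (auto simp: e_def simp del: index_mult_mat_vec)
    then show "\<theta> + P *\<^sub>v \<Phi> \<omega> (P\<^sup>T *\<^sub>v (f - A *\<^sub>v \<theta>)) (0\<^sub>v k) =
        mat_inv A *\<^sub>v f + (coarse_mat A P Ac Ec *\<^sub>v (\<theta> - mat_inv A *\<^sub>v f) + P *\<^sub>v W \<omega>)"
      by (simp add: t_def e_def)
  qed
qed

text \<open>With iteration matrix zero the prescribed noise covariance is all of A^-1.\<close>

lemma affine_update_exact:
  assumes A: "A \<in> carrier_mat n n" "spd A" and d: "d \<in> I" "dm d = n"
    and mean: "\<And>a. a \<in> carrier_vec n \<Longrightarrow> mean a (Z d) = 0"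
    and cov: "\<And>a b. a \<in> carrier_vec n \<Longrightarrow> b \<in> carrier_vec n \<Longrightarrow>
      cov a (Z d) b (Z d) = a \<bullet> (mat_inv A *\<^sub>v b)"
  shows "affine_update {d} n A (0\<^sub>m n n) (\<lambda>\<omega> f \<theta>. mat_inv A *\<^sub>v f + Z d \<omega>)"
proof (rule affine_updateI[where W = "Z d"])
  have zero: "0\<^sub>m n n *\<^sub>v v = 0\<^sub>v n" if "v \<in> carrier_vec n" for v :: "real vec"
    using that by (intro eq_vecI) auto
  show Zd: "lin_vec {d} n (Z d)" using lin_vec_draw[of d "{d}"] d by simp
  show "cov u (Z d) v (Z d) = u \<bullet> (mat_inv A *\<^sub>v v) -
      ((0\<^sub>m n n)\<^sup>T *\<^sub>v u) \<bullet> (mat_inv A *\<^sub>v ((0\<^sub>m n n)\<^sup>T *\<^sub>v v))"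
    if u: "u \<in> carrier_vec n" and v: "v \<in> carrier_vec n" for u v
    using cov[OF u v] zero[OF u] zero[OF v] spd_inverse_mult_vec(1)[OF A, of "0\<^sub>v n"] by simp
  show "mat_inv A *\<^sub>v f + Z d \<omega> = mat_inv A *\<^sub>v f + (0\<^sub>m n n *\<^sub>v (\<theta> - mat_inv A *\<^sub>v f) + Z d \<omega>)"
    if "\<omega> \<in> space \<Omega>" "f \<in> carrier_vec n" "\<theta> \<in> carrier_vec n" for \<omega> f \<theta>
    using zero[of "\<theta> - mat_inv A *\<^sub>v f"] that spd_inverse_mult_vec(1)[OF A that(2)] lin_vecD(1)[OF Zd that(1)]
    by simp
qed (use mean in auto)

text \<open>The functions \<open>sm\<close> and \<open>co\<close> name the draws of a single
  transition. The index set of the cycle is spelled out because disjointness of the pre-smoothing,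
  coarse and post-smoothing draws is what permits the compositions.\<close>

lemma affine_update_mgmc:
  fixes n :: "nat \<Rightarrow> nat" and A M P :: "nat \<Rightarrow> real mat" and sm :: "nat \<Rightarrow> nat \<Rightarrow> 'd" and co :: 'd
  assumes P: "\<And>l. 1 \<le> l \<Longrightarrow> P l \<in> carrier_mat (n l) (n (l - 1))"
    and A: "\<And>l. A l \<in> carrier_mat (n l) (n l)" "\<And>l. spd (A l)"
    and galerkin: "\<And>l. 1 \<le> l \<Longrightarrow> A (l - 1) = (P l)\<^sup>T * A l * P l"
    and M: "\<And>l. 1 \<le> l \<Longrightarrow> M l \<in> carrier_mat (n l) (n l)" "\<And>l. 1 \<le> l \<Longrightarrow> spd (M l)"
    and inj: "\<And>l k l' k'. sm l k = sm l' k' \<Longrightarrow> l = l' \<and> k = k'" "\<And>l k. sm l k \<noteq> co"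
    and co: "co \<in> I" "dm co = n 0"
      "\<And>a. a \<in> carrier_vec (n 0) \<Longrightarrow> mean a (Z co) = 0"
      "\<And>a b. a \<in> carrier_vec (n 0) \<Longrightarrow> b \<in> carrier_vec (n 0) \<Longrightarrow>
        cov a (Z co) b (Z co) = a \<bullet> (mat_inv (A 0) *\<^sub>v b)"
    and sm: "\<And>l k. 1 \<le> l \<Longrightarrow> l \<le> L \<Longrightarrow> k < 2 * h \<Longrightarrow> sm l k \<in> I \<and> dm (sm l k) = n l"
      "\<And>l k a. 1 \<le> l \<Longrightarrow> l \<le> L \<Longrightarrow> k < 2 * h \<Longrightarrow> a \<in> carrier_vec (n l) \<Longrightarrow>
        mean a (Z (sm l k)) = 0"
      "\<And>l k a b. 1 \<le> l \<Longrightarrow> l \<le> L \<Longrightarrow> k < 2 * h \<Longrightarrow> a \<in> carrier_vec (n l) \<Longrightarrow> b \<in> carrier_vec (n l) \<Longrightarrow>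
        cov a (Z (sm l k)) b (Z (sm l k)) =
          a \<bullet> ((M l + (M l)\<^sup>T - A l) *\<^sub>v b)"
    and l: "l \<le> L"
  shows "affine_update (insert co {sm l' k | l' k. 1 \<le> l' \<and> l' \<le> l \<and> k < 2 * h}) (n l) (A l)
    (vcycle_mat A M P h l) (\<lambda>\<omega> f \<theta>. mgmc A M P h h (\<lambda>l k. Z (sm l k) \<omega>) (Z co \<omega>) l f \<theta>)"
  using l
proof (induction l)
  case 0
  have "dim_row (A 0) = n 0" using A(1)[of 0] by simp
  moreover have "insert co {sm l' k | l' k. 1 \<le> l' \<and> l' \<le> 0 \<and> k < 2 * h} = {co}" by auto
  ultimately show ?case using affine_update_exact[OF A co] by simp
next
  case (Suc l)
  let ?l = "Suc l"
  let ?D = "insert co {sm l' k | l' k. 1 \<le> l' \<and> l' \<le> l \<and> k < 2 * h}"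
  note A' = A[of ?l] and M' = M[of ?l, simplified] and P' = P[of ?l, simplified]
  have G: "A l = (P ?l)\<^sup>T * A ?l * P ?l" using galerkin[of ?l] by simp
  have sml: "k < 2 * h \<Longrightarrow> sm ?l k \<in> I" "k < 2 * h \<Longrightarrow> dm (sm ?l k) = n ?l"
    "k < 2 * h \<Longrightarrow> a \<in> carrier_vec (n ?l) \<Longrightarrow> mean a (Z (sm ?l k)) = 0"
    "k < 2 * h \<Longrightarrow> a \<in> carrier_vec (n ?l) \<Longrightarrow> b \<in> carrier_vec (n ?l) \<Longrightarrow>
      cov a (Z (sm ?l k)) b (Z (sm ?l k)) =
        a \<bullet> ((M ?l + (M ?l)\<^sup>T - A ?l) *\<^sub>v b)" for k a b
    using sm[of ?l k] Suc.prems by auto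
  have pre: "affine_update (sm ?l ` {..<h}) (n ?l) (A ?l) (smoother_mat (A ?l) (M ?l) ^\<^sub>m h)
      (\<lambda>\<omega> f \<theta>. smooth (A ?l) (M ?l) f (\<lambda>j. Z (sm ?l j) \<omega>) h \<theta>)"
    by (rule affine_update_smooth[OF A' M']) (use sml inj(1) in \<open>auto intro: inj_onI\<close>)
  have post: "affine_update ((\<lambda>j. sm ?l (h + j)) ` {..<h}) (n ?l) (A ?l) (smoother_mat (A ?l) (M ?l) ^\<^sub>m h)
      (\<lambda>\<omega> f \<theta>. smooth (A ?l) (M ?l) f (\<lambda>j. Z (sm ?l (h + j)) \<omega>) h \<theta>)"
    by (rule affine_update_smooth[OF A' M']) (use sml inj(1) in \<open>auto intro!: inj_onI dest!: inj(1)\<close>)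
  have IH: "affine_update ?D (n l) (A l) (vcycle_mat A M P h l)
      (\<lambda>\<omega> f \<theta>. mgmc A M P h h (\<lambda>l k. Z (sm l k) \<omega>) (Z co \<omega>) l f \<theta>)"
    using Suc.IH Suc.prems by simp
  note coarse = affine_update_coarse[OF A' P' A G IH]
  have "sm ?l ` {..<h} \<inter> ?D = {}" using inj by (fastforce dest: inj(1))
  note two = affine_update_comp[OF A' pre coarse this]
  have disj: "(sm ?l ` {..<h} \<union> ?D) \<inter> (\<lambda>j. sm ?l (h + j)) ` {..<h} = {}"
  proof -
    have "sm ?l (h + j) \<noteq> co" "sm ?l (h + j) \<noteq> sm l' k \<or> l' = ?l \<and> k = h + j" for j l' k
      using inj by metis+
    then show ?thesis by fastforce
  qed
  note three = affine_update_comp[OF A' two post disj]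
  have "sm ?l ` {..<h} \<union> ?D \<union> (\<lambda>j. sm ?l (h + j)) ` {..<h} =
      insert co {sm l' k | l' k. 1 \<le> l' \<and> l' \<le> ?l \<and> k < 2 * h}" (is "?X = ?Y")
  proof (rule subset_antisym)
    show "?X \<subseteq> ?Y" by fastforce
    show "?Y \<subseteq> ?X"
    proof
      fix z assume z: "z \<in> ?Y"
      show "z \<in> ?X"
      proof (cases "z \<in> ?D")
        case False
        then obtain k where k: "z = sm ?l k" "k < 2 * h" using z by (auto simp: le_Suc_eq)
        show ?thesis
        proof (cases "k < h")
          case False
          \<comment> \<open>The indices from h to 2 h - 1 are those of post-smoothing.\<close>
          then have "z = sm ?l (h + (k - h))" "k - h < h" using k by auto
          then show ?thesis by blast
        qed (use k in auto)
      qed auto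
    qed
  qed
  moreover have "dim_row (A l) = n l" using A(1)[of l] by simp
  ultimately show ?case using three by (simp add: Let_def)
qed

section \<open>The moments of a chain of affine updates\<close>

text \<open>\<open>H m\<close> collects the draws that enter the state after m transitions. With t =
  A^-1 f, one transition is X -> E X + (t - E t) + W, where W uses fresh draws. Constants drop out
  of covariances, and the terms with A^-1 in the noise covariance turn the recursion into one for
  the deviation from A^-1.\<close>

lemma affine_chain:
  fixes A E :: "real mat" and X :: "nat \<Rightarrow> 'w \<Rightarrow> real vec"
  assumes A: "A \<in> carrier_mat n n" "spd A" and f: "f \<in> carrier_vec n"
    and step: "\<And>m. affine_update (D m) n A E (\<Phi> m)"
    and X0: "lin_vec (H 0) n (X 0)"
    and XSuc: "\<And>m \<omega>. \<omega> \<in> space \<Omega> \<Longrightarrow> X (Suc m) \<omega> = \<Phi> m \<omega> f (X m \<omega>)"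
    and H: "\<And>m. H (Suc m) = H m \<union> D m" "\<And>m. H m \<inter> D m = {}"
  shows "mean_vec \<Omega> n (X (Suc m)) - mat_inv A *\<^sub>v f = E *\<^sub>v (mean_vec \<Omega> n (X m) - mat_inv A *\<^sub>v f)"
    and "cov_mat \<Omega> n (X (Suc m)) (X (Suc m)) - mat_inv A =
      E * (cov_mat \<Omega> n (X m) (X m) - mat_inv A) * E\<^sup>T"
    and "cov_mat \<Omega> n (X (m + Suc s)) (X m) = E * cov_mat \<Omega> n (X (m + s)) (X m)"
proof -
  define t where "t = mat_inv A *\<^sub>v f"
  have t: "t \<in> carrier_vec n" using spd_inverse_mult_vec(1)[OF A f] by (simp add: t_def)
  note Ai = spd_invertible(1)[OF A]
  have "\<exists>W. invariant_noise (D m) n A E W \<and>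
      (\<forall>\<omega>\<in>space \<Omega>. \<forall>\<theta>\<in>carrier_vec n. \<Phi> m \<omega> f \<theta> = t + (E *\<^sub>v (\<theta> - t) + W \<omega>))" for m
    using step[of m] f unfolding affine_update_def t_def by blast
  then obtain W where N: "\<And>m. invariant_noise (D m) n A E (W m)"
    and \<Phi>: "\<And>m \<omega> \<theta>. \<omega> \<in> space \<Omega> \<Longrightarrow> \<theta> \<in> carrier_vec n \<Longrightarrow>
      \<Phi> m \<omega> f \<theta> = t + (E *\<^sub>v (\<theta> - t) + W m \<omega>)"
    by metis
  note W = invariant_noiseD(1)[OF N] and mean = invariant_noiseD(2)[OF N] and cov = invariant_noiseD(3)[OF N]
  have E: "E \<in> carrier_mat n n" using step[of 0] by (simp add: affine_update_def)
  \<comment> \<open>With this constant, t is a fixed point of the noiseless map.\<close>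
  define c where "c = t - E *\<^sub>v t"
  have Et: "E *\<^sub>v t \<in> carrier_vec n" using E t by simp
  have c: "c \<in> carrier_vec n" using t Et by (simp add: c_def)
  have step_eq: "t + (E *\<^sub>v (\<theta> - t) + w) = E *\<^sub>v \<theta> + (c + w)"
    if "\<theta> \<in> carrier_vec n" "w \<in> carrier_vec n" for \<theta> w
    using mult_minus_distrib_mat_vec[OF E that(1) t] E that t
    by (intro eq_vecI) (auto simp: c_def simp del: index_mult_mat_vec)
  have V: "lin_vec (D m) n (\<lambda>\<omega>. c + W m \<omega>)" for m
    using lin_vec_add[OF lin_vec_const[OF c] W] .
  have X: "lin_vec (H m) n (X m)" for m
  proof (induction m)
    case 0
    show ?case by (rule X0)
  next
    case (Suc m)
    have "lin_vec (H (Suc m)) n (\<lambda>\<omega>. E *\<^sub>v X m \<omega> + (c + W m \<omega>))"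
      unfolding H(1)
      by (intro lin_vec_add lin_vec_mono[OF lin_vec_mult[OF E Suc]] lin_vec_mono[OF V]) auto
    then show ?case
      by (rule lin_vec_cong)
        (simp add: XSuc \<Phi> lin_vecD(1)[OF Suc] step_eq lin_vecD(1)[OF W])
  qed
  have Xrec: "X (Suc m) \<omega> = E *\<^sub>v X m \<omega> + (c + W m \<omega>)" if "\<omega> \<in> space \<Omega>" for m \<omega>
    using that by (simp add: XSuc \<Phi> lin_vecD(1)[OF X] step_eq lin_vecD(1)[OF W])
  have V_scalar: "u \<bullet> (c + W m \<omega>) = u \<bullet> c + u \<bullet> W m \<omega>" if "u \<in> carrier_vec n" "\<omega> \<in> space \<Omega>" for u m \<omega>
    using that c lin_vecD(1)[OF W] by (intro scalar_prod_add_distrib[of _ n]) auto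
  have V_mean: "expectation (\<lambda>\<omega>. u \<bullet> (c + W m \<omega>)) = u \<bullet> c" if u: "u \<in> carrier_vec n" for u m
  proof -
    have "expectation (\<lambda>\<omega>. u \<bullet> (c + W m \<omega>)) = expectation (\<lambda>\<omega>. u \<bullet> c + u \<bullet> W m \<omega>)"
      by (rule Bochner_Integration.integral_cong[OF refl]) (rule V_scalar[OF u])
    also have "\<dots> = u \<bullet> c" using lin_vecD(4)[OF W u] mean[OF u] by (simp add: prob_space)
    finally show ?thesis .
  qed
  have V_cov: "covariance \<Omega> (\<lambda>\<omega>. u \<bullet> (c + W m \<omega>)) (\<lambda>\<omega>. v \<bullet> (c + W m \<omega>)) =
      u \<bullet> (mat_inv A *\<^sub>v v) - (E\<^sup>T *\<^sub>v u) \<bullet> (mat_inv A *\<^sub>v (E\<^sup>T *\<^sub>v v))"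
    if u: "u \<in> carrier_vec n" and v: "v \<in> carrier_vec n" for u v m
  proof -
    have "covariance \<Omega> (\<lambda>\<omega>. u \<bullet> (c + W m \<omega>)) (\<lambda>\<omega>. v \<bullet> (c + W m \<omega>)) =
        cov u (W m) v (W m)"
      unfolding covariance_def V_mean[OF u] V_mean[OF v] mean[OF u] mean[OF v]
      by (rule Bochner_Integration.integral_cong[OF refl]) (simp add: V_scalar u v)
    then show ?thesis using cov[OF u v] by simp
  qed
  have ET: "E\<^sup>T *\<^sub>v u \<in> carrier_vec n" if "u \<in> carrier_vec n" for u using E that by simp
  let ?mean = "\<lambda>m. mean_vec \<Omega> n (X m)" and ?C = "\<lambda>m k. cov_mat \<Omega> n (X m) (X k)"
  have mean_carr: "?mean m \<in> carrier_vec n" for m by (rule cov_mat_carrier(2))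
  have C_carr: "?C m k \<in> carrier_mat n n" for m k by (rule cov_mat_carrier(1))
  have "?mean (Suc m) = E *\<^sub>v ?mean m + c"
  proof (rule vec_eq_by_scalar_prod[of _ n])
    fix u :: "real vec" assume u: "u \<in> carrier_vec n"
    have "u \<bullet> ?mean (Suc m) = expectation (\<lambda>\<omega>. u \<bullet> (E *\<^sub>v X m \<omega> + (c + W m \<omega>)))"
      unfolding mean_vec_scalar_prod[OF X u]
      by (rule Bochner_Integration.integral_cong[OF refl]) (simp add: Xrec)
    also have "\<dots> = (E\<^sup>T *\<^sub>v u) \<bullet> ?mean m + u \<bullet> c"
      unfolding lin_vec_moments(1)[OF E X V H(2) u u] V_mean[OF u] mean_vec_scalar_prod[OF X ET[OF u]] ..
    also have "\<dots> = u \<bullet> (E *\<^sub>v ?mean m + c)"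
      using E u c mean_carr[of m] scalar_prod_mult_mat_vec[OF E u mean_carr]
      by (simp add: scalar_prod_add_distrib[of _ n])
    finally show "u \<bullet> ?mean (Suc m) = u \<bullet> (E *\<^sub>v ?mean m + c)" .
  qed (use E c mean_carr in auto)
  then show "?mean (Suc m) - mat_inv A *\<^sub>v f = E *\<^sub>v (?mean m - mat_inv A *\<^sub>v f)"
    unfolding t_def[symmetric] using mult_minus_distrib_mat_vec[OF E mean_carr t, of m] E t mean_carr[of m]
    by (intro eq_vecI) (auto simp: c_def simp del: index_mult_mat_vec)
  show "?C (Suc m) (Suc m) - mat_inv A = E * (?C m m - mat_inv A) * E\<^sup>T"
  proof (rule mat_eq_by_form[of _ n n])
    fix u v :: "real vec" assume u: "u \<in> carrier_vec n" and v: "v \<in> carrier_vec n"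
    let ?u = "E\<^sup>T *\<^sub>v u" and ?v = "E\<^sup>T *\<^sub>v v"
    have diff: "a \<bullet> ((?C k k - mat_inv A) *\<^sub>v b) = a \<bullet> (?C k k *\<^sub>v b) - a \<bullet> (mat_inv A *\<^sub>v b)"
      if "a \<in> carrier_vec n" "b \<in> carrier_vec n" for a b k
      using minus_mult_distrib_mat_vec[OF C_carr Ai that(2)] C_carr[of k k] Ai that
      by (simp add: scalar_prod_minus_distrib[of _ n])
    have "u \<bullet> (?C (Suc m) (Suc m) *\<^sub>v v) = covariance \<Omega> (\<lambda>\<omega>. u \<bullet> (E *\<^sub>v X m \<omega> + (c + W m \<omega>)))
        (\<lambda>\<omega>. v \<bullet> (E *\<^sub>v X m \<omega> + (c + W m \<omega>)))"
      unfolding cov_mat_form[OF X X u v] by (rule covariance_cong) (simp_all add: Xrec)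
    also have "\<dots> = ?u \<bullet> (?C m m *\<^sub>v ?v) + (u \<bullet> (mat_inv A *\<^sub>v v) - ?u \<bullet> (mat_inv A *\<^sub>v ?v))"
      unfolding lin_vec_moments(2)[OF E X V H(2) u v] V_cov[OF u v] cov_mat_form[OF X X ET[OF u] ET[OF v]] ..
    finally have "u \<bullet> ((?C (Suc m) (Suc m) - mat_inv A) *\<^sub>v v) = ?u \<bullet> ((?C m m - mat_inv A) *\<^sub>v ?v)"
      by (simp add: diff u v ET)
    also have "\<dots> = u \<bullet> ((E * (?C m m - mat_inv A) * E\<^sup>T) *\<^sub>v v)"
    proof -
      have D: "?C m m - mat_inv A \<in> carrier_mat n n" using Ai by (rule minus_carrier_mat)
      have ETm: "E\<^sup>T \<in> carrier_mat n n" using E by simp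
      have Dv: "(?C m m - mat_inv A) *\<^sub>v ?v \<in> carrier_vec n" using D ET[OF v] by (rule mult_mat_vec_carrier)
      have "(E * (?C m m - mat_inv A) * E\<^sup>T) *\<^sub>v v = E *\<^sub>v ((?C m m - mat_inv A) *\<^sub>v ?v)"
        using assoc_mult_mat_vec[OF mult_carrier_mat[OF E D] ETm v] assoc_mult_mat_vec[OF E D ET[OF v]]
        by simp
      then show ?thesis using scalar_prod_mult_mat_vec[OF E u Dv] by simp
    qed
    finally show "u \<bullet> ((?C (Suc m) (Suc m) - mat_inv A) *\<^sub>v v) =
        u \<bullet> ((E * (?C m m - mat_inv A) * E\<^sup>T) *\<^sub>v v)" .
  qed (use E Ai in \<open>auto intro: minus_carrier_mat\<close>)
  have H_mono: "H m \<subseteq> H (m + s)" by (induction s) (auto simp: H(1))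
  show "?C (m + Suc s) m = E * ?C (m + s) m"
  proof (rule mat_eq_by_form[of _ n n])
    fix u v :: "real vec" assume u: "u \<in> carrier_vec n" and v: "v \<in> carrier_vec n"
    let ?u = "E\<^sup>T *\<^sub>v u"
    let ?k = "m + s"
    \<comment> \<open>The noise of a later transition is uncorrelated with the state at time m,
      since \<open>H m\<close> is contained in \<open>H (m + s)\<close>.\<close>
    have disj: "D ?k \<inter> H m = {}" using H(2)[of ?k] H_mono by blast
    have eq: "u \<bullet> X (Suc ?k) \<omega> = ?u \<bullet> X ?k \<omega> + u \<bullet> (c + W ?k \<omega>)" if "\<omega> \<in> space \<Omega>" for \<omega>
      using Xrec[OF that, of ?k] scalar_prod_mult_mat_vec[OF E u lin_vecD(1)[OF X that, of ?k]]
        E u lin_vecD(1)[OF X that, of ?k] lin_vecD(1)[OF V that, of ?k]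
      by (simp add: scalar_prod_add_distrib[of _ n])
    have "u \<bullet> (?C (Suc ?k) m *\<^sub>v v) =
        covariance \<Omega> (\<lambda>\<omega>. ?u \<bullet> X ?k \<omega> + u \<bullet> (c + W ?k \<omega>)) (\<lambda>\<omega>. v \<bullet> X m \<omega>)"
      unfolding cov_mat_form[OF X X u v] by (rule covariance_cong) (simp_all only: eq)
    also have "\<dots> = ?u \<bullet> (?C ?k m *\<^sub>v v)"
      unfolding covariance_add_left[OF lin_vecD(3)[OF X ET[OF u]] lin_vecD(3)[OF V u] lin_vecD(3)[OF X v]]
        lin_uncorrelated[OF lin_vecD(2)[OF V u] lin_vecD(2)[OF X v] disj] cov_mat_form[OF X X ET[OF u] v]
      by simp
    also have "\<dots> = u \<bullet> (E *\<^sub>v (?C ?k m *\<^sub>v v))"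
      by (rule scalar_prod_mult_mat_vec[OF E u mult_mat_vec_carrier[OF C_carr v], symmetric])
    also have "E *\<^sub>v (?C ?k m *\<^sub>v v) = (E * ?C ?k m) *\<^sub>v v"
      by (rule assoc_mult_mat_vec[OF E C_carr v, symmetric])
    finally show "u \<bullet> (?C (m + Suc s) m *\<^sub>v v) = u \<bullet> ((E * ?C ?k m) *\<^sub>v v)" by simp
  qed (use E C_carr in auto)
qed

end

section \<open>Normal random vectors\<close>

context prob_space
begin

lemma normal_rv_moments:
  assumes X: "normal_rv M X m v" and v: "0 \<le> v"
  shows "square_integrable M X" "expectation X = m" "covariance M X X = v"
proof -
  have meas: "X \<in> borel_measurable M" using X by (simp add: normal_rv_def)
  have "square_integrable M X \<and> expectation X = m \<and> covariance M X X = v"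
  proof (cases "v = 0")
    case True
    then have ae: "AE \<omega> in M. X \<omega> = m" using X by (simp add: normal_rv_def)
    have "integrable M (\<lambda>\<omega>. (X \<omega>)\<^sup>2) \<longleftrightarrow> integrable M (\<lambda>_. m\<^sup>2)"
      using ae meas by (intro integrable_cong_AE) auto
    then have sq: "square_integrable M X" using meas by (simp add: square_integrable_def)
    have "expectation X = expectation (\<lambda>_. m)"
      using ae meas by (intro integral_cong_AE) auto
    then have mean: "expectation X = m" by (simp add: prob_space)
    have "covariance M X X = expectation (\<lambda>_. 0)"
      unfolding covariance_def mean using ae meas by (intro integral_cong_AE) auto
    then show ?thesis using sq mean True by simp
  next
    case False
    let ?\<sigma> = "sqrt v"
    have \<sigma>: "0 < ?\<sigma>" using v False by simp
    have D: "distributed M lborel X (normal_density m ?\<sigma>)" using X False by (simp add: normal_rv_def)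
    have "integrable M (\<lambda>\<omega>. (X \<omega> - m)\<^sup>2)"
      using distributed_integrable[OF D, of "\<lambda>x. (x - m)\<^sup>2"] integrable_normal_moment[OF \<sigma>, of m 2] by simp
    moreover have "integrable M X"
      using distributed_integrable[OF D, of "\<lambda>x. x"] integrable_normal_moment_nz_1[OF \<sigma>, of m] by simp
    \<comment> \<open>Adding 2 m X - m^2 to (X - m)^2 leaves X^2.\<close>
    ultimately have "integrable M (\<lambda>\<omega>. (X \<omega> - m)\<^sup>2 + 2 * m * X \<omega> - m\<^sup>2)" by simp
    then have "integrable M (\<lambda>\<omega>. (X \<omega>)\<^sup>2)" by (simp add: power2_diff algebra_simps)
    then have sq: "square_integrable M X" using meas by (simp add: square_integrable_def)
    have mean: "expectation X = m" by (rule normal_distributed_expectation[OF \<sigma> D])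
    have "covariance M X X = variance X" by (simp add: covariance_def power2_eq_square)
    also have "\<dots> = v" using normal_distributed_variance[OF \<sigma> D] v by simp
    finally show ?thesis using sq mean by simp
  qed
  then show "square_integrable M X" "expectation X = m" "covariance M X X = v" by auto
qed

text \<open>The definition supplies only variances of linear functionals; covariances follow by
  polarisation, from the variance at a + b.\<close>

lemma mvn_moments:
  assumes X: "mvn M n X \<mu> \<Sigma>" and a: "a \<in> carrier_vec n"
  shows "\<omega> \<in> space M \<Longrightarrow> X \<omega> \<in> carrier_vec n" "square_integrable M (\<lambda>\<omega>. a \<bullet> X \<omega>)"
    "expectation (\<lambda>\<omega>. a \<bullet> X \<omega>) = a \<bullet> \<mu>"
    "b \<in> carrier_vec n \<Longrightarrow> covariance M (\<lambda>\<omega>. a \<bullet> X \<omega>) (\<lambda>\<omega>. b \<bullet> X \<omega>) = a \<bullet> (\<Sigma> *\<^sub>v b)"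
proof -
  have \<Sigma>: "\<Sigma> \<in> carrier_mat n n" "psd \<Sigma>" and \<mu>: "\<mu> \<in> carrier_vec n"
    and meas: "X \<in> measurable M (borel_vec n)"
    and normal: "\<And>a. a \<in> carrier_vec n \<Longrightarrow> normal_rv M (\<lambda>\<omega>. a \<bullet> X \<omega>) (a \<bullet> \<mu>) (a \<bullet> (\<Sigma> *\<^sub>v a))"
    using X by (auto simp: mvn_def)
  have "0 \<le> a \<bullet> (\<Sigma> *\<^sub>v a)" if "a \<in> carrier_vec n" for a
    using \<Sigma>(2) that by (simp add: psd_iff[OF \<Sigma>(1)])
  note moments = normal_rv_moments[OF normal this]
  have "space (borel_vec n) = carrier_vec n" unfolding borel_vec_def by (rule space_measure_of) auto
  then have carr: "X \<omega> \<in> carrier_vec n" if "\<omega> \<in> space M" for \<omega>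
    using measurable_space[OF meas that] by simp
  show "\<omega> \<in> space M \<Longrightarrow> X \<omega> \<in> carrier_vec n" by (rule carr)
  show "square_integrable M (\<lambda>\<omega>. a \<bullet> X \<omega>)" "expectation (\<lambda>\<omega>. a \<bullet> X \<omega>) = a \<bullet> \<mu>"
    using moments(1,2)[OF a a] by auto
  assume b: "b \<in> carrier_vec n"
  let ?f = "\<lambda>\<omega>. a \<bullet> X \<omega>" and ?g = "\<lambda>\<omega>. b \<bullet> X \<omega>"
  have sq: "square_integrable M ?f" "square_integrable M ?g" using moments(1)[OF a a] moments(1)[OF b b] .
  have ab: "a + b \<in> carrier_vec n" using a b by simp
  have "(a + b) \<bullet> (\<Sigma> *\<^sub>v (a + b)) = covariance M (\<lambda>\<omega>. (a + b) \<bullet> X \<omega>) (\<lambda>\<omega>. (a + b) \<bullet> X \<omega>)"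
    using moments(3)[OF ab ab] by simp
  also have "\<dots> = covariance M (\<lambda>\<omega>. ?f \<omega> + ?g \<omega>) (\<lambda>\<omega>. ?f \<omega> + ?g \<omega>)"
    using a b carr by (intro covariance_cong) (auto simp: add_scalar_prod_distrib[of _ n])
  also have "\<dots> = covariance M (\<lambda>\<omega>. ?f \<omega> + ?g \<omega>) ?f + covariance M (\<lambda>\<omega>. ?f \<omega> + ?g \<omega>) ?g"
    unfolding covariance_add_left[OF sq square_integrable_add[OF sq]]
    by (intro arg_cong2[where f = "(+)"] covariance_commute)
  also have "\<dots> = covariance M ?f ?f + 2 * covariance M ?f ?g + covariance M ?g ?g"
    unfolding covariance_add_left[OF sq sq(1)] covariance_add_left[OF sq sq(2)]
    using covariance_commute[of M ?f ?g] by linarith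
  also have "\<dots> = a \<bullet> (\<Sigma> *\<^sub>v a) + 2 * covariance M ?f ?g + b \<bullet> (\<Sigma> *\<^sub>v b)"
    using moments(3)[OF a a] moments(3)[OF b b] by simp
  also have "(a + b) \<bullet> (\<Sigma> *\<^sub>v (a + b)) = a \<bullet> (\<Sigma> *\<^sub>v a) + 2 * (a \<bullet> (\<Sigma> *\<^sub>v b)) + b \<bullet> (\<Sigma> *\<^sub>v b)"
  proof -
    have sym: "transpose_mat \<Sigma> = \<Sigma>" using \<Sigma> by (simp add: psd_iff[OF \<Sigma>(1)])
    have "b \<bullet> (\<Sigma> *\<^sub>v a) = a \<bullet> (\<Sigma> *\<^sub>v b)"
      unfolding symmetric_form[OF \<Sigma>(1) sym b a, symmetric]
      using \<Sigma>(1) a b by (intro comm_scalar_prod[of _ n]) auto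
    then show ?thesis
      using \<Sigma>(1) a b by (simp add: mult_add_distrib_mat_vec[of \<Sigma> n n] add_scalar_prod_distrib[of _ n]
          scalar_prod_add_distrib[of _ n])
  qed
  finally show "covariance M ?f ?g = a \<bullet> (\<Sigma> *\<^sub>v b)" by simp
qed

text \<open>Coordinates generate the sigma-algebra, and a functional is a finite combination of
  them. This transfers independence from the vectors to their scalar functionals.\<close>

lemma borel_measurable_scalar_prod:
  assumes a: "a \<in> carrier_vec n"
  shows "(\<lambda>v. a \<bullet> v) \<in> borel_measurable (borel_vec n)"
proof -
  let ?G = "{{v \<in> carrier_vec n. v $ i \<in> B} | i B. i < n \<and> B \<in> sets (borel :: real measure)}"
  have G: "?G \<subseteq> Pow (carrier_vec n)" by auto
  have sp: "space (borel_vec n) = carrier_vec n" unfolding borel_vec_def by (rule space_measure_of[OF G])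
  have sets: "sets (borel_vec n) = sigma_sets (carrier_vec n) ?G"
    unfolding borel_vec_def by (rule sets_measure_of[OF G])
  have coord: "(\<lambda>v. v $ i) \<in> borel_measurable (borel_vec n)" if "i < n" for i
  proof (rule measurableI)
    fix B :: "real set" assume "B \<in> sets borel"
    then have "{v \<in> carrier_vec n. v $ i \<in> B} \<in> ?G" using that by blast
    moreover have "(\<lambda>v. v $ i) -` B \<inter> space (borel_vec n) = {v \<in> carrier_vec n. v $ i \<in> B}"
      unfolding sp by auto
    ultimately show "(\<lambda>v. v $ i) -` B \<inter> space (borel_vec n) \<in> sets (borel_vec n)"
      unfolding sets by (simp add: sigma_sets.Basic)
  qed auto
  have "(\<lambda>v. \<Sum>i\<in>{0..<n}. a $ i * v $ i) \<in> borel_measurable (borel_vec n)"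
    using coord by (intro borel_measurable_sum borel_measurable_times) auto
  moreover have "(\<Sum>i\<in>{0..<n}. a $ i * v $ i) = a \<bullet> v" if "v \<in> space (borel_vec n)" for v
    using that unfolding sp by (simp add: scalar_prod_def)
  ultimately show ?thesis by (simp cong: measurable_cong)
qed

lemma indep_vars_uncorrelated:
  assumes indep: "indep_vars (\<lambda>d. borel_vec (dm d)) Z I" and d: "d \<in> I" "d' \<in> I" "d \<noteq> d'"
    and a: "a \<in> carrier_vec (dm d)" and b: "b \<in> carrier_vec (dm d')"
    and sq: "square_integrable M (\<lambda>\<omega>. a \<bullet> Z d \<omega>)" "square_integrable M (\<lambda>\<omega>. b \<bullet> Z d' \<omega>)"
  shows "covariance M (\<lambda>\<omega>. a \<bullet> Z d \<omega>) (\<lambda>\<omega>. b \<bullet> Z d' \<omega>) = 0"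
proof -
  \<comment> \<open>Independence is stated for one family over \<open>{d, d'}\<close>, so the two
    test vectors are merged into one function of the index.\<close>
  define c where "c i = (if i = d then a else b)" for i
  have "indep_vars (\<lambda>d. borel_vec (dm d)) Z {d, d'}"
    using indep d by (intro indep_vars_subset[OF indep]) auto
  then have "indep_vars (\<lambda>_. borel) (\<lambda>i \<omega>. c i \<bullet> Z i \<omega>) {d, d'}"
    by (rule indep_vars_compose2) (use a b in \<open>auto simp: c_def borel_measurable_scalar_prod\<close>)
  moreover have "integrable M (\<lambda>\<omega>. c i \<bullet> Z i \<omega>)" if "i \<in> {d, d'}" for i
    using that sq d(3) square_integrable_integrable by (auto simp: c_def)
  ultimately have "expectation (\<lambda>\<omega>. \<Prod>i\<in>{d, d'}. c i \<bullet> Z i \<omega>) = (\<Prod>i\<in>{d, d'}. expectation (\<lambda>\<omega>. c i \<bullet> Z i \<omega>))"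
    by (intro indep_vars_lebesgue_integral) auto
  then have "expectation (\<lambda>\<omega>. (a \<bullet> Z d \<omega>) * (b \<bullet> Z d' \<omega>)) =
      expectation (\<lambda>\<omega>. a \<bullet> Z d \<omega>) * expectation (\<lambda>\<omega>. b \<bullet> Z d' \<omega>)"
    using d(3) d(3)[symmetric] by (simp add: c_def)
  then show ?thesis using covariance_eq[OF sq] by simp
qed

end

section \<open>Contractions in the energy norm\<close>

lemma mat_sqrt_form:
  assumes A: "A \<in> carrier_mat n n" "spd A" and x: "x \<in> carrier_vec n" and y: "y \<in> carrier_vec n"
  shows "(mat_sqrt A *\<^sub>v x) \<bullet> (mat_sqrt A *\<^sub>v y) = x \<bullet> (A *\<^sub>v y)"
proof -
  note R = mat_sqrt_spd[OF A]
  have sym: "(mat_sqrt A)\<^sup>T = mat_sqrt A" using R by (simp add: spd_iff)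
  have Ry: "mat_sqrt A *\<^sub>v y \<in> carrier_vec n" using R(1) y by simp
  have "mat_sqrt A *\<^sub>v (mat_sqrt A *\<^sub>v y) = A *\<^sub>v y"
    using assoc_mult_mat_vec[OF R(1) R(1) y] R(3) by simp
  then show ?thesis using symmetric_form[OF R(1) sym x Ry] by simp
qed

text \<open>A^{1/2} carries the energy inner product to the Euclidean one and is onto, so
  self-adjointness and the bounds of E become symmetry and 0 <= X <= \<delta>. The last two
  identities move E and its transpose past A^{1/2}.\<close>

lemma energy_contraction_similar:
  assumes A: "A \<in> carrier_mat n n" "spd A" and E: "energy_contraction n A E \<delta>" and \<delta>: "0 \<le> \<delta>"
  defines "R \<equiv> mat_sqrt A" and "X \<equiv> mat_sqrt A * E * mat_inv (mat_sqrt A)"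
  shows "X \<in> carrier_mat n n" "X\<^sup>T = X" "spec_norm X \<le> \<delta>"
    "R * E = X * R" "E\<^sup>T * R = R * X"
proof -
  have R: "R \<in> carrier_mat n n" "spd R" "R * R = A" using mat_sqrt_spd[OF A] by (auto simp: R_def)
  have Ec: "E \<in> carrier_mat n n" using E by (simp add: energy_contraction_def)
  have E_sym: "(E *\<^sub>v u) \<bullet> (A *\<^sub>v v) = u \<bullet> (A *\<^sub>v (E *\<^sub>v v))"
    if "u \<in> carrier_vec n" "v \<in> carrier_vec n" for u v
    using E that by (simp add: energy_contraction_def)
  have E_bounds: "0 \<le> v \<bullet> (A *\<^sub>v (E *\<^sub>v v))" "v \<bullet> (A *\<^sub>v (E *\<^sub>v v)) \<le> \<delta> * (v \<bullet> (A *\<^sub>v v))"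
    if "v \<in> carrier_vec n" for v
    using E that by (auto simp: energy_contraction_def)
  note Ri = spd_invertible[OF R(1,2)] and form = mat_sqrt_form[OF A, folded R_def]
  have X_def': "X = R * E * mat_inv R" by (simp add: X_def R_def)
  show X: "X \<in> carrier_mat n n" using R Ec Ri by (simp add: X_def')
  have EV: "E *\<^sub>v v \<in> carrier_vec n" if "v \<in> carrier_vec n" for v using Ec that by simp
  have XR: "X *\<^sub>v (R *\<^sub>v w) = R *\<^sub>v (E *\<^sub>v w)" if w: "w \<in> carrier_vec n" for w
  proof -
    have Rw: "R *\<^sub>v w \<in> carrier_vec n" using R w by simp
    show ?thesis
      unfolding X_def' assoc_mult_mat_vec[OF mult_carrier_mat[OF R(1) Ec] Ri(1) Rw]
        spd_inverse_mult_vec(3)[OF R(1,2) w] by (rule assoc_mult_mat_vec[OF R(1) Ec w])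
  qed
  have surj: "\<exists>w\<in>carrier_vec n. v = R *\<^sub>v w" if "v \<in> carrier_vec n" for v
  proof (rule bexI)
    show "v = R *\<^sub>v (mat_inv R *\<^sub>v v)" by (rule spd_inverse_mult_vec(2)[OF R(1,2) that, symmetric])
    show "mat_inv R *\<^sub>v v \<in> carrier_vec n" by (rule spd_inverse_mult_vec(1)[OF R(1,2) that])
  qed
  show symX: "X\<^sup>T = X"
  proof (rule symmetric_formI[OF X])
    fix u v :: "real vec" assume u: "u \<in> carrier_vec n" and v: "v \<in> carrier_vec n"
    obtain a b where ab: "a \<in> carrier_vec n" "b \<in> carrier_vec n" "u = R *\<^sub>v a" "v = R *\<^sub>v b"
      using surj[OF u] surj[OF v] by blast
    show "(X *\<^sub>v u) \<bullet> v = u \<bullet> (X *\<^sub>v v)"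
      unfolding ab(3,4) XR[OF ab(1)] XR[OF ab(2)] form[OF EV[OF ab(1)] ab(2)] form[OF ab(1) EV[OF ab(2)]]
      by (rule E_sym[OF ab(1,2)])
  qed
  have X_bounds: "0 \<le> v \<bullet> (X *\<^sub>v v) \<and> v \<bullet> (X *\<^sub>v v) \<le> \<delta> * (v \<bullet> v)" if v: "v \<in> carrier_vec n" for v
  proof -
    obtain w where w: "w \<in> carrier_vec n" "v = R *\<^sub>v w" using surj[OF v] by blast
    show ?thesis
      unfolding w(2) XR[OF w(1)] form[OF w(1) EV[OF w(1)]] form[OF w(1) w(1)] using E_bounds[OF w(1)] by simp
  qed
  show "spec_norm X \<le> \<delta>"
    using X_bounds symX by (intro symmetric_spec_norm_le[OF X _ _ \<delta>]) (auto simp: psd_iff[OF X])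
  show "R * E = X * R"
  proof (rule mat_eq_by_mult_vec[of _ n n])
    fix v :: "real vec" assume v: "v \<in> carrier_vec n"
    show "(R * E) *\<^sub>v v = (X * R) *\<^sub>v v"
      unfolding assoc_mult_mat_vec[OF R(1) Ec v] assoc_mult_mat_vec[OF X R(1) v] XR[OF v] ..
  qed (use R Ec X in auto)
  have "(R * E)\<^sup>T = (X * R)\<^sup>T" using \<open>R * E = X * R\<close> by simp
  then show "E\<^sup>T * R = R * X"
    using R(2) symX by (simp only: transpose_mult[OF R(1) Ec] transpose_mult[OF X R(1)] spd_iff[OF R(1)])
qed

section \<open>Frobenius inner products and root convergence\<close>

definition frob_inner :: "real mat \<Rightarrow> real mat \<Rightarrow> real" where
  "frob_inner X Y = (\<Sum>i\<in>{0..<dim_row X}. row X i \<bullet> row Y i)"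

lemma frob_inner_self: "frob_inner X X = (frob X)\<^sup>2"
  by (simp add: frob_inner_def frob_def L2_set_def sum_nonneg norm2_squared)

lemma frob_Cauchy_Schwarz:
  assumes "X \<in> carrier_mat m n" "Y \<in> carrier_mat m n"
  shows "frob_inner X Y \<le> frob X * frob Y"
proof -
  have "frob_inner X Y \<le> (\<Sum>i\<in>{0..<m}. \<bar>norm2 (row X i)\<bar> * \<bar>norm2 (row Y i)\<bar>)"
    unfolding frob_inner_def using assms
    by (auto intro!: sum_mono order_trans[OF abs_ge_self norm2_Cauchy_Schwarz[of _ n]])
  also have "\<dots> \<le> frob X * frob Y"
    using L2_set_mult_ineq[of "\<lambda>i. norm2 (row X i)" "\<lambda>i. norm2 (row Y i)" "{0..<m}"] assms
    by (simp add: frob_def)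
  finally show ?thesis .
qed

lemma frob_inner_transpose:
  assumes "X \<in> carrier_mat m n" "Y \<in> carrier_mat m n"
  shows "frob_inner (X\<^sup>T) (Y\<^sup>T) = frob_inner X Y"
proof -
  have "frob_inner (X\<^sup>T) (Y\<^sup>T) = (\<Sum>j\<in>{0..<n}. \<Sum>i\<in>{0..<m}. X $$ (i, j) * Y $$ (i, j))"
    using assms by (auto simp: frob_inner_def scalar_prod_def intro!: sum.cong)
  also have "\<dots> = (\<Sum>i\<in>{0..<m}. \<Sum>j\<in>{0..<n}. X $$ (i, j) * Y $$ (i, j))" by (rule sum.swap)
  also have "\<dots> = frob_inner X Y"
    using assms by (auto simp: frob_inner_def scalar_prod_def intro!: sum.cong)
  finally show ?thesis .
qed

text \<open>Left multiplication acts on the columns, where symmetry of X applies; right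
  multiplication is reduced to it by transposition.\<close>

lemma frob_inner_mult_symmetric:
  assumes X: "X \<in> carrier_mat n n" "X\<^sup>T = X"
    and Y: "Y \<in> carrier_mat n n" and Z: "Z \<in> carrier_mat n n"
  shows "frob_inner (X * Y) Z = frob_inner Y (X * Z)" "frob_inner (Y * X) Z = frob_inner Y (Z * X)"
proof -
  have left: "frob_inner (X * Y) Z = frob_inner Y (X * Z)"
    if Y: "Y \<in> carrier_mat n n" and Z: "Z \<in> carrier_mat n n" for Y Z
  proof -
    have XY: "X * Y \<in> carrier_mat n n" and XZ: "X * Z \<in> carrier_mat n n" using X Y Z by auto
    have "frob_inner (X * Y) Z = frob_inner ((X * Y)\<^sup>T) (Z\<^sup>T)"
      by (rule frob_inner_transpose[OF XY Z, symmetric])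
    also have "\<dots> = (\<Sum>j\<in>{0..<n}. (X *\<^sub>v col Y j) \<bullet> col Z j)"
      using X Y Z by (simp add: frob_inner_def mult_mat_vec_def)
    also have "\<dots> = (\<Sum>j\<in>{0..<n}. col Y j \<bullet> (X *\<^sub>v col Z j))"
      using Y Z by (intro sum.cong refl symmetric_form[OF X]) auto
    also have "\<dots> = frob_inner (Y\<^sup>T) ((X * Z)\<^sup>T)"
      using X Y Z by (simp add: frob_inner_def mult_mat_vec_def)
    also have "\<dots> = frob_inner Y (X * Z)" by (rule frob_inner_transpose[OF Y XZ])
    finally show ?thesis .
  qed
  show "frob_inner (X * Y) Z = frob_inner Y (X * Z)" by (rule left[OF Y Z])
  have YX: "Y * X \<in> carrier_mat n n" and ZX: "Z * X \<in> carrier_mat n n" using X Y Z by auto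
  have "frob_inner (Y * X) Z = frob_inner (X * Y\<^sup>T) (Z\<^sup>T)"
    unfolding frob_inner_transpose[OF YX Z, symmetric] transpose_mult[OF Y X(1)] X(2) ..
  also have "\<dots> = frob_inner (Y\<^sup>T) (X * Z\<^sup>T)" using Y Z by (intro left) auto
  also have "\<dots> = frob_inner (Y\<^sup>T) ((Z * X)\<^sup>T)"
    unfolding transpose_mult[OF Z X(1)] X(2) ..
  also have "\<dots> = frob_inner Y (Z * X)" by (rule frob_inner_transpose[OF Y ZX])
  finally show "frob_inner (Y * X) Z = frob_inner Y (Z * X)" .
qed

text \<open>F -> X F X is self-adjoint for the Frobenius inner product, so the squared norm of the
  middle term is the inner product of F with X G X.\<close>

lemma frob_log_convex:
  assumes X: "X \<in> carrier_mat n n" "X\<^sup>T = X" and F: "F \<in> carrier_mat n n"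
  defines "G \<equiv> X * F * X"
  shows "(frob G)\<^sup>2 \<le> frob F * frob (X * G * X)"
proof -
  have G: "G \<in> carrier_mat n n" using X F by (simp add: G_def)
  have XF: "X * F \<in> carrier_mat n n" and GX: "G * X \<in> carrier_mat n n" using X F G by auto
  have "(frob G)\<^sup>2 = frob_inner (X * F * X) G" by (simp add: frob_inner_self[symmetric] G_def)
  also have "\<dots> = frob_inner F (X * (G * X))"
    unfolding frob_inner_mult_symmetric(2)[OF X XF G] by (rule frob_inner_mult_symmetric(1)[OF X F GX])
  also have "X * (G * X) = X * G * X" using X G by simp
  also have "frob_inner F (X * G * X) \<le> frob F * frob (X * G * X)"
    using X F G by (intro frob_Cauchy_Schwarz[of _ n n]) auto
  finally show ?thesis .
qed

text \<open>For c = b / b 0 the sequence log c is convex and starts at 0, so (log c m) / m is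
  nondecreasing: the roots increase, and the geometric bound keeps them bounded. Terms may vanish,
  so the comparison of slopes is stated without logarithms as c m ^ (m + 1) <= c (m + 1) ^
  m.\<close>

lemma log_convex_root_convergent:
  fixes b :: "nat \<Rightarrow> real"
  assumes nonneg: "\<And>m. 0 \<le> b m" and pos: "0 < b 0"
    and convex: "\<And>m. (b (Suc m))\<^sup>2 \<le> b m * b (Suc (Suc m))"
    and bound: "\<And>m. b m \<le> K * \<kappa> ^ m" and \<kappa>: "0 \<le> \<kappa>"
  shows "\<exists>r. (\<lambda>m. root m (b m)) \<longlonglongrightarrow> r"
proof -
  define c where "c m = b m / b 0" for m
  have c: "0 \<le> c m" "c 0 = 1" for m using nonneg pos by (auto simp: c_def)
  have c_convex: "(c (Suc m))\<^sup>2 \<le> c m * c (Suc (Suc m))" for m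
    using convex[of m] pos by (simp add: c_def power2_eq_square field_simps)
  have step: "c m ^ Suc m \<le> c (Suc m) ^ m" for m
  proof (induction m)
    case 0
    show ?case using c by simp
  next
    case (Suc m)
    \<comment> \<open>Both sides carry the extra factor c (m + 1) ^ m, to be cancelled once the
      induction hypothesis has been used.\<close>
    have "c (Suc m) ^ m * c (Suc m) ^ Suc (Suc m) = ((c (Suc m))\<^sup>2) ^ Suc m"
      by (simp add: power_mult[symmetric] power_add[symmetric] mult_2)
    also have "\<dots> \<le> (c m * c (Suc (Suc m))) ^ Suc m" using c_convex by (intro power_mono) auto
    also have "\<dots> = c m ^ Suc m * c (Suc (Suc m)) ^ Suc m" by (rule power_mult_distrib)
    also have "\<dots> \<le> c (Suc m) ^ m * c (Suc (Suc m)) ^ Suc m"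
      using Suc c by (intro mult_right_mono) auto
    finally have *: "c (Suc m) ^ m * c (Suc m) ^ Suc (Suc m) \<le> c (Suc m) ^ m * c (Suc (Suc m)) ^ Suc m" .
    show ?case
    proof (cases "c (Suc m) = 0")
      case False
      then have "0 < c (Suc m) ^ m" using c(1)[of "Suc m"] by simp
      with * show ?thesis by (simp only: mult_le_cancel_left_pos)
    qed (use c in simp)
  qed
  have mono: "root (Suc m) (c (Suc m)) \<le> root (Suc (Suc m)) (c (Suc (Suc m)))" for m
  proof (rule power_le_imp_le_base)
    let ?M = "Suc m" and ?N = "Suc (Suc m)"
    have root_pow: "root (Suc k) (c j) ^ Suc k = c j" for j k
      by (rule real_root_pow_pos2[OF zero_less_Suc c(1)])
    have "(root ?M (c ?M)) ^ (?M * ?N) = ((root ?M (c ?M)) ^ ?M) ^ ?N" by (rule power_mult)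
    also have "\<dots> = c ?M ^ ?N" by (simp only: root_pow)
    also have "\<dots> \<le> c ?N ^ ?M" by (rule step)
    also have "\<dots> = ((root ?N (c ?N)) ^ ?N) ^ ?M" by (simp only: root_pow)
    also have "\<dots> = (root ?N (c ?N)) ^ (?N * ?M)" by (rule power_mult[symmetric])
    also have "?N * ?M = ?M * ?N" by (rule mult.commute)
    finally show "(root ?M (c ?M)) ^ Suc (?M * ?N - 1) \<le> (root ?N (c ?N)) ^ Suc (?M * ?N - 1)" by simp
    show "0 \<le> root ?N (c ?N)" by (rule real_root_ge_zero[OF c(1)])
  qed
  \<comment> \<open>At least 1, so that one base dominates the constant for every exponent: K / b 0
    <= K' <= K' ^ (m + 1).\<close>
  define K' where "K' = max 1 (K / b 0)"
  have "root (Suc m) (c (Suc m)) \<le> K' * \<kappa>" for m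
  proof -
    have "c (Suc m) \<le> K / b 0 * \<kappa> ^ Suc m"
      using bound[of "Suc m"] pos by (simp add: c_def field_simps)
    also have "\<dots> \<le> K' ^ Suc m * \<kappa> ^ Suc m"
    proof (rule mult_right_mono)
      have "1 \<le> K'" by (simp add: K'_def)
      then have "K' ^ 1 \<le> K' ^ Suc m" by (intro power_increasing) auto
      then show "K / b 0 \<le> K' ^ Suc m" by (simp add: K'_def)
    qed (use \<kappa> in simp)
    also have "\<dots> = (K' * \<kappa>) ^ Suc m" by (rule power_mult_distrib[symmetric])
    finally have "root (Suc m) (c (Suc m)) \<le> root (Suc m) ((K' * \<kappa>) ^ Suc m)"
      by (rule real_root_le_mono[OF zero_less_Suc])
    also have "\<dots> = K' * \<kappa>" using \<kappa> by (intro real_root_power_cancel) (auto simp: K'_def)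
    finally show ?thesis .
  qed
  moreover have "incseq (\<lambda>m. root (Suc m) (c (Suc m)))" using mono by (rule incseq_SucI)
  ultimately obtain r where "(\<lambda>m. root (Suc m) (c (Suc m))) \<longlonglongrightarrow> r"
    using incseq_convergent[of "\<lambda>m. root (Suc m) (c (Suc m))" "K' * \<kappa>"] by metis
  \<comment> \<open>The shift keeps \<open>root 0\<close>, which is zero by convention, out of the
    monotonicity argument.\<close>
  then have "(\<lambda>m. root m (c m)) \<longlonglongrightarrow> r" by (rule LIMSEQ_imp_Suc)
  then have "(\<lambda>m. root m (b 0) * root m (c m)) \<longlonglongrightarrow> 1 * r"
    by (intro tendsto_mult LIMSEQ_root_const[OF pos])
  moreover have "root m (b 0) * root m (c m) = root m (b m)" for m
    using pos by (simp add: c_def flip: real_root_mult)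
  ultimately show ?thesis by auto
qed

text \<open>The m-th roots of positive constants tend to 1, so equivalent sequences share the limit
  of their roots.\<close>

lemma equivalent_root_tendsto:
  fixes b e :: "nat \<Rightarrow> real"
  assumes lim: "(\<lambda>m. root m (b m)) \<longlonglongrightarrow> r" and c: "0 < c1" "0 < c2"
    and le: "\<And>m. c1 * b m \<le> e m" "\<And>m. e m \<le> c2 * b m"
  shows "(\<lambda>m. root m (e m)) \<longlonglongrightarrow> r"
proof (rule tendsto_sandwich)
  show "(\<lambda>m. root m (c1 * b m)) \<longlonglongrightarrow> r"
    using tendsto_mult[OF LIMSEQ_root_const[OF c(1)] lim] by (simp add: real_root_mult)
  show "(\<lambda>m. root m (c2 * b m)) \<longlonglongrightarrow> r"
    using tendsto_mult[OF LIMSEQ_root_const[OF c(2)] lim] by (simp add: real_root_mult)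
  show "\<forall>\<^sub>F m in sequentially. root m (c1 * b m) \<le> root m (e m)"
    "\<forall>\<^sub>F m in sequentially. root m (e m) \<le> root m (c2 * b m)"
    using eventually_gt_at_top[of 0] by (eventually_elim, simp add: le real_root_le_mono)+
qed

lemma root_limit_le:
  fixes e :: "nat \<Rightarrow> real"
  assumes lim: "(\<lambda>m. root m (e m)) \<longlonglongrightarrow> r" and K: "0 < K" and d: "0 \<le> d"
    and le: "\<And>m. e m \<le> K * d ^ m"
  shows "r \<le> d"
proof (rule LIMSEQ_le[OF lim])
  have "(\<lambda>m. root m K * d) \<longlonglongrightarrow> 1 * d" using K by (intro tendsto_mult LIMSEQ_root_const) auto
  then show "(\<lambda>m. root m K * d) \<longlonglongrightarrow> d" by simp
  have "root m (e m) \<le> root m K * d" if "1 \<le> m" for m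
  proof -
    have "root m (e m) \<le> root m (K * d ^ m)" using le that by (intro real_root_le_mono) auto
    also have "\<dots> = root m K * d" using that d by (simp add: real_root_mult real_root_power_cancel)
    finally show ?thesis .
  qed
  then show "\<exists>N. \<forall>m\<ge>N. root m (e m) \<le> root m K * d" by blast
qed

lemma energy_norm_contraction:
  assumes A: "A \<in> carrier_mat n n" "spd A" and E: "energy_contraction n A E \<delta>" and \<delta>: "0 \<le> \<delta>"
  shows "w \<in> carrier_vec n \<Longrightarrow> energy_norm A (E *\<^sub>v w) \<le> \<delta> * energy_norm A w"
    and "Y \<in> carrier_mat n n \<Longrightarrow> energy_mat_norm A (E * Y) \<le> \<delta> * energy_mat_norm A Y"
proof -
  define R where "R = mat_sqrt A"
  define X where "X = R * E * mat_inv R"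
  have R: "R \<in> carrier_mat n n" "spd R" using mat_sqrt_spd[OF A] by (auto simp: R_def)
  have Ec: "E \<in> carrier_mat n n" using E by (simp add: energy_contraction_def)
  note X = energy_contraction_similar[OF A E \<delta>, folded R_def, folded X_def]
  note Ri = spd_invertible(1)[OF R]
  show "energy_norm A (E *\<^sub>v w) \<le> \<delta> * energy_norm A w" if w: "w \<in> carrier_vec n"
  proof -
    have Rw: "R *\<^sub>v w \<in> carrier_vec n" using R w by simp
    have "R *\<^sub>v (E *\<^sub>v w) = X *\<^sub>v (R *\<^sub>v w)"
      unfolding assoc_mult_mat_vec[OF R(1) Ec w, symmetric] assoc_mult_mat_vec[OF X(1) R(1) w, symmetric] X(4) ..
    moreover have "norm2 (X *\<^sub>v (R *\<^sub>v w)) \<le> spec_norm X * norm2 (R *\<^sub>v w)"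
      using X(1) Rw by (intro norm2_mult_le_spec_norm) simp
    moreover have "spec_norm X * norm2 (R *\<^sub>v w) \<le> \<delta> * norm2 (R *\<^sub>v w)"
      using X(3) by (rule mult_right_mono) simp
    ultimately show ?thesis by (simp add: energy_norm_def R_def[symmetric])
  qed
  show "energy_mat_norm A (E * Y) \<le> \<delta> * energy_mat_norm A Y" if Y: "Y \<in> carrier_mat n n"
  proof -
    have RY: "R * Y \<in> carrier_mat n n" using R Y by simp
    have "R * (E * Y) = X * (R * Y)"
      unfolding assoc_mult_mat[OF R(1) Ec Y, symmetric] assoc_mult_mat[OF X(1) R(1) Y, symmetric] X(4) ..
    then have "R * (E * Y) * mat_inv R = X * (R * Y * mat_inv R)"
      using assoc_mult_mat[OF X(1) RY Ri] by simp
    moreover have "spec_norm (X * (R * Y * mat_inv R)) \<le> spec_norm X * spec_norm (R * Y * mat_inv R)"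
      using X(1) RY Ri by (intro spec_norm_mult_le[of _ n n _ n]) auto
    moreover have "spec_norm X * spec_norm (R * Y * mat_inv R) \<le> \<delta> * spec_norm (R * Y * mat_inv R)"
      using X(3) by (rule mult_right_mono) simp
    ultimately show ?thesis by (simp only: energy_mat_norm_def R_def[symmetric])
  qed
qed

text \<open>The Frobenius norms of \<open>F m = A\<^sup>1\<^sup>/\<^sup>2 (Y m - A\<^sup>-\<^sup>1) A\<^sup>1\<^sup>/\<^sup>2\<close> are log-convex because
  \<open>F (m + 1) = X F m X\<close> with a symmetric \<open>X\<close>; this is why the limit exists.\<close>

lemma covariance_recursion:
  fixes Y :: "nat \<Rightarrow> real mat"
  assumes A: "A \<in> carrier_mat n n" "spd A" and E: "energy_contraction n A E \<delta>" and \<delta>: "0 \<le> \<delta>"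
    and Y: "\<And>m. Y m \<in> carrier_mat n n"
    and rec: "\<And>m. Y (Suc m) - mat_inv A = E * (Y m - mat_inv A) * E\<^sup>T"
  shows "spec_norm (mat_sqrt A * Y m * mat_sqrt A - 1\<^sub>m n)
      \<le> \<delta> ^ (2 * m) * spec_norm (mat_sqrt A * Y 0 * mat_sqrt A - 1\<^sub>m n)"
    and "Y 0 \<noteq> mat_inv A \<Longrightarrow>
      \<exists>r. (\<lambda>m. root m (energy_mat_norm A (Y m - mat_inv A) / energy_mat_norm A (Y 0 - mat_inv A)))
        \<longlonglongrightarrow> r \<and> r \<le> \<delta>\<^sup>2"
proof -
  define R where "R = mat_sqrt A"
  define X where "X = R * E * mat_inv R"
  \<comment> \<open>This is A^-1, as A^{1/2} squares to A. It converts the symmetric scaling R D R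
    into the scaling R D R^-1 of the energy norm.\<close>
  define J where "J = mat_inv R * mat_inv R"
  define D where "D m = Y m - mat_inv A" for m
  define F where "F m = R * D m * R" for m
  have R: "R \<in> carrier_mat n n" "spd R" "R * R = A" using mat_sqrt_spd[OF A] by (auto simp: R_def)
  have Ec: "E \<in> carrier_mat n n" using E by (simp add: energy_contraction_def)
  have ET: "E\<^sup>T \<in> carrier_mat n n" using Ec by simp
  note X = energy_contraction_similar[OF A E \<delta>, folded R_def, folded X_def]
  note Ri = spd_invertible[OF R(1,2)] and Ai = spd_invertible[OF A]
  have D: "D m \<in> carrier_mat n n" for m unfolding D_def using Ai(1) by (rule minus_carrier_mat)
  have J: "J \<in> carrier_mat n n" using Ri by (simp add: J_def)
  have F: "F m \<in> carrier_mat n n" for m using R(1) D[of m] by (simp add: F_def)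
  have JA: "J * A = 1\<^sub>m n"
  proof -
    have "J * A = mat_inv R * ((mat_inv R * R) * R)"
      unfolding J_def R(3)[symmetric] using R(1) Ri(1) by (simp add: assoc_mult_mat[of _ n n _ n _ n])
    then show ?thesis using R(1) Ri by simp
  qed
  \<comment> \<open>The two intertwining identities carry E and its transpose through R on either
    side.\<close>
  have F_rec: "F (Suc m) = X * F m * X" for m
  proof -
    have "F (Suc m) = R * (E * D m * E\<^sup>T) * R" using rec by (simp add: F_def D_def)
    also have "\<dots> = (R * E) * D m * (E\<^sup>T * R)"
      using R(1) Ec ET D[of m] by (simp add: assoc_mult_mat[of _ n n _ n _ n])
    also have "\<dots> = X * F m * X"
      unfolding X(4,5) F_def using R(1) X(1) D[of m] by (simp add: assoc_mult_mat[of _ n n _ n _ n])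
    finally show ?thesis .
  qed
  have F_eq: "R * Y m * R - 1\<^sub>m n = F m" for m
  proof -
    have "R * mat_inv A * R = 1\<^sub>m n"
    proof -
      have R2: "R * mat_inv A \<in> carrier_mat n n" using R Ai by simp
      have "R * (R * mat_inv A) = 1\<^sub>m n" using assoc_mult_mat[OF R(1) R(1) Ai(1)] R(3) Ai(2) by simp
      from mat_mult_left_right_inverse[OF R(1) R2 this] show ?thesis .
    qed
    moreover have "R * D m * R = R * Y m * R - R * mat_inv A * R"
      unfolding D_def mult_minus_distrib_mat[OF R(1) Y Ai(1)]
      using R(1) Y[of m] Ai(1) by (intro minus_mult_distrib_mat[of _ n n _ _ n]) auto
    ultimately show ?thesis by (simp add: F_def)
  qed
  have F_le: "spec_norm (F m) \<le> (\<delta>\<^sup>2) ^ m * spec_norm (F 0)" for m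
  proof (induction m)
    case (Suc m)
    have "spec_norm (F (Suc m)) \<le> spec_norm X * spec_norm (F m) * spec_norm X"
      unfolding F_rec
      using order_trans[OF spec_norm_mult_le[OF mult_carrier_mat[OF X(1) F] X(1)]
          mult_right_mono[OF spec_norm_mult_le[OF X(1) F] spec_norm_nonneg]] .
    also have "\<dots> \<le> \<delta> * spec_norm (F m) * \<delta>"
      using X(3) \<delta> by (intro mult_mono) auto
    also have "\<dots> = \<delta>\<^sup>2 * spec_norm (F m)" by (simp add: power2_eq_square)
    also have "\<dots> \<le> \<delta>\<^sup>2 * ((\<delta>\<^sup>2) ^ m * spec_norm (F 0))" using Suc by (intro mult_left_mono) auto
    finally show ?case by simp
  qed simp
  show "spec_norm (mat_sqrt A * Y m * mat_sqrt A - 1\<^sub>m n)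
      \<le> \<delta> ^ (2 * m) * spec_norm (mat_sqrt A * Y 0 * mat_sqrt A - 1\<^sub>m n)"
    unfolding R_def[symmetric] F_eq using F_le by (simp add: power_mult)
  assume ne: "Y 0 \<noteq> mat_inv A"
  define e where "e m = energy_mat_norm A (D m)" for m
  \<comment> \<open>Equivalence constant between the Frobenius norm of F and the energy norm of D;
    the added 1 keeps it positive in dimension zero as well.\<close>
  define c where "c = real (n * n) * spec_norm A + 1"
  define b where "b m = frob (F m)" for m
  have c: "0 < c" by (simp add: c_def add_nonneg_pos)
  have e_eq: "e m = spec_norm (F m * J)" for m
  proof -
    have "F m * J = R * D m * ((R * mat_inv R) * mat_inv R)"
      unfolding F_def J_def using R(1) D[of m] Ri(1) by (simp add: assoc_mult_mat[of _ n n _ n _ n])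
    then have "F m * J = R * D m * mat_inv R" using Ri by simp
    then show ?thesis by (simp add: e_def energy_mat_norm_def R_def)
  qed
  have e_upper: "e m \<le> spec_norm (F m) * (spec_norm J + 1)" for m
    unfolding e_eq by (rule order_trans[OF spec_norm_mult_le[OF F J]]) (simp add: mult_left_mono)
  have b_le: "b m \<le> real (n * n) * spec_norm (F m)" for m
    using frob_le_spec_norm[of "F m"] F[of m] by (simp add: b_def)
  have e_lower: "b m \<le> c * e m" for m
  proof -
    have "F m = F m * J * A" using assoc_mult_mat[OF F J A(1)] JA F[of m] by simp
    then have "spec_norm (F m) \<le> e m * spec_norm A"
      unfolding e_eq using spec_norm_mult_le[OF mult_carrier_mat[OF F J] A(1), of m] by simp
    then have "real (n * n) * spec_norm (F m) \<le> real (n * n) * (e m * spec_norm A)"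
      by (rule mult_left_mono) simp
    also have "\<dots> \<le> c * e m" by (simp add: c_def algebra_simps e_eq)
    finally show ?thesis using b_le[of m] by linarith
  qed
  \<comment> \<open>Conjugation by the invertible R is injective, so a vanishing F 0 would force the
    excluded case Y 0 = A^-1.\<close>
  have "b 0 \<noteq> 0"
  proof
    assume "b 0 = 0"
    have "D 0 = 0\<^sub>m n n"
    proof -
      have "F 0 = 0\<^sub>m n n"
      proof (rule eq_matI)
        fix i j assume "i < dim_row (0\<^sub>m n n :: real mat)" "j < dim_col (0\<^sub>m n n :: real mat)"
        then have "\<bar>F 0 $$ (i, j)\<bar> \<le> b 0"
          using F[of 0] order_trans[OF abs_index_le_spec_norm spec_norm_le_frob, of i "F 0" j] by (simp add: b_def)
        then show "F 0 $$ (i, j) = 0\<^sub>m n n $$ (i, j)"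
          using \<open>b 0 = 0\<close> \<open>i < _\<close> \<open>j < _\<close> by simp
      qed (use F[of 0] in auto)
      moreover have "D 0 = mat_inv R * F 0 * mat_inv R"
      proof -
        have "mat_inv R * F 0 * mat_inv R = (mat_inv R * R) * D 0 * (R * mat_inv R)"
          unfolding F_def using R(1) D[of 0] Ri(1) by (simp add: assoc_mult_mat[of _ n n _ n _ n])
        then show ?thesis using Ri D[of 0] by simp
      qed
      ultimately show ?thesis using Ri(1) by simp
    qed
    then have "D 0 $$ (i, j) = 0" if "i < n" "j < n" for i j using that by simp
    then have "Y 0 $$ (i, j) = mat_inv A $$ (i, j)" if "i < n" "j < n" for i j
      using that Y[of 0] Ai(1) by (simp add: D_def)
    then have "Y 0 = mat_inv A" using Y[of 0] Ai(1) by (intro eq_matI) auto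
    with ne show False by simp
  qed
  then have b0: "0 < b 0" by (simp add: b_def less_le)
  then have "0 < c * e 0" using e_lower[of 0] by linarith
  then have e0: "0 < e 0" using c by (simp add: zero_less_mult_iff)
  have b_convex: "(b (Suc m))\<^sup>2 \<le> b m * b (Suc (Suc m))" for m
    using frob_log_convex[OF X(1,2) F[of m]] by (simp add: b_def F_rec)
  have b_bound: "b m \<le> (real (n * n) * spec_norm (F 0)) * (\<delta>\<^sup>2) ^ m" for m
  proof -
    have "b m \<le> real (n * n) * spec_norm (F m)" by (rule b_le)
    also have "\<dots> \<le> real (n * n) * ((\<delta>\<^sup>2) ^ m * spec_norm (F 0))" by (rule mult_left_mono[OF F_le]) simp
    finally show ?thesis by (simp only: mult_ac)
  qed
  obtain r where r: "(\<lambda>m. root m (b m)) \<longlonglongrightarrow> r"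
    using log_convex_root_convergent[OF _ b0 b_convex b_bound] unfolding b_def by fastforce
  have "(\<lambda>m. root m (e m / e 0)) \<longlonglongrightarrow> r"
  proof (rule equivalent_root_tendsto[OF r])
    show "0 < 1 / (c * e 0)" using c e0 by simp
    show "0 < (spec_norm J + 1) / e 0" using e0 by (simp add: add_nonneg_pos)
    fix m
    show "1 / (c * e 0) * b m \<le> e m / e 0" using e_lower[of m] c e0 by (simp add: field_simps)
    have "e m \<le> (spec_norm J + 1) * b m"
      by (rule order_trans[OF e_upper])
        (simp add: b_def mult.commute mult_right_mono spec_norm_le_frob add_nonneg_nonneg)
    then show "e m / e 0 \<le> (spec_norm J + 1) / e 0 * b m" using e0 by (simp add: divide_right_mono)
  qed
  moreover have "r \<le> \<delta>\<^sup>2"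
  proof (rule root_limit_le[OF r, of "real (n * n) * spec_norm (F 0) + 1"])
    show "0 < real (n * n) * spec_norm (F 0) + 1" by (simp add: add_nonneg_pos)
    show "b m \<le> (real (n * n) * spec_norm (F 0) + 1) * (\<delta>\<^sup>2) ^ m" for m
      by (rule order_trans[OF b_bound mult_right_mono]) simp_all
  qed simp
  ultimately show "\<exists>r. (\<lambda>m. root m (energy_mat_norm A (Y m - mat_inv A) / energy_mat_norm A (Y 0 - mat_inv A)))
      \<longlonglongrightarrow> r \<and> r \<le> \<delta>\<^sup>2"
    by (auto simp: e_def D_def)
qed

theorem theorem4p12:
  fixes n :: "nat \<Rightarrow> nat" and A M P :: "nat \<Rightarrow> real mat" and C\<^sub>A :: real and \<nu> L :: nat
    and f :: "real vec" and \<Omega> :: "'w measure" and Z :: "draw \<Rightarrow> 'w \<Rightarrow> real vec"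
    and \<theta> :: "nat \<Rightarrow> 'w \<Rightarrow> real vec"
  assumes nu: "0 < \<nu>" "even \<nu>"
    and dims: "strict_mono n"
    and P_carrier: "\<And>l. 1 \<le> l \<Longrightarrow> P l \<in> carrier_mat (n l) (n (l - 1))"
    and P_full_rank: "\<And>l. 1 \<le> l \<Longrightarrow> vec_space.rank (n l) (P l) = n (l - 1)"
    and A_carrier: "\<And>l. A l \<in> carrier_mat (n l) (n l)"
    and A_spd: "\<And>l. spd (A l)"
    and A_galerkin: "\<And>l. 1 \<le> l \<Longrightarrow> A (l - 1) = transpose_mat (P l) * A l * P l"
    and M_carrier: "\<And>l. 1 \<le> l \<Longrightarrow> M l \<in> carrier_mat (n l) (n l)"
    and M_symmetric: "\<And>l. 1 \<le> l \<Longrightarrow> transpose_mat (M l) = M l"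
    and M_invertible: "\<And>l. 1 \<le> l \<Longrightarrow> invertible_mat (M l)"
    and smoothing_property:
      "\<And>l. 1 \<le> l \<Longrightarrow> 0\<^sub>m (n l) (n l) <\<^sub>L A l \<and> A l \<le>\<^sub>L M l"
    and C_pos: "0 < C\<^sub>A"
    and approximation_property:
      "\<And>l. 1 \<le> l \<Longrightarrow>
         spec_norm (mat_sqrt (M l) *
           (mat_inv (A l) - P l * mat_inv (A (l - 1)) * transpose_mat (P l)) *
           mat_sqrt (M l)) \<le> C\<^sub>A"
    and L: "1 \<le> L"
    and f: "f \<in> carrier_vec (n L)"
    and prob: "prob_space \<Omega>"
    and initial_normal: "\<exists>\<mu> \<Sigma>. mvn \<Omega> (n L) (Z Initial) \<mu> \<Sigma>"
    and smoothing_noise: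
      "\<And>m l k. 1 \<le> l \<Longrightarrow> l \<le> L \<Longrightarrow> k < \<nu> \<Longrightarrow>
         mvn \<Omega> (n l) (Z (Smoothing m l k)) (0\<^sub>v (n l)) (M l + transpose_mat (M l) - A l)"
    and coarse_noise:
      "\<And>m. mvn \<Omega> (n 0) (Z (Coarse m)) (0\<^sub>v (n 0)) (mat_inv (A 0))"
    and independent:
      "prob_space.indep_vars \<Omega> (\<lambda>d. borel_vec (draw_dim n L d)) Z (draws \<nu> L)"
    and chain_0: "\<And>\<omega>. \<omega> \<in> space \<Omega> \<Longrightarrow> \<theta> 0 \<omega> = Z Initial \<omega>"
    and chain_Suc:
      "\<And>m \<omega>. \<omega> \<in> space \<Omega> \<Longrightarrow>
         \<theta> (Suc m) \<omega> =
           mgmc A M P (\<nu> div 2) (\<nu> div 2) (\<lambda>l k. Z (Smoothing m l k) \<omega>) (Z (Coarse m) \<omega>)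
             L f (\<theta> m \<omega>)"
  shows
    "(\<forall>m. energy_norm (A L) (mean_vec \<Omega> (n L) (\<theta> (m + 1)) - mat_inv (A L) *\<^sub>v f)
        \<le> C\<^sub>A / (C\<^sub>A + \<nu>) *
          energy_norm (A L) (mean_vec \<Omega> (n L) (\<theta> m) - mat_inv (A L) *\<^sub>v f)) \<and>
     (\<forall>m. spec_norm (mat_sqrt (A L) * cov_mat \<Omega> (n L) (\<theta> m) (\<theta> m) * mat_sqrt (A L) - 1\<^sub>m (n L))
        \<le> (C\<^sub>A / (C\<^sub>A + \<nu>)) ^ (2 * m) *
          spec_norm (mat_sqrt (A L) * cov_mat \<Omega> (n L) (\<theta> 0) (\<theta> 0) * mat_sqrt (A L) - 1\<^sub>m (n L))) \<and>
     (\<forall>m s. energy_mat_norm (A L) (cov_mat \<Omega> (n L) (\<theta> (m + s)) (\<theta> m))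
        \<le> (C\<^sub>A / (C\<^sub>A + \<nu>)) ^ s *
          energy_mat_norm (A L) (cov_mat \<Omega> (n L) (\<theta> m) (\<theta> m))) \<and>
     (cov_mat \<Omega> (n L) (\<theta> 0) (\<theta> 0) \<noteq> mat_inv (A L) \<longrightarrow>
        (\<exists>r. (\<lambda>m. root m
                (energy_mat_norm (A L) (cov_mat \<Omega> (n L) (\<theta> m) (\<theta> m) - mat_inv (A L)) /
                 energy_mat_norm (A L) (cov_mat \<Omega> (n L) (\<theta> 0) (\<theta> 0) - mat_inv (A L))))
             \<longlonglongrightarrow> r \<and> r \<le> (C\<^sub>A / (C\<^sub>A + \<nu>))\<^sup>2))"
proof -
  define h where "h = \<nu> div 2"
  \<comment> \<open>Evenness of \<nu> makes both halves equally long, so the factor C / (C + 2 h) of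
    the cycle is the claimed one.\<close>
  have h: "2 * h = \<nu>" using nu by (simp add: h_def)
  define \<delta> where "\<delta> = C\<^sub>A / (C\<^sub>A + real \<nu>)"
  have \<delta>: "0 \<le> \<delta>" using C_pos by (simp add: \<delta>_def)
  have AM: "v \<bullet> (A l *\<^sub>v v) \<le> v \<bullet> (M l *\<^sub>v v)" if l: "1 \<le> l" and v: "v \<in> carrier_vec (n l)" for l v
  proof -
    have diff: "M l - A l \<in> carrier_mat (n l) (n l)" using A_carrier by (rule minus_carrier_mat)
    have "psd (M l - A l)" using smoothing_property[OF l] by (simp add: loewner_le_def)
    then have "0 \<le> v \<bullet> ((M l - A l) *\<^sub>v v)" using v by (simp add: psd_iff[OF diff])
    also have "\<dots> = v \<bullet> (M l *\<^sub>v v) - v \<bullet> (A l *\<^sub>v v)"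
      using minus_mult_distrib_mat_vec[OF M_carrier[OF l] A_carrier v] M_carrier[OF l] A_carrier[of l] v
      by (simp add: scalar_prod_minus_distrib[of _ "n l"])
    finally show ?thesis by simp
  qed
  \<comment> \<open>Definiteness is inherited from A <= M; it makes \<open>mat_sqrt (M l)\<close>
    and \<open>mat_inv (M l)\<close> the genuine root and inverse.\<close>
  have M_spd: "spd (M l)" if l: "1 \<le> l" for l
  proof -
    have "0 < v \<bullet> (M l *\<^sub>v v)" if v: "v \<in> carrier_vec (n l)" "v \<noteq> 0\<^sub>v (n l)" for v
    proof -
      have "0 < v \<bullet> (A l *\<^sub>v v)" using A_spd[of l] v by (simp add: spd_iff[OF A_carrier])
      also have "\<dots> \<le> v \<bullet> (M l *\<^sub>v v)" by (rule AM[OF l v(1)])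
      finally show ?thesis .
    qed
    then show ?thesis using M_symmetric[OF l] by (simp add: spd_iff[OF M_carrier[OF l]])
  qed
  define E where "E = vcycle_mat A M P h L"
  have E: "energy_contraction (n L) (A L) E \<delta>"
    unfolding E_def \<delta>_def h[symmetric]
    by (rule vcycle_contraction[where n = n and A = A and M = M and P = P, OF P_carrier A_carrier A_spd A_galerkin M_carrier M_spd AM C_pos
          approximation_property])
  interpret prob_space \<Omega> by (rule prob)
  have draw_mvn: "\<exists>\<mu> \<Sigma>. mvn \<Omega> (draw_dim n L d) (Z d) \<mu> \<Sigma>" if d: "d \<in> draws \<nu> L" for d
  proof -
    consider "d = Initial" | m l k where "d = Smoothing m l k" "1 \<le> l" "l \<le> L" "k < \<nu>" | m where "d = Coarse m"
      using d by (auto simp: draws_def)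
    then show ?thesis
    proof cases
      case 1
      then show ?thesis using initial_normal by simp
    next
      case (2 m l k)
      then show ?thesis using smoothing_noise[OF 2(2-4), of m] by auto
    next
      case (3 m)
      then show ?thesis using coarse_noise[of m] by auto
    qed
  qed
  have draw_sq: "square_integrable \<Omega> (\<lambda>\<omega>. a \<bullet> Z d \<omega>)"
    if "d \<in> draws \<nu> L" "a \<in> carrier_vec (draw_dim n L d)" for d a
    using draw_mvn[OF that(1)] mvn_moments(2)[OF _ that(2)] by blast
  interpret uncorrelated_draws \<Omega> "draws \<nu> L" "draw_dim n L" Z
  proof
    show "Z d \<omega> \<in> carrier_vec (draw_dim n L d)" if "d \<in> draws \<nu> L" "\<omega> \<in> space \<Omega>" for d \<omega>
      \<comment> \<open>The carrier fact has a test vector among its premises; the zero vector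
        serves.\<close>
      using draw_mvn[OF that(1)] mvn_moments(1)[OF _ zero_carrier_vec that(2)] by blast
    show "covariance \<Omega> (\<lambda>\<omega>. a \<bullet> Z d \<omega>) (\<lambda>\<omega>. b \<bullet> Z d' \<omega>) = 0"
      if "d \<in> draws \<nu> L" "d' \<in> draws \<nu> L" "d \<noteq> d'" "a \<in> carrier_vec (draw_dim n L d)"
        "b \<in> carrier_vec (draw_dim n L d')" for d d' a b
      by (rule indep_vars_uncorrelated[OF independent that draw_sq[OF that(1,4)] draw_sq[OF that(2,5)]])
  qed (rule draw_sq)
  \<comment> \<open>\<open>D m\<close> holds the draws of transition m, \<open>H m\<close> the
    initial state and the draws of all earlier transitions; the transition number inside each draw
    makes them disjoint.\<close>
  define D where "D m = insert (Coarse m) {Smoothing m l k | l k. 1 \<le> l \<and> l \<le> L \<and> k < 2 * h}" for m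
  define H where "H m = insert Initial (\<Union>j<m. D j)" for m
  define \<Phi> where "\<Phi> m \<omega> f \<theta> = mgmc A M P h h (\<lambda>l k. Z (Smoothing m l k) \<omega>) (Z (Coarse m) \<omega>) L f \<theta>"
    for m \<omega> f \<theta>
  have step: "affine_update (D m) (n L) (A L) E (\<Phi> m)" for m
    unfolding D_def E_def \<Phi>_def
  proof (rule affine_update_mgmc[where n = n and A = A and M = M and P = P and sm = "Smoothing m" and
        co = "Coarse m", OF P_carrier A_carrier A_spd A_galerkin M_carrier M_spd])
    show "Coarse m \<in> draws \<nu> L" by (simp add: draws_def)
    show "expectation (\<lambda>\<omega>. a \<bullet> Z (Coarse m) \<omega>) = 0" if "a \<in> carrier_vec (n 0)" for a
      using mvn_moments(3)[OF coarse_noise that] that by simp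
    show "covariance \<Omega> (\<lambda>\<omega>. a \<bullet> Z (Coarse m) \<omega>) (\<lambda>\<omega>. b \<bullet> Z (Coarse m) \<omega>) = a \<bullet> (mat_inv (A 0) *\<^sub>v b)"
      if "a \<in> carrier_vec (n 0)" "b \<in> carrier_vec (n 0)" for a b
      by (rule mvn_moments(4)[OF coarse_noise that])
    fix l k assume l: "1 \<le> l" "l \<le> L" "k < 2 * h"
    then have k: "k < \<nu>" using h by simp
    show "Smoothing m l k \<in> draws \<nu> L \<and> draw_dim n L (Smoothing m l k) = n l"
      using l k by (auto simp: draws_def)
    show "expectation (\<lambda>\<omega>. a \<bullet> Z (Smoothing m l k) \<omega>) = 0" if "a \<in> carrier_vec (n l)" for a
      using mvn_moments(3)[OF smoothing_noise[OF l(1,2) k] that] that by simp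
    show "covariance \<Omega> (\<lambda>\<omega>. a \<bullet> Z (Smoothing m l k) \<omega>) (\<lambda>\<omega>. b \<bullet> Z (Smoothing m l k) \<omega>) =
        a \<bullet> ((M l + (M l)\<^sup>T - A l) *\<^sub>v b)"
      if "a \<in> carrier_vec (n l)" "b \<in> carrier_vec (n l)" for a b
      by (rule mvn_moments(4)[OF smoothing_noise[OF l(1,2) k] that])
  qed auto
  have initial_lin: "lin_vec (H 0) (n L) (\<theta> 0)"
  proof (rule lin_vec_cong)
    show "lin_vec (H 0) (n L) (Z Initial)" using lin_vec_draw[of Initial "H 0"] by (simp add: H_def draws_def)
  qed (simp add: chain_0)
  have H_Suc: "H (Suc m) = H m \<union> D m" for m by (auto simp: H_def lessThan_Suc)
  have H_disj: "H m \<inter> D m = {}" for m by (auto simp: H_def D_def)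
  have \<theta>_Suc: "\<theta> (Suc m) \<omega> = \<Phi> m \<omega> f (\<theta> m \<omega>)" if "\<omega> \<in> space \<Omega>" for m \<omega>
    using chain_Suc[OF that] by (simp add: \<Phi>_def h_def)
  note moments = affine_chain[where X = \<theta> and \<Phi> = \<Phi> and H = H and D = D and A = "A L" and n = "n L" and E = E,
      OF A_carrier A_spd f step initial_lin \<theta>_Suc H_Suc H_disj]
  have mean_carrier: "mean_vec \<Omega> (n L) (\<theta> m) - mat_inv (A L) *\<^sub>v f \<in> carrier_vec (n L)" for m
    using cov_mat_carrier(2) spd_inverse_mult_vec(1)[OF A_carrier A_spd f] by simp
  have 1: "energy_norm (A L) (mean_vec \<Omega> (n L) (\<theta> (m + 1)) - mat_inv (A L) *\<^sub>v f)
      \<le> \<delta> * energy_norm (A L) (mean_vec \<Omega> (n L) (\<theta> m) - mat_inv (A L) *\<^sub>v f)" for m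
    using energy_norm_contraction(1)[OF A_carrier A_spd E \<delta> mean_carrier] moments(1) by simp
  have 3: "energy_mat_norm (A L) (cov_mat \<Omega> (n L) (\<theta> (m + s)) (\<theta> m))
      \<le> \<delta> ^ s * energy_mat_norm (A L) (cov_mat \<Omega> (n L) (\<theta> m) (\<theta> m))" for m s
  proof (induction s)
    case (Suc s)
    have "energy_mat_norm (A L) (cov_mat \<Omega> (n L) (\<theta> (m + Suc s)) (\<theta> m))
        \<le> \<delta> * energy_mat_norm (A L) (cov_mat \<Omega> (n L) (\<theta> (m + s)) (\<theta> m))"
      using energy_norm_contraction(2)[OF A_carrier A_spd E \<delta> cov_mat_carrier(1)] moments(3) by simp
    also have "\<dots> \<le> \<delta> * (\<delta> ^ s * energy_mat_norm (A L) (cov_mat \<Omega> (n L) (\<theta> m) (\<theta> m)))"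
      by (rule mult_left_mono[OF Suc \<delta>])
    finally show ?case by simp
  qed simp
  have C: "cov_mat \<Omega> (n L) (\<theta> (Suc m)) (\<theta> (Suc m)) - mat_inv (A L) =
      E * (cov_mat \<Omega> (n L) (\<theta> m) (\<theta> m) - mat_inv (A L)) * E\<^sup>T" for m
    by (rule moments(2))
  note 24 = covariance_recursion[where Y = "\<lambda>m. cov_mat \<Omega> (n L) (\<theta> m) (\<theta> m)",
      OF A_carrier A_spd E \<delta> cov_mat_carrier(1) C]
  show ?thesis
    unfolding \<delta>_def[symmetric] by (intro conjI allI impI 1 24 3)
qed

end
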